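(* Let $a\in(0,\infty)$, $\beta\in(0,1)$, $1<p<q<\infty$ and $1/q=1/p-\beta$. Then there exists a positive constant $C$, depending on $a$, $p$ and $q$, such that the following hold. (i) If $b\in\mathrm{BMO}(\gamma)$, then for all $f\in L_c^\infty(\gamma)$, $$\left\|\widetilde{[b,I_a^\beta]}(f)\right\|_{L^q(\gamma)}\le C\|b\|_\ast\|f\|_{L^p(\gamma)}.$$ Moreover, the sublinear operator $\widetilde{[b,I_a^\beta]}$ admits a unique bounded extension from $L^p(\gamma)$ to $L^q(\gamma)$ with norm at most a constant multiple of $\|b\|_\ast$. (ii) If $b\in L^1(\gamma)$ and $[b,\widetilde I_a^\beta]$ is bounded from $L^p(\gamma)\cap L_c^\infty(\gamma)$ to $L^q(\gamma)$, then $b\in\mathrm{BMO}(\gamma)$ and $$\|b\|_{\mathrm{BMO}(\gamma)}\le\|b\|_{L^1(\gamma)}+C\left\|[b,\widetilde I_a^\beta]\right\|_{L^p(\gamma)\to L^q(\gamma)}.$$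
   Context: Fix $n\in\{1,2,\dots\}$; constants may depend on $n$. Let $d\gamma(x)=\pi^{-n/2}e^{-|x|^2}dx$ be the Gauss measure on $\mathbb R^n$, where $|\cdot|$ is the Euclidean norm. $B(x,r)=\{y\in\mathbb R^n:|x-y|<r\}$; for a ball $B$, $c_B$ and $r_B$ denote its center and radius. Let $m(x)=\min\{1,1/|x|\}$ for $x\in\mathbb R^n$ (with $m(0)=1$). For $a\in(0,\infty)$, $\mathcal B_a$ is the set of all balls $B\subset\mathbb R^n$ with $r_B\le a\,m(c_B)$. For $b$ locally integrable and $B$ a ball, $b_B=\frac1{\gamma(B)}\int_B b\,d\gamma$. For $b\in L^1(\gamma)$ set $$\|b\|_\ast=\sup_{B\in\mathcal B_1}\frac1{\gamma(B)}\int_B|b(x)-b_B|\,d\gamma(x);$$ $\mathrm{BMO}(\gamma)$ is the set of $b\in L^1(\gamma)$ with $\|b\|_\ast<\infty$, with norm $\|b\|_{\mathrm{BMO}(\gamma)}=\|b\|_\ast+\|b\|_{L^1(\gamma)}$. $L_c^\infty(\gamma)$ is the set of functions in $L^\infty(\gamma)$ with compact support. Let $V(x,y)=\gamma(B(x,|x-y|))$. For $a\in(0,\infty)$, $\beta\in(0,1)$ define $$\widetilde I_a^\beta(f)(x)=\int_{B(x,\,am(x))}\frac{f(y)}{[e^{-|x|^2}|x-y|^n]^{1-\beta}}\,d\gamma(y).$$ For $b\in L^1(\gamma)$ (in particular for $b\in\mathrm{BMO}(\gamma)$), $f\in L_c^\infty(\gamma)$ and $x\in\mathbb R^n$ define the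 commutator $$[b,\widetilde I_a^\beta](f)=b\,\widetilde I_a^\beta(f)-\widetilde I_a^\beta(bf)$$ and $$\widetilde{[b,I_a^\beta]}(f)(x)=\int_{B(x,\,am(x))}\frac{|b(x)-b(y)||f(y)|}{[V(x,y)]^{1-\beta}}\,d\gamma(y).$$ An operator $T$ is bounded from a normed space $\mathcal X$ to a normed space $\mathcal Y$ if there is a constant $C\ge0$ with $\|T(f)\|_{\mathcal Y}\le C\|f\|_{\mathcal X}$ for all $f\in\mathcal X$; $\|T\|_{\mathcal X\to\mathcal Y}$ denotes its operator norm. Here $L^p(\gamma)\cap L_c^\infty(\gamma)$ carries the $L^p(\gamma)$ norm, and $\|[b,\widetilde I_a^\beta]\|_{L^p(\gamma)\to L^q(\gamma)}$ is the corresponding operator norm (supremum over $f\in L_c^\infty(\gamma)$ with $\|f\|_{L^p(\gamma)}=1$). *)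

theory Defs
  imports "HOL-Analysis.Analysis"
begin

definition gauss :: "(real ^ 'n) measure" where
  "gauss = density lborel
     (\<lambda>x. ennreal (pi powr (- (real CARD('n) / 2)) * exp (- (norm x)\<^sup>2)))"

text \<open>The case split is needed because \<open>1 / 0 = 0\<close> in HOL.\<close>

definition admissible :: "real ^ 'n \<Rightarrow> real" where
  "admissible x = (if x = 0 then 1 else min 1 (1 / norm x))"

definition adm_balls :: "real \<Rightarrow> (real ^ 'n) set set" where
  "adm_balls a = {ball c r | c r. 0 < r \<and> r \<le> a * admissible c}"

text \<open>
  Elements of Lebesgue spaces are represented by Borel functions on the whole space, identified when
  they agree almost everywhere. Norms and seminorms take values in \<open>ennreal\<close>, so that
  they are meaningful (possibly infinite) for all measurable functions.
\<close>

definition ennreal_powr :: "ennreal \<Rightarrow> real \<Rightarrow> ennreal" where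
  "ennreal_powr t p = (if t = \<infinity> then \<infinity> else ennreal (enn2real t powr p))"

text \<open>The norm of \<open>L\<^sup>p(\<gamma>)\<close>, for functions with values in \<open>[0, \<infinity>]\<close> and for real functions.\<close>

definition eLp_norm :: "real \<Rightarrow> (real ^ 'n \<Rightarrow> ennreal) \<Rightarrow> ennreal" where
  "eLp_norm p g = ennreal_powr (\<integral>\<^sup>+ x. ennreal_powr (g x) p \<partial>gauss) (1 / p)"

definition Lp_norm :: "real \<Rightarrow> (real ^ 'n \<Rightarrow> real) \<Rightarrow> ennreal" where
  "Lp_norm p f = eLp_norm p (\<lambda>x. ennreal \<bar>f x\<bar>)"

definition Lp :: "real \<Rightarrow> (real ^ 'n \<Rightarrow> real) set" where
  "Lp p = {f \<in> borel_measurable gauss. Lp_norm p f < \<infinity>}"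

text \<open>Essentially bounded functions vanishing almost everywhere outside a compact set.\<close>

definition Linf_c :: "(real ^ 'n \<Rightarrow> real) set" where
  "Linf_c = {f \<in> borel_measurable gauss.
     (\<exists>M. AE x in gauss. \<bar>f x\<bar> \<le> M) \<and>
     (\<exists>K. compact K \<and> (AE x in gauss. x \<notin> K \<longrightarrow> f x = 0))}"

definition ball_avg :: "(real ^ 'n \<Rightarrow> real) \<Rightarrow> (real ^ 'n) set \<Rightarrow> real" where
  "ball_avg b B = (LINT x:B|gauss. b x) / measure gauss B"

definition bmo_seminorm :: "(real ^ 'n \<Rightarrow> real) \<Rightarrow> ennreal" where
  "bmo_seminorm b = (SUP B\<in>adm_balls 1.
     (\<integral>\<^sup>+ x\<in>B. ennreal \<bar>b x - ball_avg b B\<bar> \<partial>gauss) / emeasure gauss B)"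

definition BMO :: "(real ^ 'n \<Rightarrow> real) set" where
  "BMO = {b \<in> Lp 1. bmo_seminorm b < \<infinity>}"

definition bmo_norm :: "(real ^ 'n \<Rightarrow> real) \<Rightarrow> ennreal" where
  "bmo_norm b = bmo_seminorm b + Lp_norm 1 b"

definition V :: "real ^ 'n \<Rightarrow> real ^ 'n \<Rightarrow> real" where
  "V x y = measure gauss (ball x (norm (x - y)))"

definition frac_int :: "real \<Rightarrow> real \<Rightarrow> (real ^ 'n \<Rightarrow> real) \<Rightarrow> real ^ 'n \<Rightarrow> real" where
  "frac_int a \<beta> f x = (LINT y:ball x (a * admissible x)|gauss.
     f y / (exp (- (norm x)\<^sup>2) * norm (x - y) ^ CARD('n)) powr (1 - \<beta>))"

text \<open>
  For \<open>b \<in> L\<^sup>1(\<gamma>)\<close> the integral defining \<open>frac_int a \<beta> (\<lambda>y. b y * f y) x\<close> converges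
  absolutely for almost every \<open>x\<close> only; on the exceptional null set it is \<open>0\<close> by convention.
\<close>

definition commutator ::
  "real \<Rightarrow> real \<Rightarrow> (real ^ 'n \<Rightarrow> real) \<Rightarrow> (real ^ 'n \<Rightarrow> real) \<Rightarrow> real ^ 'n \<Rightarrow> real" where
  "commutator a \<beta> b f x = b x * frac_int a \<beta> f x - frac_int a \<beta> (\<lambda>y. b y * f y) x"

definition abs_commutator ::
  "real \<Rightarrow> real \<Rightarrow> (real ^ 'n \<Rightarrow> real) \<Rightarrow> (real ^ 'n \<Rightarrow> real) \<Rightarrow> real ^ 'n \<Rightarrow> ennreal" where
  "abs_commutator a \<beta> b f x = (\<integral>\<^sup>+ y\<in>ball x (a * admissible x).
     ennreal (\<bar>b x - b y\<bar> * \<bar>f y\<bar> / V x y powr (1 - \<beta>)) \<partial>gauss)"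

text \<open>
  Boundedness and operator norm of \<open>T\<close> from a subspace \<open>D\<close> of \<open>L\<^sup>p(\<gamma>)\<close>, with the
  \<open>L\<^sup>p\<close> norm, to \<open>L\<^sup>q(\<gamma>)\<close>.
\<close>

definition bounded_op ::
  "real \<Rightarrow> real \<Rightarrow> (real ^ 'n \<Rightarrow> real) set \<Rightarrow>
   ((real ^ 'n \<Rightarrow> real) \<Rightarrow> real ^ 'n \<Rightarrow> real) \<Rightarrow> bool" where
  "bounded_op p q D T \<longleftrightarrow>
     (\<exists>C\<ge>0. \<forall>f\<in>D. T f \<in> Lp q \<and> Lp_norm q (T f) \<le> ennreal C * Lp_norm p f)"

definition op_norm ::
  "real \<Rightarrow> real \<Rightarrow> (real ^ 'n \<Rightarrow> real) set \<Rightarrow>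
   ((real ^ 'n \<Rightarrow> real) \<Rightarrow> real ^ 'n \<Rightarrow> real) \<Rightarrow> ennreal" where
  "op_norm p q D T = (SUP f\<in>{f\<in>D. Lp_norm p f = 1}. Lp_norm q (T f))"

text \<open>
  Subadditivity is one-sided, \<open>T (f + g) \<le> T f + T g\<close>; with absolute homogeneity it forces
  \<open>T f \<ge> 0\<close> almost everywhere. With \<open>\<bar>T (f + g)\<bar> \<le> \<bar>T f\<bar> + \<bar>T g\<bar>\<close> instead, bounded extensions
  would not be unique (values could be multiplied by arbitrary signs).
\<close>

definition sublinear_op ::
  "(real ^ 'n \<Rightarrow> real) set \<Rightarrow> ((real ^ 'n \<Rightarrow> real) \<Rightarrow> real ^ 'n \<Rightarrow> real) \<Rightarrow> bool" where
  "sublinear_op D T \<longleftrightarrow>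
     (\<forall>f\<in>D. \<forall>g\<in>D. AE x in gauss. T (\<lambda>y. f y + g y) x \<le> T f x + T g x) \<and>
     (\<forall>f\<in>D. \<forall>c. AE x in gauss. T (\<lambda>y. c * f y) x = \<bar>c\<bar> * T f x)"

text \<open>
  Extensions to all of \<open>L\<^sup>p(\<gamma>)\<close> of an operator \<open>S\<close> given on \<open>Linf_c\<close>. That \<open>T\<close> respects
  almost everywhere equality follows from sublinearity and boundedness.
\<close>

definition bounded_sublinear_extension ::
  "real \<Rightarrow> real \<Rightarrow> ((real ^ 'n \<Rightarrow> real) \<Rightarrow> real ^ 'n \<Rightarrow> ennreal) \<Rightarrow>
   ((real ^ 'n \<Rightarrow> real) \<Rightarrow> real ^ 'n \<Rightarrow> real) \<Rightarrow> bool" where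
  "bounded_sublinear_extension p q S T \<longleftrightarrow>
     sublinear_op (Lp p) T \<and> bounded_op p q (Lp p) T \<and>
     (\<forall>f\<in>Linf_c. AE x in gauss. S f x = ennreal (T f x))"

end

theory Submission
  imports Defs
begin

text \<open>
  (i) On admissible balls the Gauss measure is a constant multiple of Lebesgue measure up to bounded
  factors, so \<open>V x y\<close> is comparable to \<open>exp (- (norm x)\<^sup>2) * norm (x - y) ^ n\<close>. Cutting the kernel at
  \<open>V x y \<approx> 2 powr - k\<close> dominates the commutator by operators \<open>T\<^sub>k\<close>, \<open>k \<ge> 0\<close>. Hoelder's inequality, Fubini's
  theorem and the John--Nirenberg moments of \<open>b\<close> bound \<open>T\<^sub>k\<close> from \<open>L\<^sup>s\<close> to \<open>L\<^sup>r\<close> by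
  \<open>2 powr (k * (1 / s - 1 / r - \<beta>))\<close> for all \<open>1 < s < r\<close>. At \<open>(s, r) = (p, q)\<close> there is neither growth
  nor decay, and real interpolation between four neighbouring pairs of exponents sums the scales.

  (ii) Let \<open>m\<close> be a median of \<open>b\<close> on a small cube, and let \<open>E\<close> and \<open>F\<close> be the parts where \<open>b \<ge> m\<close> and
  \<open>b \<le> m\<close>. As the kernel is positive, the commutator applied to the indicator of \<open>F\<close> is at least a
  constant times \<open>b - m\<close> on \<open>E\<close>. This bounds the oscillation of \<open>b\<close> on cubes that are small relative to
  \<open>a\<close>; the oscillation on a cube is bounded by that on its subcubes of half the size, so
  the bound extends to all admissible balls.
\<close>

text \<open>The Gauss measure is not doubling: comparison constants exist only over distances up to
  a fixed multiple of \<open>admissible x\<close>. So every estimate stays at that scale, and a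
  bound known for small cubes reaches a larger multiple by finitely many doublings of the side.

  John--Nirenberg is what frees the exponents in (i): Hoelder's inequality for the pair (s, r) asks
  for moments of b of the orders s / (s - 1) and r, which exceed any fixed order when s is close to
  1. Since 1 / q = 1 / p - \<beta> makes (p, q) the critical pair, a small shift of the reciprocals
  tips the balance towards small or towards large scales, as desired.

  In (ii) b is merely integrable and the kernel singular, so the two integrals in the commutator
  must be shown to converge at almost every point before their difference may be written as one
  integral.\<close>

section \<open>Real powers and the Hoelder inequality in the extended half-line\<close>

lemma ennreal_powr_ennreal [simp]: "0 \<le> x \<Longrightarrow> ennreal_powr (ennreal x) r = ennreal (x powr r)"
  by (simp add: ennreal_powr_def)

lemma ennreal_powr_top [simp]: "ennreal_powr top r = top"
  by (simp add: ennreal_powr_def)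

lemma ennreal_powr_0 [simp]: "ennreal_powr 0 r = 0"
  by (simp add: ennreal_powr_def)

lemma ennreal_powr_1 [simp]: "ennreal_powr 1 r = 1"
  by (simp add: ennreal_powr_def)

lemma ennreal_powr_one [simp]: "ennreal_powr x 1 = x"
  by (cases x) auto

lemma ennreal_powr_eq_top_iff [simp]: "ennreal_powr x r = top \<longleftrightarrow> x = top"
  by (cases x) auto

lemma ennreal_powr_less_top_iff [simp]: "ennreal_powr x r < top \<longleftrightarrow> x < top"
  by (simp add: less_top[symmetric])

lemma ennreal_powr_eq_0_iff [simp]: "ennreal_powr x r = 0 \<longleftrightarrow> x = 0"
  by (cases x) auto

lemma ennreal_powr_mono: "x \<le> y \<Longrightarrow> 0 \<le> r \<Longrightarrow> ennreal_powr x r \<le> ennreal_powr y r"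
  by (cases x; cases y) (auto intro!: ennreal_leI powr_mono2 simp: top_unique)

lemma ennreal_powr_powr:
  assumes "0 < r" "0 < s"
  shows "ennreal_powr (ennreal_powr x r) s = ennreal_powr x (r * s)"
  using assms by (cases x) (auto simp: powr_powr)

lemma ennreal_powr_le_iff:
  assumes "0 < r"
  shows "ennreal_powr x r \<le> ennreal_powr y r \<longleftrightarrow> x \<le> y"
proof
  assume "ennreal_powr x r \<le> ennreal_powr y r"
  then have "ennreal_powr (ennreal_powr x r) (1 / r) \<le> ennreal_powr (ennreal_powr y r) (1 / r)"
    using assms by (simp add: ennreal_powr_mono)
  moreover have "ennreal_powr (ennreal_powr z r) (1 / r) = z" for z
    using assms ennreal_powr_powr[of r "1 / r" z] by simp
  ultimately show "x \<le> y" by simp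
qed (use assms in \<open>auto intro: ennreal_powr_mono\<close>)

lemma ennreal_powr_mult:
  assumes "0 < r"
  shows "ennreal_powr (x * y) r = ennreal_powr x r * ennreal_powr y r"
proof (cases x)
  case (real u)
  show ?thesis
  proof (cases y)
    case (real v)
    then show ?thesis using \<open>x = ennreal u\<close> \<open>0 \<le> u\<close>
      by (simp add: ennreal_mult[symmetric] powr_mult)
  qed (cases "u = 0"; use real in \<open>auto simp: ennreal_mult_top\<close>)
qed (cases "y = 0"; auto simp: ennreal_top_mult)

lemma ennreal_powr_add:
  assumes "0 < r" "0 < s"
  shows "ennreal_powr x (r + s) = ennreal_powr x r * ennreal_powr x s"
  using assms by (cases x) (auto simp: powr_add ennreal_mult)

lemma measurable_ennreal_powr [measurable]:
  assumes [measurable]: "f \<in> borel_measurable M"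
  shows "(\<lambda>x. ennreal_powr (f x) r) \<in> borel_measurable M"
  unfolding ennreal_powr_def by measurable

lemma ennreal_powr_sum_le:
  assumes "1 \<le> r"
  shows "ennreal_powr (x + y) r \<le> ennreal (2 powr r) * (ennreal_powr x r + ennreal_powr y r)"
proof -
  have "ennreal_powr (x + y) r \<le> ennreal_powr (2 * max x y) r"
    using assms by (intro ennreal_powr_mono) (auto simp: mult_2 intro!: add_mono)
  also have "\<dots> = ennreal (2 powr r) * ennreal_powr (max x y) r"
    using assms ennreal_powr_ennreal[of 2 r] by (simp add: ennreal_powr_mult)
  also have "ennreal_powr (max x y) r \<le> ennreal_powr x r + ennreal_powr y r"
    by (auto simp: max_def)
  finally show ?thesis by (simp add: mult_left_mono)
qed

lemma ennreal_Young:
  fixes u v :: ennreal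
  assumes "1 < s" "1 < t" "1 / s + 1 / t = 1"
  shows "u * v \<le> ennreal (1 / s) * ennreal_powr u s + ennreal (1 / t) * ennreal_powr v t"
proof (cases u)
  case (real x)
  show ?thesis
  proof (cases v)
    case (real y)
    then show ?thesis using \<open>u = ennreal x\<close> \<open>0 \<le> x\<close> assms Youngs_inequality[of s t x y]
      by (simp add: ennreal_mult[symmetric] ennreal_plus[symmetric] del: ennreal_plus)
  qed (use assms in \<open>simp add: ennreal_mult_top\<close>)
qed (use assms in \<open>simp add: ennreal_mult_top\<close>)

text \<open>If a norm vanishes, so does the product almost everywhere; if both are nonzero and one
  is infinite, the right-hand side is infinite. Otherwise both functions are divided by their norms,
  and Young's inequality integrates to 1 / s + 1 / t = 1.\<close>

lemma nn_integral_Hoelder: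
  assumes [measurable]: "u \<in> borel_measurable M" "v \<in> borel_measurable M"
    and st: "1 < s" "1 < t" "1 / s + 1 / t = 1"
  shows "(\<integral>\<^sup>+x. u x * v x \<partial>M)
    \<le> ennreal_powr (\<integral>\<^sup>+x. ennreal_powr (u x) s \<partial>M) (1 / s)
      * ennreal_powr (\<integral>\<^sup>+x. ennreal_powr (v x) t \<partial>M) (1 / t)"
    (is "?L \<le> ennreal_powr ?U _ * ennreal_powr ?V _")
proof -
  have pos: "0 < s" "0 < t" using st by auto
  consider "?U = 0 \<or> ?V = 0" | "?U \<noteq> 0" "?V \<noteq> 0" "?U = top \<or> ?V = top"
    | X Y where "?U = ennreal X" "?V = ennreal Y" "0 < X" "0 < Y"
    by (cases ?U; cases ?V) (auto simp: less_le)
  then show ?thesis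
  proof cases
    case 1
    then have "(AE x in M. u x = 0) \<or> (AE x in M. v x = 0)"
      by (subst (asm) (1 2) nn_integral_0_iff_AE) auto
    then have "AE x in M. u x * v x = 0" by auto
    then have "?L = 0" by (subst nn_integral_0_iff_AE) auto
    then show ?thesis by simp
  next
    case 2
    then show ?thesis by (auto simp: ennreal_top_mult ennreal_mult_top)
  next
    case 3
    define \<alpha> \<beta> where "\<alpha> = X powr (1 / s)" and "\<beta> = Y powr (1 / t)"
    have ab: "0 < \<alpha>" "0 < \<beta>" using 3 by (auto simp: \<alpha>_def \<beta>_def)
    have *: "ennreal (inverse z) * ennreal z = 1" if "0 < z" for z
      using that by (simp add: ennreal_mult[symmetric])
    have "?L = (\<integral>\<^sup>+x. ennreal (\<alpha> * \<beta>) * ((ennreal (inverse \<alpha>) * u x) * (ennreal (inverse \<beta>) * v x)) \<partial>M)"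
    proof (intro nn_integral_cong)
      fix x
      have "ennreal (\<alpha> * \<beta>) * ((ennreal (inverse \<alpha>) * u x) * (ennreal (inverse \<beta>) * v x))
         = (ennreal (inverse \<alpha>) * ennreal \<alpha>) * (ennreal (inverse \<beta>) * ennreal \<beta>) * (u x * v x)"
        using ab by (simp add: ennreal_mult mult_ac)
      then show "u x * v x = ennreal (\<alpha> * \<beta>) * ((ennreal (inverse \<alpha>) * u x) * (ennreal (inverse \<beta>) * v x))"
        using *[OF ab(1)] *[OF ab(2)] by simp
    qed
    also have "\<dots> \<le> (\<integral>\<^sup>+x. ennreal (\<alpha> * \<beta>) * (ennreal (1 / s) * ennreal_powr (ennreal (inverse \<alpha>) * u x) s
        + ennreal (1 / t) * ennreal_powr (ennreal (inverse \<beta>) * v x) t) \<partial>M)"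
      by (intro nn_integral_mono mult_left_mono ennreal_Young st) auto
    also have "\<dots> = ennreal (\<alpha> * \<beta>) * (ennreal (1 / s) * (ennreal (inverse \<alpha> powr s) * ?U)
        + ennreal (1 / t) * (ennreal (inverse \<beta> powr t) * ?V))"
      using ab pos by (simp add: nn_integral_cmult nn_integral_add ennreal_powr_mult)
    also have "inverse \<alpha> powr s = inverse X"
      using 3 pos powr_powr[of X "- (1 / s)" s] by (simp add: \<alpha>_def powr_minus)
    also have "inverse \<beta> powr t = inverse Y"
      using 3 pos powr_powr[of Y "- (1 / t)" t] by (simp add: \<beta>_def powr_minus)
    also have "ennreal (inverse X) * ?U = 1" using 3 * by simp
    also have "ennreal (inverse Y) * ?V = 1" using 3 * by simp
    also have "ennreal (1 / s) * 1 + ennreal (1 / t) * 1 = 1"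
      using st by (simp add: ennreal_plus[symmetric] del: ennreal_plus)
    finally show ?thesis using 3 ab by (simp add: \<alpha>_def \<beta>_def ennreal_mult)
  qed
qed

section \<open>Cubes and mean oscillation\<close>

text \<open>Half-open, so that the half-size subcubes partition it exactly, and anchored at the
  lowest corner, which is itself a point of the cube when \<open>0 < l\<close>.\<close>

definition cube :: "real ^ 'n \<Rightarrow> real \<Rightarrow> (real ^ 'n) set" where
  "cube c l = {x. \<forall>i. c $ i \<le> x $ i \<and> x $ i < c $ i + l}"

text \<open>The set \<open>S\<close> lists the coordinates in which the upper half is taken; the 2 ^
  n children are thus indexed by \<open>UNIV :: 'n set set\<close>.\<close>

definition child :: "real ^ 'n \<Rightarrow> real \<Rightarrow> 'n set \<Rightarrow> real ^ 'n" where
  "child c l S = (\<chi> i. c $ i + (if i \<in> S then l / 2 else 0))"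

lemma cube_eq_Inter:
  "cube c l = (\<Inter>i. {x. c $ i \<le> x $ i} \<inter> {x. x $ i < c $ i + l})"
  by (auto simp: cube_def)

lemma sets_cube [measurable]: "cube c l \<in> sets borel"
  unfolding cube_eq_Inter
  by (intro sets.finite_INT sets.Int borel_closed borel_open)
     (auto simp: closed_halfspace_component_ge_cart open_halfspace_component_lt_cart)

lemma emeasure_cube:
  assumes "0 \<le> l"
  shows "emeasure lborel (cube c l :: (real ^ 'n) set) = ennreal (l ^ CARD('n))"
proof -
  let ?u = "(\<chi> i. c $ i + l) :: real ^ 'n"
  have "emeasure lborel (cbox c ?u) = ennreal (l ^ CARD('n))"
  proof -
    have "cbox c ?u \<noteq> {}" using assms by (simp add: interval_ne_empty_cart)
    then have "measure lborel (cbox c ?u) = l ^ CARD('n)"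
      by (simp add: content_cbox_cart)
    then show ?thesis
      using emeasure_eq_ennreal_measure[of lborel "cbox c ?u"] emeasure_lborel_cbox_finite[of c ?u]
      by (simp add: less_top)
  qed
  moreover have "emeasure lborel (box c ?u) = emeasure lborel (cbox c ?u)"
    by (simp add: emeasure_lborel_box_eq emeasure_lborel_cbox_eq)
  moreover have "emeasure lborel (box c ?u) \<le> emeasure lborel (cube c l)"
    by (intro emeasure_mono) (auto simp: mem_box_cart cube_def less_imp_le)
  moreover have "emeasure lborel (cube c l) \<le> emeasure lborel (cbox c ?u)"
    by (intro emeasure_mono) (auto simp: mem_box_cart cube_def less_imp_le)
  ultimately show ?thesis by (metis antisym)
qed

lemma corner_in_cube: "0 < l \<Longrightarrow> c \<in> cube c l"
  by (simp add: cube_def)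

lemma cube_subset_cube_iff:
  assumes "0 < l'"
  shows "cube c' l' \<subseteq> cube c l \<longleftrightarrow> (\<forall>i. c $ i \<le> c' $ i \<and> c' $ i + l' \<le> c $ i + l)" (is "?L \<longleftrightarrow> ?R")
proof
  assume L: ?L
  then have "c' \<in> cube c l" using corner_in_cube[OF assms] by auto
  then have "c $ i \<le> c' $ i" for i by (simp add: cube_def)
  moreover have "c' $ i + l' \<le> c $ i + l" for i
  \<comment> \<open>The upper faces do not belong to the cube, so the bound is first obtained for
    every t below \<open>c' $ i + l'\<close>, at a point of the diagonal.\<close>
  proof (rule dense_le_bounded[of "c' $ i"])
    show "c' $ i < c' $ i + l'" using assms by simp
    fix t assume t: "c' $ i < t" "t < c' $ i + l'"
    have "(\<chi> j. c' $ j + (t - c' $ i)) \<in> cube c' l'"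
      using t by (simp add: cube_def)
    then have "(\<chi> j. c' $ j + (t - c' $ i)) \<in> cube c l" using L by blast
    from this[unfolded cube_def, simplified, rule_format, of i]
    show "t \<le> c $ i + l" by simp
  qed
  ultimately show ?R by blast
next
  assume ?R
  then have *: "c $ i \<le> c' $ i" "c' $ i + l' \<le> c $ i + l" for i by auto
  show ?L
  proof (clarsimp simp: cube_def)
    fix x i assume "\<forall>i. c' $ i \<le> x $ i \<and> x $ i < c' $ i + l'"
    then show "c $ i \<le> x $ i \<and> x $ i < c $ i + l"
      using *[of i] by (meson order_trans order_less_le_trans)
  qed
qed

lemma child_subset:
  assumes "0 < l" shows "cube (child c l S) (l / 2) \<subseteq> cube c l"
  using assms by (subst cube_subset_cube_iff) (auto simp: child_def)

lemma indicator_cube_children: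
  "indicator (cube c l) x = (\<Sum>S\<in>UNIV. indicator (cube (child c l S) (l / 2)) x :: ennreal)"
proof (cases "x \<in> cube c l")
  case True
  \<comment> \<open>The only child containing x takes the upper half in exactly these
    coordinates.\<close>
  define S0 where "S0 = {i. c $ i + l / 2 \<le> x $ i}"
  have "x \<in> cube (child c l S) (l / 2) \<longleftrightarrow> S0 = S" for S
  proof
    assume *: "x \<in> cube (child c l S) (l / 2)"
    have "i \<in> S \<longleftrightarrow> i \<in> S0" for i
      using *[unfolded cube_def child_def, simplified, rule_format, of i]
      by (auto simp: S0_def split: if_splits)
    then show "S0 = S" by auto
  next
    assume "S0 = S"
    then show "x \<in> cube (child c l S) (l / 2)"
      using True by (auto simp: S0_def cube_def child_def algebra_simps)
  qed
  then have "indicator (cube (child c l S) (l / 2)) x = (if S0 = S then 1 else 0 :: ennreal)" for S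
    by simp
  then show ?thesis using True by simp
next
  case False
  have "x \<notin> cube (child c l S) (l / 2)" for S
  proof
    assume *: "x \<in> cube (child c l S) (l / 2)"
    \<comment> \<open>A point in a child forces \<open>0 < l\<close>, which makes
      \<open>child_subset\<close> available.\<close>
    have "0 < l" using *[unfolded cube_def child_def, simplified, rule_format, of undefined] by simp
    then show False using child_subset * False by blast
  qed
  then show ?thesis using False by simp
qed

lemma nn_integral_cube_children:
  assumes [measurable]: "f \<in> borel_measurable borel"
  shows "(\<integral>\<^sup>+x\<in>cube c l. f x \<partial>lborel) = (\<Sum>S\<in>UNIV. \<integral>\<^sup>+x\<in>cube (child c l S) (l / 2). f x \<partial>lborel)"
  by (subst nn_integral_sum[symmetric])
     (auto simp: sum_distrib_left[symmetric] indicator_cube_children[symmetric])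

lemma sum_children_volume:
  assumes "0 < l"
  shows "(\<Sum>S\<in>(UNIV :: 'n::finite set set). ennreal ((l / 2) ^ CARD('n))) = ennreal (l ^ CARD('n))"
proof -
  have "(\<Sum>S\<in>(UNIV :: 'n set set). ennreal ((l / 2) ^ CARD('n)))
      = of_nat (2 ^ CARD('n)) * ennreal ((l / 2) ^ CARD('n))"
    unfolding sum_constant by (simp add: card_UNIV_set)
  also have "\<dots> = ennreal (real (2 ^ CARD('n)) * (l / 2) ^ CARD('n))"
    using assms by (subst ennreal_of_nat_eq_real_of_nat) (simp only: ennreal_mult zero_le_power of_nat_0_le_iff half_gt_zero less_imp_le)
  also have "real (2 ^ CARD('n)) * (l / 2) ^ CARD('n) = l ^ CARD('n)"
    by (simp add: power_divide)
  finally show ?thesis .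
qed

lemma nn_integral_const_cube:
  fixes c :: "real ^ 'n"
  assumes "0 \<le> l"
  shows "(\<integral>\<^sup>+x\<in>cube c l. k \<partial>lborel) = k * ennreal (l ^ CARD('n))"
  using assms by (simp add: nn_integral_cmult emeasure_cube)

section \<open>Mean oscillation and its passage between scales\<close>

lemma nn_integral_dist_triangle:
  fixes b g h :: "'a \<Rightarrow> real"
  assumes [measurable]: "b \<in> borel_measurable M" "g \<in> borel_measurable M" "h \<in> borel_measurable M" "A \<in> sets M"
  shows "(\<integral>\<^sup>+x\<in>A. ennreal \<bar>b x - h x\<bar> \<partial>M)
    \<le> (\<integral>\<^sup>+x\<in>A. ennreal \<bar>b x - g x\<bar> \<partial>M) + (\<integral>\<^sup>+x\<in>A. ennreal \<bar>g x - h x\<bar> \<partial>M)"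
proof -
  have "(\<integral>\<^sup>+x\<in>A. ennreal \<bar>b x - h x\<bar> \<partial>M)
    \<le> (\<integral>\<^sup>+x. ennreal \<bar>b x - g x\<bar> * indicator A x + ennreal \<bar>g x - h x\<bar> * indicator A x \<partial>M)"
    by (intro nn_integral_mono)
       (auto simp: indicator_def ennreal_plus[symmetric] simp del: ennreal_plus)
  also have "\<dots> = (\<integral>\<^sup>+x\<in>A. ennreal \<bar>b x - g x\<bar> \<partial>M) + (\<integral>\<^sup>+x\<in>A. ennreal \<bar>g x - h x\<bar> \<partial>M)"
    by (intro nn_integral_add) auto
  finally show ?thesis .
qed

text \<open>For comparing the constants of two overlapping cubes: where both approximate b in mean,
  they must be close to each other.\<close>

lemma const_dist_le:
  fixes b :: "'a \<Rightarrow> real"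
  assumes [measurable]: "b \<in> borel_measurable M" "A \<in> sets M"
  shows "ennreal \<bar>d - e\<bar> * emeasure M A
    \<le> (\<integral>\<^sup>+x\<in>A. ennreal \<bar>b x - d\<bar> \<partial>M) + (\<integral>\<^sup>+x\<in>A. ennreal \<bar>b x - e\<bar> \<partial>M)"
  using nn_integral_dist_triangle[of "\<lambda>_. d" M b "\<lambda>_. e" A]
  by (simp add: nn_integral_cmult abs_minus_commute)

text \<open>The constant is left unspecified. Compared with the mean this changes the oscillation by
  at most a factor 2, and no integrability is presupposed.\<close>

definition osc_le :: "(real ^ 'n \<Rightarrow> real) \<Rightarrow> real \<Rightarrow> real ^ 'n \<Rightarrow> real \<Rightarrow> bool" where
  "osc_le b \<kappa> c l \<longleftrightarrow>
     (\<exists>d. (\<integral>\<^sup>+x\<in>cube c l. ennreal \<bar>b x - d\<bar> \<partial>lborel) \<le> ennreal (\<kappa> * l ^ CARD('n)))"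

text \<open>Each half-size subcube shares a quarter-size cube with the concentric half-size cube.\<close>

lemma osc_le_double:
  fixes b :: "real ^ 'n \<Rightarrow> real"
  assumes [measurable]: "b \<in> borel_measurable borel"
    and "0 < l" "0 \<le> \<kappa>"
    and half: "\<And>c'. cube c' (l / 2) \<subseteq> cube c l \<Longrightarrow> osc_le b \<kappa> c' (l / 2)"
  shows "osc_le b ((1 + 2 ^ (CARD('n) + 1)) * \<kappa>) c l"
proof -
  let ?n = "CARD('n)"
  define c0 where "c0 = (\<chi> i. c $ i + l / 4)"
  have "cube c0 (l / 2) \<subseteq> cube c l"
    using \<open>0 < l\<close> by (subst cube_subset_cube_iff) (auto simp: c0_def)
  then obtain d0 where d0: "(\<integral>\<^sup>+x\<in>cube c0 (l / 2). ennreal \<bar>b x - d0\<bar> \<partial>lborel) \<le> ennreal (\<kappa> * (l / 2) ^ ?n)"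
    using half unfolding osc_le_def by blast
  have one: "(\<integral>\<^sup>+x\<in>cube (child c l S) (l / 2). ennreal \<bar>b x - d0\<bar> \<partial>lborel)
      \<le> ennreal ((1 + 2 ^ (?n + 1)) * \<kappa>) * ennreal ((l / 2) ^ ?n)" for S
  proof -
    let ?Q = "cube (child c l S) (l / 2)"
    obtain d where d: "(\<integral>\<^sup>+x\<in>?Q. ennreal \<bar>b x - d\<bar> \<partial>lborel) \<le> ennreal (\<kappa> * (l / 2) ^ ?n)"
      using half[OF child_subset[OF \<open>0 < l\<close>]] unfolding osc_le_def by blast
    define c1 where "c1 = (\<chi> i. c $ i + (if i \<in> S then l / 2 else l / 4))"
    have sub: "cube c1 (l / 4) \<subseteq> ?Q" "cube c1 (l / 4) \<subseteq> cube c0 (l / 2)"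
      using \<open>0 < l\<close> by (subst cube_subset_cube_iff; auto simp: c0_def c1_def child_def)+
    have mono: "(\<integral>\<^sup>+x\<in>cube c1 (l / 4). ennreal \<bar>b x - e\<bar> \<partial>lborel) \<le> (\<integral>\<^sup>+x\<in>R. ennreal \<bar>b x - e\<bar> \<partial>lborel)"
      if "cube c1 (l / 4) \<subseteq> R" for R e
      using that by (intro nn_integral_mono) (auto simp: indicator_def)
    have "ennreal (\<bar>d - d0\<bar> * (l / 4) ^ ?n) = ennreal \<bar>d - d0\<bar> * emeasure lborel (cube c1 (l / 4))"
      using \<open>0 < l\<close> by (simp add: emeasure_cube ennreal_mult)
    also have "\<dots> \<le> (\<integral>\<^sup>+x\<in>cube c1 (l / 4). ennreal \<bar>b x - d\<bar> \<partial>lborel)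
        + (\<integral>\<^sup>+x\<in>cube c1 (l / 4). ennreal \<bar>b x - d0\<bar> \<partial>lborel)"
      by (intro const_dist_le) auto
    also have "\<dots> \<le> ennreal (\<kappa> * (l / 2) ^ ?n) + ennreal (\<kappa> * (l / 2) ^ ?n)"
      by (intro add_mono order_trans[OF mono d] order_trans[OF mono d0] sub)
    \<comment> \<open>Two oscillations, each over a cube with 2 ^ n times the volume of the shared
      one. The \<open>1\<close> in the final factor is the child's own oscillation.\<close>
    also have "\<dots> = ennreal (2 ^ (?n + 1) * \<kappa> * (l / 4) ^ ?n)"
    proof -
      have "(l / 2) ^ ?n = 2 ^ ?n * (l / 4) ^ ?n" by (simp flip: power_mult_distrib)
      then show ?thesis
        using \<open>0 < l\<close> \<open>0 \<le> \<kappa>\<close> by (simp add: ennreal_plus[symmetric] algebra_simps del: ennreal_plus)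
    qed
    finally have "\<bar>d - d0\<bar> * (l / 4) ^ ?n \<le> 2 ^ (?n + 1) * \<kappa> * (l / 4) ^ ?n"
      by (rule ennreal_le_iff[THEN iffD1, rotated]) (use \<open>0 < l\<close> \<open>0 \<le> \<kappa>\<close> in simp)
    from mult_right_le_imp_le[OF this] have dd: "\<bar>d - d0\<bar> \<le> 2 ^ (?n + 1) * \<kappa>"
      using \<open>0 < l\<close> by simp
    have "(\<integral>\<^sup>+x\<in>?Q. ennreal \<bar>b x - d0\<bar> \<partial>lborel)
       \<le> (\<integral>\<^sup>+x\<in>?Q. ennreal \<bar>b x - d\<bar> \<partial>lborel) + (\<integral>\<^sup>+x\<in>?Q. ennreal \<bar>d - d0\<bar> \<partial>lborel)"
      by (intro nn_integral_dist_triangle) auto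
    also have "\<dots> \<le> ennreal (\<kappa> * (l / 2) ^ ?n) + ennreal (2 ^ (?n + 1) * \<kappa>) * ennreal ((l / 2) ^ ?n)"
      using \<open>0 < l\<close> dd by (intro add_mono d) (auto simp: nn_integral_const_cube intro!: mult_right_mono ennreal_leI)
    also have "\<dots> = ennreal ((1 + 2 ^ (?n + 1)) * \<kappa>) * ennreal ((l / 2) ^ ?n)"
      using \<open>0 < l\<close> \<open>0 \<le> \<kappa>\<close>
      by (simp add: ennreal_plus[symmetric] ennreal_mult[symmetric] algebra_simps del: ennreal_plus)
    finally show ?thesis .
  qed
  have "(\<integral>\<^sup>+x\<in>cube c l. ennreal \<bar>b x - d0\<bar> \<partial>lborel)
      \<le> (\<Sum>S\<in>(UNIV :: 'n set set). ennreal ((1 + 2 ^ (?n + 1)) * \<kappa>) * ennreal ((l / 2) ^ ?n))"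
    by (subst nn_integral_cube_children, measurable, intro sum_mono one)
  also have "\<dots> = ennreal ((1 + 2 ^ (?n + 1)) * \<kappa> * l ^ ?n)"
    using \<open>0 < l\<close> \<open>0 \<le> \<kappa>\<close>
    by (subst sum_distrib_left[symmetric], subst sum_children_volume) (auto simp: ennreal_mult)
  finally show ?thesis unfolding osc_le_def by blast
qed

text \<open>Every doubling of the side costs the factor of \<open>osc_le_double\<close>. The set
  \<open>Q\<close> confines the cubes to a region where the hypothesis on small cubes holds with one
  \<delta>; it will be a single cube, on which \<open>admissible\<close> varies by a bounded
  factor.\<close>

lemma osc_le_scale_up:
  fixes b :: "real ^ 'n \<Rightarrow> real"
  assumes b: "b \<in> borel_measurable borel"
    and "0 < \<delta>" "0 \<le> \<kappa>"
    and small: "\<And>c' l'. 0 < l' \<Longrightarrow> l' \<le> \<delta> \<Longrightarrow> cube c' l' \<subseteq> Q \<Longrightarrow> osc_le b \<kappa> c' l'"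
    and "0 < l" "l \<le> 2 ^ j * \<delta>" "cube c l \<subseteq> Q"
  shows "osc_le b ((1 + 2 ^ (CARD('n) + 1)) ^ j * \<kappa>) c l"
  using assms(5-)
proof (induction j arbitrary: c l)
  case 0
  then show ?case using small by simp
next
  case (Suc j)
  have "osc_le b ((1 + 2 ^ (CARD('n) + 1)) * ((1 + 2 ^ (CARD('n) + 1)) ^ j * \<kappa>)) c l"
    using Suc.prems \<open>0 \<le> \<kappa>\<close> by (intro osc_le_double b Suc.IH) auto
  then show ?case by (simp add: mult_ac)
qed

section \<open>The John--Nirenberg inequality\<close>

text \<open>Truncate f at a height M, then apply the same truncation to continuous functions that
  converge to f off a negligible set. Both errors vanish by dominated convergence; in the second the
  majorant is 2 M on A, integrable because A has finite measure.\<close>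

lemma L1_continuous_approx:
  fixes f :: "'a::euclidean_space \<Rightarrow> real"
  assumes [measurable]: "f \<in> borel_measurable borel" "A \<in> sets borel"
    and fin: "emeasure lborel A < \<infinity>" "(\<integral>\<^sup>+x\<in>A. ennreal \<bar>f x\<bar> \<partial>lborel) < \<infinity>" and "0 < e"
  obtains g where "continuous_on UNIV g" "(\<integral>\<^sup>+x\<in>A. ennreal \<bar>f x - g x\<bar> \<partial>lborel) < ennreal e"
proof -
  define clip where "clip M t = max (- real M) (min (real M) t)" for M :: nat and t :: real
  have clip_le: "\<bar>clip M t\<bar> \<le> real M" for M t by (auto simp: clip_def)
  have clip_cont: "continuous_on UNIV (clip M)" for M
    unfolding clip_def by (intro continuous_intros)
  have [measurable]: "clip M \<in> borel_measurable borel" for M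
    using clip_cont by (rule borel_measurable_continuous_onI)
  have "(\<lambda>M. \<integral>\<^sup>+x. ennreal \<bar>f x - clip M (f x)\<bar> * indicator A x \<partial>lborel) \<longlonglongrightarrow> nn_integral lborel (\<lambda>_ :: 'a. 0)"
  proof (rule nn_integral_dominated_convergence)
    show "(\<integral>\<^sup>+x\<in>A. ennreal \<bar>f x\<bar> \<partial>lborel) < \<infinity>" by (rule fin)
    show "AE x in lborel. ennreal \<bar>f x - clip M (f x)\<bar> * indicator A x \<le> ennreal \<bar>f x\<bar> * indicator A x" for M
      by (auto simp: clip_def indicator_def intro!: ennreal_leI)
    show "AE x in lborel. (\<lambda>M. ennreal \<bar>f x - clip M (f x)\<bar> * indicator A x) \<longlonglongrightarrow> 0"
    proof (intro AE_I2 tendsto_eventually)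
      fix x
      have "eventually (\<lambda>M. nat \<lceil>\<bar>f x\<bar>\<rceil> \<le> M) sequentially" by (rule eventually_ge_at_top)
      then show "eventually (\<lambda>M. ennreal \<bar>f x - clip M (f x)\<bar> * indicator A x = 0) sequentially"
      proof eventually_elim
        case (elim M)
        then have "\<bar>f x\<bar> \<le> real M" by linarith
        then show ?case by (auto simp: clip_def)
      qed
    qed
  qed auto
  then have "eventually (\<lambda>M. (\<integral>\<^sup>+x\<in>A. ennreal \<bar>f x - clip M (f x)\<bar> \<partial>lborel) < ennreal (e / 2)) sequentially"
    using \<open>0 < e\<close> by (intro order_tendstoD(2)) auto
  then obtain M where M: "(\<integral>\<^sup>+x\<in>A. ennreal \<bar>f x - clip M (f x)\<bar> \<partial>lborel) < ennreal (e / 2)"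
    by (auto simp: eventually_sequentially)
  have "f measurable_on UNIV"
    by (simp add: measurable_on_iff_borel_measurable lebesgue_on_UNIV_eq measurable_completion)
  then obtain N g where N: "negligible N" and g: "\<And>j. continuous_on UNIV (g j)"
    and lim: "\<And>x. x \<notin> N \<Longrightarrow> (\<lambda>j. g j x) \<longlonglongrightarrow> f x"
    unfolding measurable_on_def by auto
  have [measurable]: "g j \<in> borel_measurable borel" for j
    using g by (rule borel_measurable_continuous_onI)
  have "(\<lambda>j. \<integral>\<^sup>+x. ennreal \<bar>clip M (f x) - clip M (g j x)\<bar> * indicator A x \<partial>lborel) \<longlonglongrightarrow> nn_integral lborel (\<lambda>_ :: 'a. 0)"
  proof (rule nn_integral_dominated_convergence)
    show "(\<integral>\<^sup>+x. ennreal (2 * real M) * indicator A x \<partial>lborel) < \<infinity>"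
      using fin by (simp add: nn_integral_cmult ennreal_mult_less_top)
    show "AE x in lborel. ennreal \<bar>clip M (f x) - clip M (g j x)\<bar> * indicator A x \<le> ennreal (2 * real M) * indicator A x" for j
    proof (intro AE_I2 mult_right_mono ennreal_leI)
      fix x show "\<bar>clip M (f x) - clip M (g j x)\<bar> \<le> 2 * real M"
        using clip_le[of M "f x"] clip_le[of M "g j x"] by linarith
    qed simp
    have "AE x in lebesgue. x \<notin> N"
      using N by (simp add: AE_not_in negligible_iff_null_sets)
    then have "AE x in lborel. x \<notin> N" by (simp add: AE_completion_iff)
    then show "AE x in lborel. (\<lambda>j. ennreal \<bar>clip M (f x) - clip M (g j x)\<bar> * indicator A x) \<longlonglongrightarrow> 0"
    proof eventually_elim
      case (elim x)
      have "isCont (clip M) (f x)" using clip_cont by (simp add: continuous_on_eq_continuous_at)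
      then have "(\<lambda>j. clip M (g j x)) \<longlonglongrightarrow> clip M (f x)"
        using lim[OF elim] by (rule isCont_tendsto_compose)
      then have "(\<lambda>j. \<bar>clip M (f x) - clip M (g j x)\<bar>) \<longlonglongrightarrow> \<bar>clip M (f x) - clip M (f x)\<bar>"
        by (intro tendsto_intros)
      then have "(\<lambda>j. ennreal \<bar>clip M (f x) - clip M (g j x)\<bar>) \<longlonglongrightarrow> 0"
        using tendsto_ennrealI by fastforce
      then show ?case by (cases "x \<in> A") auto
    qed
  qed auto
  then have "eventually (\<lambda>j. (\<integral>\<^sup>+x\<in>A. ennreal \<bar>clip M (f x) - clip M (g j x)\<bar> \<partial>lborel) < ennreal (e / 2)) sequentially"
    using \<open>0 < e\<close> by (intro order_tendstoD(2)) auto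
  then obtain j where j: "(\<integral>\<^sup>+x\<in>A. ennreal \<bar>clip M (f x) - clip M (g j x)\<bar> \<partial>lborel) < ennreal (e / 2)"
    by (auto simp: eventually_sequentially)
  show ?thesis
  proof (rule that[of "\<lambda>x. clip M (g j x)"])
    show "continuous_on UNIV (\<lambda>x. clip M (g j x))"
      by (rule continuous_on_compose2[OF clip_cont g]) auto
    have "(\<integral>\<^sup>+x\<in>A. ennreal \<bar>f x - clip M (g j x)\<bar> \<partial>lborel)
      \<le> (\<integral>\<^sup>+x\<in>A. ennreal \<bar>f x - clip M (f x)\<bar> \<partial>lborel) + (\<integral>\<^sup>+x\<in>A. ennreal \<bar>clip M (f x) - clip M (g j x)\<bar> \<partial>lborel)"
      by (intro nn_integral_dist_triangle) auto
    also have "\<dots> < ennreal (e / 2) + ennreal (e / 2)" using M j by (rule add_strict_mono)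
    also have "\<dots> = ennreal e" using \<open>0 < e\<close> by (simp add: ennreal_plus[symmetric] del: ennreal_plus)
    finally show "(\<integral>\<^sup>+x\<in>A. ennreal \<bar>f x - clip M (g j x)\<bar> \<partial>lborel) < ennreal e" .
  qed
qed

section \<open>Tails of dyadic means and their decay\<close>

text \<open>With \<open>m c l\<close> the mean of \<open>b\<close> on \<open>cube c l\<close>, \<open>cube_tail m d \<tau> N c l\<close> is the measure of the points of
  \<open>cube c l\<close> whose mean over the surrounding subcube of generation \<open>N\<close> differs from \<open>d\<close> by more than \<open>\<tau>\<close>,
  and \<open>cube_err b m N c l\<close> is the distance in \<open>L\<^sup>1\<close> between \<open>b\<close> and these means.\<close>

primrec cube_tail :: "(real ^ 'n \<Rightarrow> real \<Rightarrow> real) \<Rightarrow> real \<Rightarrow> real \<Rightarrow> nat \<Rightarrow> real ^ 'n \<Rightarrow> real \<Rightarrow> ennreal" where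
  "cube_tail m d \<tau> 0 c l = (if \<bar>m c l - d\<bar> > \<tau> then ennreal (l ^ CARD('n)) else 0)"
| "cube_tail m d \<tau> (Suc N) c l = (\<Sum>S\<in>UNIV. cube_tail m d \<tau> N (child c l S) (l / 2))"

primrec cube_err :: "(real ^ 'n \<Rightarrow> real) \<Rightarrow> (real ^ 'n \<Rightarrow> real \<Rightarrow> real) \<Rightarrow> nat \<Rightarrow> real ^ 'n \<Rightarrow> real \<Rightarrow> ennreal" where
  "cube_err b m 0 c l = (\<integral>\<^sup>+x\<in>cube c l. ennreal \<bar>b x - m c l\<bar> \<partial>lborel)"
| "cube_err b m (Suc N) c l = (\<Sum>S\<in>UNIV. cube_err b m N (child c l S) (l / 2))"

text \<open>Recentring at another value costs as much of the threshold as the centre moves. In the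
  decay argument \<open>d'\<close> is the mean of a child.\<close>

lemma cube_tail_mono:
  "\<bar>d - d'\<bar> \<le> \<tau> - \<tau>' \<Longrightarrow> cube_tail m d \<tau> N c l \<le> cube_tail m d' \<tau>' N c l"
  by (induction N arbitrary: c l) (auto intro!: sum_mono)

lemma cube_tail_le:
  "0 < l \<Longrightarrow> cube_tail m d \<tau> N c l \<le> ennreal (l ^ CARD('n))" for c :: "real ^ 'n"
proof (induction N arbitrary: c l)
  case (Suc N)
  have "cube_tail m d \<tau> (Suc N) c l \<le> (\<Sum>S\<in>(UNIV :: 'n set set). ennreal ((l / 2) ^ CARD('n)))"
    unfolding cube_tail.simps using Suc by (intro sum_mono) auto
  also have "\<dots> = ennreal (l ^ CARD('n))" using Suc by (intro sum_children_volume)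
  finally show ?case .
qed simp

text \<open>Passing to a child whose mean leaves the \<open>2\<kappa>\<close>-neighbourhood of \<open>d\<close> costs half of the mass;
  this replaces the stopping cubes of Calderon and Zygmund.\<close>

lemma cube_tail_step:
  fixes b :: "real ^ 'n \<Rightarrow> real"
  assumes [measurable]: "b \<in> borel_measurable borel" and "0 < \<kappa>" "0 \<le> \<theta>" "0 \<le> \<tau>"
    and mean: "\<And>c l d. 0 < l \<Longrightarrow> cube c l \<subseteq> Q \<Longrightarrow>
      ennreal \<bar>m c l - d\<bar> * ennreal (l ^ CARD('n)) \<le> (\<integral>\<^sup>+x\<in>cube c l. ennreal \<bar>b x - d\<bar> \<partial>lborel)"
    and osc: "\<And>c l. 0 < l \<Longrightarrow> cube c l \<subseteq> Q \<Longrightarrow>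
      (\<integral>\<^sup>+x\<in>cube c l. ennreal \<bar>b x - m c l\<bar> \<partial>lborel) \<le> ennreal (\<kappa> * l ^ CARD('n))"
    and IH: "\<And>N c l. 0 < l \<Longrightarrow> cube c l \<subseteq> Q \<Longrightarrow>
      cube_tail m (m c l) \<tau> N c l \<le> ennreal \<theta> * ennreal (l ^ CARD('n))"
    and "0 < l" "cube c l \<subseteq> Q" "\<bar>m c l - d\<bar> \<le> 2 * \<kappa>"
  shows "cube_tail m d (\<tau> + (2 ^ CARD('n) + 2) * \<kappa>) N c l
    \<le> ennreal (\<theta> / (2 * \<kappa>)) * (\<integral>\<^sup>+x\<in>cube c l. ennreal \<bar>b x - d\<bar> \<partial>lborel)"
  using assms(8-)
proof (induction N arbitrary: c l)
  case 0
  have "(0::real) < 2 ^ CARD('n) * \<kappa>" using \<open>0 < \<kappa>\<close> by simp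
  then have "\<not> \<bar>m c l - d\<bar> > \<tau> + (2 ^ CARD('n) + 2) * \<kappa>"
    using 0 \<open>0 \<le> \<tau>\<close> by (simp add: distrib_right)
  then show ?case by (simp del: not_less)
next
  case (Suc N)
  let ?n = "CARD('n)"
  have "cube_tail m d (\<tau> + (2 ^ ?n + 2) * \<kappa>) N (child c l S) (l / 2)
      \<le> ennreal (\<theta> / (2 * \<kappa>)) * (\<integral>\<^sup>+x\<in>cube (child c l S) (l / 2). ennreal \<bar>b x - d\<bar> \<partial>lborel)" for S
  proof -
    let ?c = "child c l S"
    have l2: "0 < l / 2" and sub: "cube ?c (l / 2) \<subseteq> Q"
      using Suc.prems child_subset[of l c S] by auto
    show ?thesis
    proof (cases "\<bar>m ?c (l / 2) - d\<bar> \<le> 2 * \<kappa>")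
      case True
      then show ?thesis by (rule Suc.IH[OF l2 sub])
    next
      case False
      \<comment> \<open>A child has 1 / 2 ^ n of the volume, so its mean is within 2 ^ n \<kappa> of
        the parent's. Together with the distance 2 \<kappa> of the parent's mean from d this is the
        increment of the threshold.\<close>
      have "ennreal (\<bar>m ?c (l / 2) - m c l\<bar> * (l / 2) ^ ?n) \<le> (\<integral>\<^sup>+x\<in>cube ?c (l / 2). ennreal \<bar>b x - m c l\<bar> \<partial>lborel)"
        using mean[OF l2 sub] l2 by (simp add: ennreal_mult)
      also have "\<dots> \<le> (\<integral>\<^sup>+x\<in>cube c l. ennreal \<bar>b x - m c l\<bar> \<partial>lborel)"
        using child_subset[OF \<open>0 < l\<close>, of c S] by (intro nn_integral_mono) (auto simp: indicator_def)
      also have "\<dots> \<le> ennreal (\<kappa> * l ^ ?n)" by (intro osc Suc.prems)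
      also have "\<kappa> * l ^ ?n = (2 ^ ?n * \<kappa>) * (l / 2) ^ ?n" by (simp add: power_divide)
      finally have "\<bar>m ?c (l / 2) - m c l\<bar> * (l / 2) ^ ?n \<le> (2 ^ ?n * \<kappa>) * (l / 2) ^ ?n"
        by (rule ennreal_le_iff[THEN iffD1, rotated]) (use Suc.prems \<open>0 < \<kappa>\<close> in simp)
      from mult_right_le_imp_le[OF this] have "\<bar>m ?c (l / 2) - m c l\<bar> \<le> 2 ^ ?n * \<kappa>"
        using Suc.prems by simp
      then have jump: "\<bar>d - m ?c (l / 2)\<bar> \<le> (2 ^ ?n + 2) * \<kappa>"
        using Suc.prems by (simp add: distrib_right)
      have "cube_tail m d (\<tau> + (2 ^ ?n + 2) * \<kappa>) N ?c (l / 2) \<le> cube_tail m (m ?c (l / 2)) \<tau> N ?c (l / 2)"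
        using jump by (intro cube_tail_mono) simp
      also have "\<dots> \<le> ennreal \<theta> * ennreal ((l / 2) ^ ?n)" by (rule IH[OF l2 sub])
      also have "\<dots> \<le> ennreal (\<theta> / (2 * \<kappa>)) * (ennreal \<bar>m ?c (l / 2) - d\<bar> * ennreal ((l / 2) ^ ?n))"
      proof -
        \<comment> \<open>This child's mean is more than 2 \<kappa> away from d, so its volume is at
          most 1 / (2 \<kappa>) times its own share of the integral of |b - d|. The shares of
          disjoint children add up.\<close>
        have "\<theta> \<le> \<theta> / (2 * \<kappa>) * \<bar>m ?c (l / 2) - d\<bar>"
          using False \<open>0 < \<kappa>\<close> mult_left_mono[of "2 * \<kappa>" "\<bar>m ?c (l / 2) - d\<bar>" \<theta>] \<open>0 \<le> \<theta>\<close>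
          by (simp add: field_simps)
        then have "ennreal \<theta> \<le> ennreal (\<theta> / (2 * \<kappa>)) * ennreal \<bar>m ?c (l / 2) - d\<bar>"
          using \<open>0 < \<kappa>\<close> \<open>0 \<le> \<theta>\<close> by (simp add: ennreal_mult[symmetric] ennreal_leI)
        then show ?thesis by (simp add: mult.assoc[symmetric] mult_right_mono)
      qed
      also have "\<dots> \<le> ennreal (\<theta> / (2 * \<kappa>)) * (\<integral>\<^sup>+x\<in>cube ?c (l / 2). ennreal \<bar>b x - d\<bar> \<partial>lborel)"
        by (intro mult_left_mono mean[OF l2 sub]) simp
      finally show ?thesis .
    qed
  qed
  then have "cube_tail m d (\<tau> + (2 ^ ?n + 2) * \<kappa>) (Suc N) c l
      \<le> (\<Sum>S\<in>UNIV. ennreal (\<theta> / (2 * \<kappa>)) * (\<integral>\<^sup>+x\<in>cube (child c l S) (l / 2). ennreal \<bar>b x - d\<bar> \<partial>lborel))"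
    unfolding cube_tail.simps by (intro sum_mono)
  also have "\<dots> = ennreal (\<theta> / (2 * \<kappa>)) * (\<integral>\<^sup>+x\<in>cube c l. ennreal \<bar>b x - d\<bar> \<partial>lborel)"
    by (subst nn_integral_cube_children) (auto simp: sum_distrib_left)
  finally show ?case .
qed

text \<open>In \<open>cube_tail_step\<close> let d be the mean of the cube: the integral is then at
  most \<kappa> l ^ n, so one increment of the threshold turns \<theta> into \<theta> / 2. The
  induction hypothesis is used for all generations and all subcubes at once, hence the
  generalisation.\<close>

lemma cube_tail_decay:
  fixes b :: "real ^ 'n \<Rightarrow> real"
  assumes b: "b \<in> borel_measurable borel" and "0 < \<kappa>"
    and mean: "\<And>c l d. 0 < l \<Longrightarrow> cube c l \<subseteq> Q \<Longrightarrow>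
      ennreal \<bar>m c l - d\<bar> * ennreal (l ^ CARD('n)) \<le> (\<integral>\<^sup>+x\<in>cube c l. ennreal \<bar>b x - d\<bar> \<partial>lborel)"
    and osc: "\<And>c l. 0 < l \<Longrightarrow> cube c l \<subseteq> Q \<Longrightarrow>
      (\<integral>\<^sup>+x\<in>cube c l. ennreal \<bar>b x - m c l\<bar> \<partial>lborel) \<le> ennreal (\<kappa> * l ^ CARD('n))"
    and "0 < l" "cube c l \<subseteq> Q"
  shows "cube_tail m (m c l) (real j * ((2 ^ CARD('n) + 2) * \<kappa>)) N c l \<le> ennreal ((1 / 2) ^ j) * ennreal (l ^ CARD('n))"
  using assms(5-)
proof (induction j arbitrary: N c l)
  case 0
  then show ?case by (simp add: cube_tail_le)
next
  case (Suc j)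
  let ?n = "CARD('n)"
  have "cube_tail m (m c l) (real j * ((2 ^ ?n + 2) * \<kappa>) + (2 ^ ?n + 2) * \<kappa>) N c l
      \<le> ennreal ((1 / 2) ^ j / (2 * \<kappa>)) * (\<integral>\<^sup>+x\<in>cube c l. ennreal \<bar>b x - m c l\<bar> \<partial>lborel)"
    by (rule cube_tail_step[where Q=Q and m=m, OF b \<open>0 < \<kappa>\<close> _ _ mean osc Suc.IH Suc.prems])
       (use \<open>0 < \<kappa>\<close> in \<open>auto intro!: mult_nonneg_nonneg\<close>)
  also have "\<dots> \<le> ennreal ((1 / 2) ^ j / (2 * \<kappa>)) * ennreal (\<kappa> * l ^ ?n)"
    by (intro mult_left_mono osc Suc.prems) simp
  also have "\<dots> = ennreal ((1 / 2) ^ Suc j) * ennreal (l ^ ?n)"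
    using Suc.prems \<open>0 < \<kappa>\<close> by (simp add: ennreal_mult[symmetric])
  finally show ?case by (simp add: distrib_right add.commute)
qed

lemma emeasure_Collect_cube:
  assumes [measurable]: "Measurable.pred borel P"
  shows "emeasure lborel {x \<in> cube c l. P x} = (\<integral>\<^sup>+x\<in>cube c l. indicator {x. P x} x \<partial>lborel)"
proof -
  have "{x \<in> cube c l. P x} = {x. P x} \<inter> cube c l" by auto
  then have "emeasure lborel {x \<in> cube c l. P x} = (\<integral>\<^sup>+x. indicator ({x. P x} \<inter> cube c l) x \<partial>lborel)"
    by simp
  then show ?thesis by (simp only: indicator_inter_arith)
qed

text \<open>Where |b - d| exceeds \<tau> + \<kappa>, either the surrounding mean is more than \<tau>
  away from d, or b is more than \<kappa> away from that mean. Markov's inequality bounds the second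
  set.\<close>

lemma tail_le_cube_tail_plus_err:
  fixes b :: "real ^ 'n \<Rightarrow> real"
  assumes [measurable]: "b \<in> borel_measurable borel" and "0 < \<kappa>" "0 < l"
  shows "emeasure lborel {x \<in> cube c l. \<bar>b x - d\<bar> > \<tau> + \<kappa>}
    \<le> cube_tail m d \<tau> N c l + ennreal (1 / \<kappa>) * cube_err b m N c l"
  using \<open>0 < l\<close>
proof (induction N arbitrary: c l)
  case 0
  have "emeasure lborel {x \<in> cube c l. \<bar>b x - d\<bar> > \<tau> + \<kappa>}
    \<le> emeasure lborel ((if \<bar>m c l - d\<bar> > \<tau> then cube c l else {}) \<union> {x \<in> cube c l. 1 \<le> ennreal (1 / \<kappa>) * ennreal \<bar>b x - m c l\<bar>})"
  proof (intro emeasure_mono)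
    show "{x \<in> cube c l. \<bar>b x - d\<bar> > \<tau> + \<kappa>}
      \<subseteq> (if \<bar>m c l - d\<bar> > \<tau> then cube c l else {}) \<union> {x \<in> cube c l. 1 \<le> ennreal (1 / \<kappa>) * ennreal \<bar>b x - m c l\<bar>}"
      using \<open>0 < \<kappa>\<close> by (auto simp: ennreal_mult[symmetric] ennreal_le_iff[of _ 1, simplified] simp flip: ennreal_1 split: if_splits)
  qed (intro sets.Un; auto)
  also have "\<dots> \<le> emeasure lborel (if \<bar>m c l - d\<bar> > \<tau> then cube c l else {})
      + emeasure lborel {x \<in> cube c l. 1 \<le> ennreal (1 / \<kappa>) * ennreal \<bar>b x - m c l\<bar>}"
    by (intro emeasure_subadditive) auto
  also have "\<dots> \<le> cube_tail m d \<tau> 0 c l + ennreal (1 / \<kappa>) * cube_err b m 0 c l"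
  proof (intro add_mono)
    show "emeasure lborel (if \<bar>m c l - d\<bar> > \<tau> then cube c l else {}) \<le> cube_tail m d \<tau> 0 c l"
      using 0 by (auto simp: emeasure_cube)
    show "emeasure lborel {x \<in> cube c l. 1 \<le> ennreal (1 / \<kappa>) * ennreal \<bar>b x - m c l\<bar>}
      \<le> ennreal (1 / \<kappa>) * cube_err b m 0 c l"
      unfolding cube_err.simps by (rule nn_integral_Markov_inequality) auto
  qed
  finally show ?case .
next
  case (Suc N)
  have "emeasure lborel {x \<in> cube c l. \<bar>b x - d\<bar> > \<tau> + \<kappa>}
    = (\<integral>\<^sup>+x\<in>cube c l. indicator {x. \<bar>b x - d\<bar> > \<tau> + \<kappa>} x \<partial>lborel)"
    by (rule emeasure_Collect_cube) measurable
  also have "\<dots> = (\<Sum>S\<in>UNIV. \<integral>\<^sup>+x\<in>cube (child c l S) (l / 2). indicator {x. \<bar>b x - d\<bar> > \<tau> + \<kappa>} x \<partial>lborel)"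
    by (intro nn_integral_cube_children) measurable
  also have "\<dots> = (\<Sum>S\<in>UNIV. emeasure lborel {x \<in> cube (child c l S) (l / 2). \<bar>b x - d\<bar> > \<tau> + \<kappa>})"
    by (intro sum.cong refl emeasure_Collect_cube[symmetric]) measurable
  also have "\<dots> \<le> (\<Sum>S\<in>UNIV. cube_tail m d \<tau> N (child c l S) (l / 2) + ennreal (1 / \<kappa>) * cube_err b m N (child c l S) (l / 2))"
    using Suc.prems by (intro sum_mono Suc.IH) auto
  finally show ?case by (simp add: sum.distrib sum_distrib_left)
qed

text \<open>On a cube of generation N the function g is constant up to \<eta>, and the mean of b
  approximates b at most twice as badly as the constant g(c) does. This is what makes the error
  small without differentiating the integral of b.\<close>

lemma cube_err_le:
  fixes b g :: "real ^ 'n \<Rightarrow> real"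
  assumes [measurable]: "b \<in> borel_measurable borel" "g \<in> borel_measurable borel" and "0 \<le> \<eta>"
    and mean: "\<And>c l d. 0 < l \<Longrightarrow> cube c l \<subseteq> Q \<Longrightarrow>
      ennreal \<bar>m c l - d\<bar> * ennreal (l ^ CARD('n)) \<le> (\<integral>\<^sup>+x\<in>cube c l. ennreal \<bar>b x - d\<bar> \<partial>lborel)"
    and g: "\<And>x y. x \<in> Q \<Longrightarrow> y \<in> Q \<Longrightarrow> \<forall>i. \<bar>x $ i - y $ i\<bar> \<le> l / 2 ^ N \<Longrightarrow> \<bar>g x - g y\<bar> \<le> \<eta>"
    and "0 < l" "cube c l \<subseteq> Q"
  shows "cube_err b m N c l \<le> 2 * ((\<integral>\<^sup>+x\<in>cube c l. ennreal \<bar>b x - g x\<bar> \<partial>lborel) + ennreal \<eta> * ennreal (l ^ CARD('n)))"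
  using assms(5-)
proof (induction N arbitrary: c l)
  case 0
  let ?J = "\<integral>\<^sup>+x\<in>cube c l. ennreal \<bar>b x - g c\<bar> \<partial>lborel"
  have "cube_err b m 0 c l \<le> ?J + (\<integral>\<^sup>+x\<in>cube c l. ennreal \<bar>g c - m c l\<bar> \<partial>lborel)"
    unfolding cube_err.simps by (intro nn_integral_dist_triangle) auto
  \<comment> \<open>The mean property, applied to the constant g(c), bounds the distance from g(c)
    to the mean by \<open>?J\<close> once more.\<close>
  also have "\<dots> \<le> ?J + ?J"
    using 0 mean[of l c "g c"] by (intro add_mono) (auto simp: nn_integral_const_cube abs_minus_commute)
  also have "\<dots> = 2 * ?J" by (simp add: mult_2)
  also have "?J \<le> (\<integral>\<^sup>+x\<in>cube c l. ennreal \<bar>b x - g x\<bar> \<partial>lborel) + (\<integral>\<^sup>+x\<in>cube c l. ennreal \<bar>g x - g c\<bar> \<partial>lborel)"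
    by (intro nn_integral_dist_triangle) auto
  also have "(\<integral>\<^sup>+x\<in>cube c l. ennreal \<bar>g x - g c\<bar> \<partial>lborel) \<le> (\<integral>\<^sup>+x\<in>cube c l. ennreal \<eta> \<partial>lborel)"
  proof (intro nn_integral_mono)
    fix x
    have "\<bar>g x - g c\<bar> \<le> \<eta>" if "x \<in> cube c l"
    proof (rule 0(1))
      show "x \<in> Q" "c \<in> Q" using 0 that corner_in_cube[of l c] by auto
      show "\<forall>i. \<bar>x $ i - c $ i\<bar> \<le> l / 2 ^ 0"
      proof
        fix i show "\<bar>x $ i - c $ i\<bar> \<le> l / 2 ^ 0"
          using that[unfolded cube_def, simplified, rule_format, of i] by simp
      qed
    qed
    then show "ennreal \<bar>g x - g c\<bar> * indicator (cube c l) x \<le> ennreal \<eta> * indicator (cube c l) x"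
      by (auto simp: indicator_def ennreal_leI)
  qed
  also have "\<dots> = ennreal \<eta> * ennreal (l ^ CARD('n))" using 0 by (simp add: nn_integral_const_cube)
  finally show ?case by (simp add: mult_left_mono add_left_mono)
next
  case (Suc N)
  have "cube_err b m (Suc N) c l \<le> (\<Sum>S\<in>(UNIV :: 'n set set). 2 * ((\<integral>\<^sup>+x\<in>cube (child c l S) (l / 2). ennreal \<bar>b x - g x\<bar> \<partial>lborel)
      + ennreal \<eta> * ennreal ((l / 2) ^ CARD('n))))"
    unfolding cube_err.simps
  proof (intro sum_mono Suc.IH)
    fix S show "cube (child c l S) (l / 2) \<subseteq> Q" using Suc.prems child_subset[of l c S] by auto
    \<comment> \<open>Halving the side and lowering the generation by one leave l / 2 ^ N unchanged,
      so the children inherit the modulus of continuity of g.\<close>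
    fix x y assume "x \<in> Q" "y \<in> Q" "\<forall>i. \<bar>x $ i - y $ i\<bar> \<le> l / 2 / 2 ^ N"
    then show "\<bar>g x - g y\<bar> \<le> \<eta>" using Suc.prems(1)[of x y] by (simp add: field_simps)
  qed (use Suc.prems in auto)
  also have "\<dots> = 2 * ((\<integral>\<^sup>+x\<in>cube c l. ennreal \<bar>b x - g x\<bar> \<partial>lborel) + ennreal \<eta> * ennreal (l ^ CARD('n)))"
    using Suc.prems(2)
    by (simp only: sum_distrib_left[symmetric] sum.distrib sum_children_volume)
       (subst nn_integral_cube_children, auto)
  finally show ?case .
qed

lemma norm_le_card_mult:
  fixes x :: "real ^ 'n"
  assumes "\<And>i. \<bar>x $ i\<bar> \<le> e"
  shows "norm x \<le> real CARD('n) * e"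
  using norm_le_l1_cart[of x] sum_mono[of UNIV "\<lambda>i. \<bar>x $ i\<bar>" "\<lambda>_. e"] assms by force

text \<open>The decay is known for the generation-N means, uniformly in N. The tail of b itself
  differs from theirs by the L1 distance between b and the means, and for fixed j this is made
  smaller than any \<epsilon> by the choice of N.\<close>

lemma john_nirenberg_cube:
  fixes b :: "real ^ 'n \<Rightarrow> real"
  assumes [measurable]: "b \<in> borel_measurable borel" and "0 < \<kappa>" "0 < l0"
    and all: "\<And>c l. 0 < l \<Longrightarrow> cube c l \<subseteq> cube c0 l0 \<Longrightarrow> osc_le b \<kappa> c l"
  obtains d where "\<And>j::nat. emeasure lborel {x \<in> cube c0 l0. \<bar>b x - d\<bar> > (real j * (2 ^ CARD('n) + 2) + 1) * (2 * \<kappa>)}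
    \<le> ennreal ((1 / 2) ^ j) * ennreal (l0 ^ CARD('n))"
proof -
  let ?n = "CARD('n)"
  define m where "m c l = (LINT x:cube c l|lborel. b x) / l ^ ?n" for c l
  let ?K = "2 * \<kappa>"
  have fin: "\<exists>d. (\<integral>\<^sup>+x\<in>cube c l. ennreal \<bar>b x - d\<bar> \<partial>lborel) \<le> ennreal (\<kappa> * l ^ ?n)"
    if "0 < l" "cube c l \<subseteq> cube c0 l0" for c l
    using all[OF that] by (simp add: osc_le_def)
  have int: "set_integrable lborel (cube c l) b" if "0 < l" "cube c l \<subseteq> cube c0 l0" for c l
  proof -
    obtain d where d: "(\<integral>\<^sup>+x\<in>cube c l. ennreal \<bar>b x - d\<bar> \<partial>lborel) \<le> ennreal (\<kappa> * l ^ ?n)"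
      using fin \<open>0 < l\<close> \<open>cube c l \<subseteq> cube c0 l0\<close> by blast
    have "set_integrable lborel (cube c l) (\<lambda>x. b x - d)"
      unfolding set_integrable_def
    proof (rule integrableI_bounded)
      have "(\<integral>\<^sup>+x. ennreal (norm (indicator (cube c l) x *\<^sub>R (b x - d))) \<partial>lborel)
        = (\<integral>\<^sup>+x\<in>cube c l. ennreal \<bar>b x - d\<bar> \<partial>lborel)"
        by (intro nn_integral_cong) (auto simp: indicator_def)
      then show "(\<integral>\<^sup>+x. ennreal (norm (indicator (cube c l) x *\<^sub>R (b x - d))) \<partial>lborel) < \<infinity>"
        using d by (simp add: order_le_less_trans)
    qed auto
    moreover have "set_integrable lborel (cube c l) (\<lambda>x. d)"
      using that by (auto simp: set_integrable_def emeasure_cube)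
    ultimately have "set_integrable lborel (cube c l) (\<lambda>x. (b x - d) + d)"
      by (rule set_integral_add)
    then show ?thesis by simp
  qed
  have mean: "ennreal \<bar>m c l - d\<bar> * ennreal (l ^ ?n) \<le> (\<integral>\<^sup>+x\<in>cube c l. ennreal \<bar>b x - d\<bar> \<partial>lborel)"
    if "0 < l" "cube c l \<subseteq> cube c0 l0" for c l d
  proof -
    have d': "set_integrable lborel (cube c l) (\<lambda>x. d)"
      using that by (auto simp: set_integrable_def emeasure_cube)
    have meas: "measure lborel (cube c l) = l ^ ?n"
      using that by (simp add: measure_def emeasure_cube)
    have "(LINT x:cube c l|lborel. b x - d) = m c l * l ^ ?n - d * l ^ ?n"
      using that int[OF that] d' by (simp add: set_integral_diff m_def set_integral_const meas emeasure_cube)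
    then have "\<bar>m c l - d\<bar> * l ^ ?n = norm (LINT x:cube c l|lborel. b x - d)"
      using that by (simp add: left_diff_distrib[symmetric] abs_mult)
    also have "ennreal \<dots> \<le> (\<integral>\<^sup>+x. ennreal (norm (indicator (cube c l) x *\<^sub>R (b x - d))) \<partial>lborel)"
      unfolding set_lebesgue_integral_def
      by (intro integral_norm_bound_ennreal)
         (use set_integral_diff(1)[OF int[OF that] d'] in \<open>simp add: set_integrable_def\<close>)
    also have "\<dots> = (\<integral>\<^sup>+x\<in>cube c l. ennreal \<bar>b x - d\<bar> \<partial>lborel)"
      by (intro nn_integral_cong) (auto simp: indicator_def)
    finally show ?thesis using that by (simp add: ennreal_mult)
  qed
  \<comment> \<open>Putting the mean in place of the constant from \<open>osc_le\<close> doubles the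
    bound; this is the 2 \<kappa> of the conclusion.\<close>
  have osc: "(\<integral>\<^sup>+x\<in>cube c l. ennreal \<bar>b x - m c l\<bar> \<partial>lborel) \<le> ennreal (?K * l ^ ?n)"
    if "0 < l" "cube c l \<subseteq> cube c0 l0" for c l
  proof -
    obtain d where d: "(\<integral>\<^sup>+x\<in>cube c l. ennreal \<bar>b x - d\<bar> \<partial>lborel) \<le> ennreal (\<kappa> * l ^ ?n)"
      using fin \<open>0 < l\<close> \<open>cube c l \<subseteq> cube c0 l0\<close> by blast
    have "(\<integral>\<^sup>+x\<in>cube c l. ennreal \<bar>b x - m c l\<bar> \<partial>lborel)
      \<le> (\<integral>\<^sup>+x\<in>cube c l. ennreal \<bar>b x - d\<bar> \<partial>lborel) + (\<integral>\<^sup>+x\<in>cube c l. ennreal \<bar>d - m c l\<bar> \<partial>lborel)"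
      by (intro nn_integral_dist_triangle) auto
    also have "\<dots> \<le> ennreal (\<kappa> * l ^ ?n) + ennreal (\<kappa> * l ^ ?n)"
      using that d order_trans[OF mean[OF that, of d] d]
      by (intro add_mono) (auto simp: nn_integral_const_cube abs_minus_commute)
    also have "\<dots> = ennreal (?K * l ^ ?n)"
      using that \<open>0 < \<kappa>\<close> by (simp add: ennreal_plus[symmetric] del: ennreal_plus)
    finally show ?thesis .
  qed
  show ?thesis
  proof (rule that[of "m c0 l0"], rule ennreal_le_epsilon)
    fix j :: nat and \<epsilon> :: real assume "0 < \<epsilon>"
    define e where "e = \<epsilon> * \<kappa> / (1 + l0 ^ ?n)"
    have "0 < l0 ^ ?n" using \<open>0 < l0\<close> by simp
    then have "0 < e" "e * (1 + l0 ^ ?n) = \<epsilon> * \<kappa>"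
      using \<open>0 < \<epsilon>\<close> \<open>0 < \<kappa>\<close> by (auto simp: e_def)
    then have e: "0 < e" "1 / ?K * (2 * (e + e * l0 ^ ?n)) = \<epsilon>"
      using \<open>0 < \<kappa>\<close> by (simp_all add: field_simps)
    have fin0: "(\<integral>\<^sup>+x\<in>cube c0 l0. ennreal \<bar>b x\<bar> \<partial>lborel) < \<infinity>"
    proof -
      have "(\<integral>\<^sup>+x\<in>cube c0 l0. ennreal \<bar>b x\<bar> \<partial>lborel) = (\<integral>\<^sup>+x. ennreal (norm (indicator (cube c0 l0) x *\<^sub>R b x)) \<partial>lborel)"
        by (intro nn_integral_cong) (auto simp: indicator_def)
      then show ?thesis using int[OF \<open>0 < l0\<close> order_refl]
        by (simp add: set_integrable_def integrable_iff_bounded)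
    qed
    obtain g where g: "continuous_on UNIV g" and bg: "(\<integral>\<^sup>+x\<in>cube c0 l0. ennreal \<bar>b x - g x\<bar> \<partial>lborel) < ennreal e"
      using L1_continuous_approx[of b "cube c0 l0" e] fin0 e \<open>0 < l0\<close> by (auto simp: emeasure_cube)
    have [measurable]: "g \<in> borel_measurable borel" using g by (rule borel_measurable_continuous_onI)
    let ?B = "cbox c0 (\<chi> i. c0 $ i + l0)"
    have sub: "cube c0 l0 \<subseteq> ?B" by (auto simp: cube_def mem_box_cart less_imp_le)
    have "uniformly_continuous_on ?B g"
      using g by (intro compact_uniformly_continuous) (auto intro: continuous_on_subset)
    then obtain \<delta> where "0 < \<delta>" and \<delta>: "\<And>x y. x \<in> ?B \<Longrightarrow> y \<in> ?B \<Longrightarrow> dist x y < \<delta> \<Longrightarrow> dist (g x) (g y) < e"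
      using e(1) unfolding uniformly_continuous_on_def by metis
    \<comment> \<open>Generation N has side l0 / 2 ^ N, hence diameter below the \<delta> of uniform
      continuity.\<close>
    obtain N where N: "real ?n * l0 / \<delta> < 2 ^ N"
      using real_arch_pow[of 2 "real ?n * l0 / \<delta>"] by auto
    have err: "cube_err b m N c0 l0 \<le> 2 * ((\<integral>\<^sup>+x\<in>cube c0 l0. ennreal \<bar>b x - g x\<bar> \<partial>lborel) + ennreal e * ennreal (l0 ^ ?n))"
    proof (rule cube_err_le[where Q = "cube c0 l0"])
      fix x y assume xy: "x \<in> cube c0 l0" "y \<in> cube c0 l0" "\<forall>i. \<bar>x $ i - y $ i\<bar> \<le> l0 / 2 ^ N"
      have "dist x y \<le> real ?n * (l0 / 2 ^ N)"
        using xy norm_le_card_mult[of "x - y" "l0 / 2 ^ N"] by (simp add: dist_norm)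
      also have "\<dots> < \<delta>" using N \<open>0 < \<delta>\<close> by (simp add: field_simps)
      finally show "\<bar>g x - g y\<bar> \<le> e" using \<delta>[of x y] xy(1,2) subsetD[OF sub] by (auto simp: dist_real_def)
    qed (use mean e \<open>0 < l0\<close> in auto)
    have "emeasure lborel {x \<in> cube c0 l0. \<bar>b x - m c0 l0\<bar> > (real j * (2 ^ ?n + 2) + 1) * ?K}
      = emeasure lborel {x \<in> cube c0 l0. \<bar>b x - m c0 l0\<bar> > real j * ((2 ^ ?n + 2) * ?K) + ?K}"
      by (simp add: algebra_simps)
    also have "\<dots> \<le> cube_tail m (m c0 l0) (real j * ((2 ^ ?n + 2) * ?K)) N c0 l0 + ennreal (1 / ?K) * cube_err b m N c0 l0"
      using \<open>0 < \<kappa>\<close> \<open>0 < l0\<close> by (intro tail_le_cube_tail_plus_err) auto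
    also have "\<dots> \<le> ennreal ((1 / 2) ^ j) * ennreal (l0 ^ ?n) + ennreal (1 / ?K) * (2 * (ennreal e + ennreal e * ennreal (l0 ^ ?n)))"
    proof (intro add_mono mult_left_mono)
      show "cube_tail m (m c0 l0) (real j * ((2 ^ ?n + 2) * ?K)) N c0 l0 \<le> ennreal ((1 / 2) ^ j) * ennreal (l0 ^ ?n)"
        using \<open>0 < \<kappa>\<close> \<open>0 < l0\<close> mean osc
        by (intro cube_tail_decay[where b = b and Q = "cube c0 l0"]) auto
      show "cube_err b m N c0 l0 \<le> 2 * (ennreal e + ennreal e * ennreal (l0 ^ ?n))"
        by (rule order_trans[OF err], intro mult_left_mono add_mono less_imp_le[OF bg]) auto
    qed simp
    also have "ennreal (1 / ?K) * (2 * (ennreal e + ennreal e * ennreal (l0 ^ ?n))) = ennreal (1 / ?K * (2 * (e + e * l0 ^ ?n)))"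
    proof -
      have 1: "ennreal e + ennreal e * ennreal (l0 ^ ?n) = ennreal (e + e * l0 ^ ?n)"
        using e(1) \<open>0 < l0\<close> by (simp add: ennreal_mult ennreal_plus)
      have 2: "ennreal (1 / ?K) * (2 * ennreal z) = ennreal (1 / ?K * (2 * z))" if "0 \<le> z" for z
        using that \<open>0 < \<kappa>\<close> ennreal_mult[of 2 z] ennreal_mult[of "1 / ?K" "2 * z"] by simp
      show ?thesis unfolding 1 by (rule 2) (use e(1) \<open>0 < l0\<close> in simp)
    qed
    finally show "emeasure lborel {x \<in> cube c0 l0. \<bar>b x - m c0 l0\<bar> > (real j * (2 ^ ?n + 2) + 1) * ?K}
      \<le> ennreal ((1 / 2) ^ j) * ennreal (l0 ^ ?n) + ennreal \<epsilon>" using e(2) by simp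
  qed
qed

section \<open>From exponential decay to moments of every order\<close>

lemma ennreal_le_suminf: "f j \<le> suminf f" for f :: "nat \<Rightarrow> ennreal"
  using sum_le_suminf[of f "{j}"] by simp

lemma powr_le_exp:
  fixes x t \<delta> :: real
  assumes "0 \<le> x" "0 < t" "0 < \<delta>"
  shows "x powr t \<le> (t / \<delta>) powr t * exp (\<delta> * x)"
proof -
  have "x powr t = (t / \<delta>) powr t * (\<delta> * x / t) powr t"
    using assms by (simp add: powr_mult[symmetric])
  also have "(\<delta> * x / t) powr t \<le> exp (\<delta> * x / t) powr t"
  proof (rule powr_mono2)
    show "\<delta> * x / t \<le> exp (\<delta> * x / t)" using exp_ge_add_one_self[of "\<delta> * x / t"] by linarith
  qed (use assms in auto)
  also have "\<dots> = exp (\<delta> * x)" using assms by (simp add: powr_def)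
  finally show ?thesis by (simp add: mult_left_mono)
qed

text \<open>The values of |b - d| are sorted into layers of width D, in units of 2 \<kappa>. The
  t-th power grows polynomially in the layer number j, the measure of the layer decays like 2 ^ - j,
  and the series converges.\<close>

lemma bmo_moment_cube:
  fixes t :: real
  assumes "0 < t"
  obtains C :: real where "0 < C"
    "\<And>(b :: real ^ 'n \<Rightarrow> real) \<kappa> c0 l0. b \<in> borel_measurable borel \<Longrightarrow> 0 < \<kappa> \<Longrightarrow> 0 < l0 \<Longrightarrow>
      (\<And>c l. 0 < l \<Longrightarrow> cube c l \<subseteq> cube c0 l0 \<Longrightarrow> osc_le b \<kappa> c l) \<Longrightarrow>
      \<exists>d. (\<integral>\<^sup>+x\<in>cube c0 l0. ennreal ((\<bar>b x - d\<bar> / \<kappa>) powr t) \<partial>lborel) \<le> ennreal (C * l0 ^ CARD('n))"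
proof -
  let ?n = "CARD('n)"
  define D where "D = (2 ^ ?n + 2 :: real)"
  \<comment> \<open>Chosen so that exp (\<delta> D) = 3 / 2: the power may grow by 3 / 2 per layer,
    and against the decay 1 / 2 the ratio is 3 / 4.\<close>
  define \<delta> where "\<delta> = ln (3 / 2) / D"
  have "0 < D" by (simp add: D_def add_pos_pos)
  then have "0 < \<delta>" by (simp add: \<delta>_def)
  define K where "K = (t / \<delta>) powr t * exp (\<delta> * (D + 1))"
  have "0 \<le> K" by (simp add: K_def)
  have trm: "((real j + 1) * D + 1) powr t \<le> K * (3 / 2) ^ j" for j
  proof -
    have "((real j + 1) * D + 1) powr t \<le> (t / \<delta>) powr t * exp (\<delta> * ((real j + 1) * D + 1))"
      using \<open>0 < D\<close> \<open>0 < \<delta>\<close> assms by (intro powr_le_exp) auto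
    also have "exp (\<delta> * ((real j + 1) * D + 1)) = exp (\<delta> * (D + 1)) * exp (real j * (\<delta> * D))"
      by (simp add: exp_add[symmetric] algebra_simps)
    also have "exp (real j * (\<delta> * D)) = exp (\<delta> * D) ^ j" by (rule exp_of_nat_mult)
    also have "exp (\<delta> * D) = 3 / 2" using \<open>0 < D\<close> by (simp add: \<delta>_def)
    finally show ?thesis by (simp add: K_def mult.assoc)
  qed
  define C where "C = 2 powr t * (1 + 4 * K)"
  show ?thesis
  proof (rule that[of C])
    show "0 < C" using \<open>0 \<le> K\<close> by (simp add: C_def add_pos_nonneg)
    fix b :: "real ^ 'n \<Rightarrow> real" and \<kappa> c0 l0
    assume [measurable]: "b \<in> borel_measurable borel" and pos: "0 < \<kappa>" "0 < l0"
      and all: "\<And>c l. 0 < l \<Longrightarrow> cube c l \<subseteq> cube c0 l0 \<Longrightarrow> osc_le b \<kappa> c l"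
    obtain d where d: "\<And>j::nat. emeasure lborel {x \<in> cube c0 l0. \<bar>b x - d\<bar> > (real j * D + 1) * (2 * \<kappa>)}
      \<le> ennreal ((1 / 2) ^ j) * ennreal (l0 ^ ?n)"
      using john_nirenberg_cube[of b \<kappa> l0 c0] pos all unfolding D_def by auto
    define A where "A j = {x \<in> cube c0 l0. \<bar>b x - d\<bar> > (real j * D + 1) * (2 * \<kappa>)}" for j :: nat
    have [measurable]: "A j \<in> sets borel" for j by (simp add: A_def)
    have pt: "ennreal ((\<bar>b x - d\<bar> / \<kappa>) powr t) * indicator (cube c0 l0) x
      \<le> ennreal (2 powr t) * (indicator (cube c0 l0) x + (\<Sum>j. ennreal (K * (3 / 2) ^ j) * indicator (A j) x))" for x
    proof (cases "x \<in> cube c0 l0")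
      case True
      define u where "u = \<bar>b x - d\<bar> / (2 * \<kappa>)"
      have u: "0 \<le> u" "\<bar>b x - d\<bar> / \<kappa> = 2 * u" using pos by (auto simp: u_def)
      have A: "x \<in> A j \<longleftrightarrow> real j * D + 1 < u" for j
        using True pos by (simp add: A_def u_def pos_less_divide_eq)
      have "ennreal (u powr t) \<le> 1 + (\<Sum>j. ennreal (K * (3 / 2) ^ j) * indicator (A j) x)"
      proof (cases "u \<le> 1")
        case True
        then have "u powr t \<le> 1 powr t" using u assms by (intro powr_mono2) auto
        then have "ennreal (u powr t) \<le> 1" by (simp add: ennreal_le_iff[of 1, simplified] flip: ennreal_1)
        then show ?thesis by (simp add: add_increasing2)
      next
        case False
        \<comment> \<open>The ceiling minus 1 puts u into the layer with strict lower and weak upper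
          end, as membership in \<open>A j\<close> requires.\<close>
        define j where "j = nat (\<lceil>(u - 1) / D\<rceil> - 1)"
        have "0 < (u - 1) / D" using False \<open>0 < D\<close> by simp
        then have "real j < (u - 1) / D" "(u - 1) / D \<le> real j + 1"
          unfolding j_def by linarith+
        then have j: "real j * D + 1 < u" "u \<le> (real j + 1) * D + 1"
          using \<open>0 < D\<close> by (simp_all add: field_simps)
        have "ennreal (u powr t) \<le> ennreal (((real j + 1) * D + 1) powr t)"
          using u j assms by (intro ennreal_leI powr_mono2) auto
        also have "\<dots> \<le> ennreal (K * (3 / 2) ^ j) * indicator (A j) x"
          using j(1) trm by (auto simp: A ennreal_leI)
        also have "\<dots> \<le> (\<Sum>j. ennreal (K * (3 / 2) ^ j) * indicator (A j) x)"
          by (rule ennreal_le_suminf)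
        finally show ?thesis by (simp add: add_increasing)
      qed
      then show ?thesis
        using True u by (simp add: powr_mult ennreal_mult mult_left_mono)
    qed simp
    have "(\<integral>\<^sup>+x\<in>cube c0 l0. ennreal ((\<bar>b x - d\<bar> / \<kappa>) powr t) \<partial>lborel)
      \<le> (\<integral>\<^sup>+x. ennreal (2 powr t) * (indicator (cube c0 l0) x + (\<Sum>j. ennreal (K * (3 / 2) ^ j) * indicator (A j) x)) \<partial>lborel)"
      by (intro nn_integral_mono pt)
    also have "\<dots> = ennreal (2 powr t) * (ennreal (l0 ^ ?n) + (\<Sum>j. ennreal (K * (3 / 2) ^ j) * emeasure lborel (A j)))"
      using pos by (simp add: nn_integral_cmult nn_integral_add nn_integral_suminf emeasure_cube)
    also have "\<dots> \<le> ennreal (2 powr t) * (ennreal (l0 ^ ?n) + (\<Sum>j. ennreal (K * l0 ^ ?n * (3 / 4) ^ j)))"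
    proof (intro mult_left_mono add_left_mono suminf_le)
      fix j
      have "ennreal (K * (3 / 2) ^ j) * emeasure lborel (A j)
        \<le> ennreal (K * (3 / 2) ^ j) * (ennreal ((1 / 2) ^ j) * ennreal (l0 ^ ?n))"
        using d[of j] unfolding A_def by (intro mult_left_mono) auto
      also have "\<dots> = ennreal (K * (3 / 2) ^ j * ((1 / 2) ^ j * l0 ^ ?n))"
        using pos \<open>0 \<le> K\<close> by (simp add: ennreal_mult)
      also have "K * (3 / 2) ^ j * ((1 / 2) ^ j * l0 ^ ?n) = K * l0 ^ ?n * ((3 / 2) * (1 / 2)) ^ j"
        unfolding power_mult_distrib by (simp add: mult_ac)
      finally show "ennreal (K * (3 / 2) ^ j) * emeasure lborel (A j) \<le> ennreal (K * l0 ^ ?n * (3 / 4) ^ j)" by simp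
    qed auto
    also have "(\<Sum>j. ennreal (K * l0 ^ ?n * (3 / 4) ^ j)) = ennreal (K * l0 ^ ?n * 4)"
    proof -
      have "(\<lambda>j. K * l0 ^ ?n * (3 / 4) ^ j) sums (K * l0 ^ ?n * (1 / (1 - 3 / 4)))"
        by (intro sums_mult geometric_sums) simp
      then show ?thesis
        using \<open>0 \<le> K\<close> pos by (intro sums_unique[symmetric]) (auto intro!: sums_ennreal[THEN iffD2])
    qed
    also have "ennreal (2 powr t) * (ennreal (l0 ^ ?n) + ennreal (K * l0 ^ ?n * 4)) = ennreal (C * l0 ^ ?n)"
      using \<open>0 \<le> K\<close> pos by (simp add: C_def ennreal_mult[symmetric] ennreal_plus[symmetric] algebra_simps del: ennreal_plus)
    finally show "\<exists>d. (\<integral>\<^sup>+x\<in>cube c0 l0. ennreal ((\<bar>b x - d\<bar> / \<kappa>) powr t) \<partial>lborel) \<le> ennreal (C * l0 ^ ?n)" by blast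
  qed
qed

section \<open>Interpolation of a scale decomposition\<close>

lemma nn_integral_powr_from_0:
  fixes u e :: real
  assumes "0 \<le> u" "0 < e"
  shows "(\<integral>\<^sup>+h\<in>{0..u}. ennreal (h powr (e - 1)) \<partial>lborel) = ennreal (u powr e / e)"
  using nn_integral_has_integral_lebesgue'[OF _ has_integral_powr_from_0[of "e - 1" u]] assms by simp

lemma nn_integral_powr_to_inf:
  fixes u e :: real
  assumes "0 < u" "0 < e"
  shows "(\<integral>\<^sup>+h\<in>{u..}. ennreal (h powr (- e - 1)) \<partial>lborel) = ennreal (u powr (- e) / e)"
  using nn_integral_has_integral_lebesgue'[OF _ has_integral_powr_to_inf[of "- e - 1" u]] assms by simp

text \<open>Substituting h powr (p / q) for the height in the layer-cake formula leaves the weight h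
  powr (p - 1). The parameter h is then the level at which the argument F of the operators is cut,
  although the operators map into a space with another exponent.\<close>

lemma layer_cake_powr:
  assumes "0 < q" "0 < p"
  shows "ennreal_powr X q \<le> ennreal p * (\<integral>\<^sup>+h\<in>{0<..}. ennreal (h powr (p - 1)) * indicator {h. ennreal (h powr (p / q)) < X} h \<partial>lborel)"
    (is "_ \<le> _ * ?I X")
proof -
  have fin: "ennreal (x powr q) \<le> ennreal p * ?I (ennreal x)" if "0 \<le> x" for x
  proof -
    define u where "u = x powr (q / p)"
    have u: "0 \<le> u" "u powr p = x powr q" "u powr (p / q) = x"
      using assms that by (auto simp: u_def powr_powr)
    have "ennreal (x powr q) = ennreal p * (\<integral>\<^sup>+h\<in>{0..u}. ennreal (h powr (p - 1)) \<partial>lborel)"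
      using assms u by (simp add: nn_integral_powr_from_0 ennreal_mult[symmetric])
    also have "(\<integral>\<^sup>+h\<in>{0..u}. ennreal (h powr (p - 1)) \<partial>lborel) = (\<integral>\<^sup>+h\<in>{0<..<u}. ennreal (h powr (p - 1)) \<partial>lborel)"
    proof (intro nn_integral_cong_AE)
      have "AE h in lborel. h \<noteq> 0" "AE h in lborel. h \<noteq> u" by (rule AE_lborel_singleton)+
      then show "AE h in lborel. ennreal (h powr (p - 1)) * indicator {0..u} h = ennreal (h powr (p - 1)) * indicator {0<..<u} h"
        by eventually_elim (auto simp: indicator_def)
    qed
    also have "\<dots> \<le> ?I (ennreal x)"
    proof (intro nn_integral_mono)
      fix h
      have "h powr (p / q) < x" if "0 < h" "h < u"
        using powr_less_mono2[of "p / q" h u] that assms u by simp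
      then show "ennreal (h powr (p - 1)) * indicator {0<..<u} h
        \<le> ennreal (h powr (p - 1)) * indicator {h. ennreal (h powr (p / q)) < ennreal x} h * indicator {0<..} h"
        using that by (auto simp: indicator_def ennreal_less_iff)
    qed
    finally show ?thesis by (simp add: mult_left_mono)
  qed
  show ?thesis
  proof (cases X)
    case (real x)
    then show ?thesis using fin[of x] by simp
  next
    case top
    \<comment> \<open>An infinite X lies above every natural number, so the finite case gives
      arbitrarily large lower bounds of the right-hand side.\<close>
    have le: "ennreal (real k powr q) \<le> ennreal p * ?I top" for k :: nat
    proof -
      have "?I (ennreal (real k)) \<le> ?I top"
        by (intro nn_integral_mono) (auto simp: indicator_def)
      then show ?thesis using fin[of "real k"] by (meson mult_left_mono of_nat_0_le_iff order_trans zero_le)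
    qed
    have unb: "\<exists>k::nat. y < real k powr q" for y
    proof -
      have "\<exists>k::nat. (max y 1 + 1) powr (1 / q) < real k" by (rule reals_Archimedean2)
      then obtain k :: nat where k: "(max y 1 + 1) powr (1 / q) < real k" by blast
      have "y < ((max y 1 + 1) powr (1 / q)) powr q" using assms by (simp add: powr_powr max_def)
      also have "\<dots> \<le> real k powr q" using k assms by (intro powr_mono2) auto
      finally show ?thesis by blast
    qed
    have "ennreal p * ?I top = top"
    proof (rule ccontr)
      assume "ennreal p * ?I top \<noteq> top"
      then obtain y where y: "ennreal p * ?I top = ennreal y" "0 \<le> y"
        by (cases "ennreal p * ?I top") auto
      obtain k :: nat where "y < real k powr q" using unb by blast
      moreover have "ennreal (real k powr q) \<le> ennreal y" using le[of k] y by simp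
      ultimately show False using y by simp
    qed
    then show ?thesis using top by simp
  qed
qed

text \<open>The bound is uniform in the position K of the peak, which may be fractional or negative.
  Rounding it to a natural number costs one factor 1 / \<rho>, and each side is then at most a
  geometric series.\<close>

lemma sum_two_sided_geometric:
  fixes K \<rho> :: real
  assumes "0 < \<rho>" "\<rho> < 1"
  shows "(\<Sum>k::nat. ennreal (\<rho> powr \<bar>real k - K\<bar>)) \<le> ennreal (2 / (\<rho> * (1 - \<rho>)))"
proof -
  have gs: "(\<Sum>k::nat. ennreal (\<rho> ^ k / \<rho>)) = ennreal (1 / (\<rho> * (1 - \<rho>)))"
  proof -
    have "(\<lambda>k. \<rho> ^ k * (1 / \<rho>)) sums ((1 / (1 - \<rho>)) * (1 / \<rho>))"
      using assms by (intro sums_mult2 geometric_sums) auto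
    then show ?thesis using assms
      by (intro sums_unique[symmetric]) (auto intro!: sums_ennreal[THEN iffD2] simp: mult.commute)
  qed
  define m where "m = nat \<lfloor>K\<rfloor>"
  have le: "ennreal (\<rho> powr \<bar>real k - K\<bar>) \<le> ennreal (\<rho> ^ (nat \<bar>int k - int m\<bar>) / \<rho>)" for k
  proof -
    have "real (nat \<bar>int k - int m\<bar>) - 1 \<le> \<bar>real k - K\<bar>"
      unfolding m_def by linarith
    then have "\<rho> powr \<bar>real k - K\<bar> \<le> \<rho> powr (real (nat \<bar>int k - int m\<bar>) - 1)"
      using assms by (intro powr_mono') auto
    also have "\<dots> = \<rho> ^ (nat \<bar>int k - int m\<bar>) / \<rho>"
      using assms by (subst powr_diff) (simp only: powr_realpow powr_one)
    finally show ?thesis by (rule ennreal_leI)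
  qed
  let ?g = "\<lambda>k. ennreal (\<rho> ^ (nat \<bar>int k - int m\<bar>) / \<rho>)"
  have "(\<Sum>k<m. ?g k) = (\<Sum>k<m. ennreal (\<rho> ^ Suc k / \<rho>))"
  proof (subst sum.nat_diff_reindex[symmetric], intro sum.cong refl)
    fix k assume "k \<in> {..<m}"
    then have "nat \<bar>int (m - Suc k) - int m\<bar> = Suc k" by auto
    then show "?g (m - Suc k) = ennreal (\<rho> ^ Suc k / \<rho>)" by (simp only:)
  qed
  also have "\<dots> \<le> (\<Sum>k<m. ennreal (\<rho> ^ k / \<rho>))"
    using assms by (intro sum_mono ennreal_leI divide_right_mono) (auto simp: mult_left_le_one_le)
  also have "\<dots> \<le> (\<Sum>k::nat. ennreal (\<rho> ^ k / \<rho>))"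
    by (intro sum_le_suminf) auto
  finally have low: "(\<Sum>k<m. ?g k) \<le> ennreal (1 / (\<rho> * (1 - \<rho>)))" unfolding gs .
  have high: "(\<Sum>k. ?g (k + m)) = ennreal (1 / (\<rho> * (1 - \<rho>)))"
    unfolding gs[symmetric] by (intro suminf_cong) simp
  have "(\<Sum>k. ennreal (\<rho> powr \<bar>real k - K\<bar>)) \<le> suminf ?g"
    by (intro suminf_le le) auto
  also have "suminf ?g = (\<Sum>k. ?g (k + m)) + (\<Sum>k<m. ?g k)"
    by (rule suminf_offset) simp
  also have "\<dots> \<le> ennreal (1 / (\<rho> * (1 - \<rho>))) + ennreal (1 / (\<rho> * (1 - \<rho>)))"
    by (intro add_mono low) (simp only: high)
  also have "\<dots> = ennreal (2 / (\<rho> * (1 - \<rho>)))"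
    using assms by (simp add: ennreal_plus[symmetric] add_divide_distrib[symmetric] del: ennreal_plus)
  finally show ?thesis .
qed

text \<open>Write h = 2 powr (K / p) and compare exponents of 2. Because 1 / q = 1 / p - \<beta>,
  the contributions of K alone cancel; what remains is r (k - K) (1 / s - 1 / r - \<beta>), which
  has a favourable sign by \<open>sgn\<close>, and the \<epsilon> terms.\<close>

lemma scale_exponent_bound:
  fixes k K p q s r \<beta> \<epsilon> W A h :: real
  assumes "0 < h" "0 < p" "0 < W" "0 \<le> A" "1 \<le> r" "0 < s" "0 < \<epsilon>" "0 < q"
    and q: "1 / q = 1 / p - \<beta>" and K: "K = p * log 2 h"
    and sgn: "(k - K) * (1 / s - 1 / r - \<beta>) \<le> - (2 * \<epsilon> * \<bar>k - K\<bar>)"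
  shows "(h powr (p / q) * (2 powr - \<epsilon>) powr \<bar>k - K\<bar> / (2 * W)) powr - r
      * (A * 2 powr (k * r * (1 / s - 1 / r - \<beta>)) * h powr ((s - p) * (r / s - 1)))
    \<le> A * (2 * W) powr r * (2 powr - \<epsilon>) powr \<bar>k - K\<bar> * h powr (- s)"
proof -
  define \<delta> where "\<delta> = 1 / s - 1 / r - \<beta>"
  define y where "y = \<bar>k - K\<bar>"
  have h: "h = 2 powr (K / p)" using assms by (simp add: K powr_log_cancel)
  let ?E1 = "- r * (K / q - \<epsilon> * y) + k * r * \<delta> + (K / p) * ((s - p) * (r / s - 1))"
  let ?E2 = "- (\<epsilon> * y) - (K / p) * s"
  have "(h powr (p / q) * (2 powr - \<epsilon>) powr y / (2 * W)) powr - r = (2 powr (K / q - \<epsilon> * y) / (2 * W)) powr - r"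
    using \<open>0 < p\<close> by (simp add: h powr_powr powr_add[symmetric])
  also have "\<dots> = (2 * W) powr r * 2 powr (- r * (K / q - \<epsilon> * y))"
  proof -
    have "(2 powr z / (2 * W)) powr - r = (2 * W) powr r * 2 powr (- r * z)" for z
    proof -
      have "(2 powr z / (2 * W)) powr - r = (2 powr z) powr - r / (2 * W) powr - r"
        by (rule powr_divide)
      also have "\<dots> = 2 powr (- r * z) / (1 / (2 * W) powr r)"
        by (simp only: powr_powr powr_minus_divide[of "2 * W"] mult.commute[of z])
      finally show ?thesis by simp
    qed
    then show ?thesis .
  qed
  finally have 1: "(h powr (p / q) * (2 powr - \<epsilon>) powr y / (2 * W)) powr - r = (2 * W) powr r * 2 powr (- r * (K / q - \<epsilon> * y))" .
  have 2: "h powr ((s - p) * (r / s - 1)) = 2 powr ((K / p) * ((s - p) * (r / s - 1)))"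
    by (simp add: h powr_powr)
  have 3: "(2 powr - \<epsilon>) powr y * h powr (- s) = 2 powr ?E2"
    by (simp add: h powr_powr powr_add[symmetric])
  have "?E1 - ?E2 = \<epsilon> * y * (1 + r) + r * ((k - K) * \<delta>)"
  proof -
    \<comment> \<open>With the reciprocals as variables the claim is a polynomial identity.\<close>
    define c d e i where "c = 1 / p" and "d = 1 / s" and "e = 1 / r" and "i = 1 / q"
    have eqs: "p * c = 1" "s * d = 1" "r * e = 1" "i = c - \<beta>" "\<delta> = d - e - \<beta>"
      using assms by (simp_all add: c_def d_def e_def i_def \<delta>_def)
    have div: "K / q = K * i" "K / p = K * c" "r / s = r * d"
      by (simp_all add: c_def d_def i_def)
    show ?thesis unfolding div using eqs by algebra
  qed
  \<comment> \<open>The gain 2 \<epsilon> r y pays for the weight of the threshold, raised to the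
    power r, and for the one factor of decay that is kept. This is where r \<ge> 1 enters.\<close>
  also have "\<dots> \<le> \<epsilon> * y * (1 + r) + r * (- (2 * \<epsilon> * y))"
    using sgn \<open>1 \<le> r\<close> unfolding \<delta>_def y_def by (intro add_left_mono mult_left_mono) auto
  also have "\<dots> = \<epsilon> * y * (1 - r)" by (simp add: algebra_simps)
  also have "\<dots> \<le> 0" using assms by (intro mult_nonneg_nonpos) (auto simp: y_def)
  finally have "2 powr ?E1 \<le> 2 powr ?E2" by (intro powr_mono) auto
  then have "(A * (2 * W) powr r) * 2 powr ?E1 \<le> (A * (2 * W) powr r) * 2 powr ?E2"
    using \<open>0 \<le> A\<close> by (intro mult_left_mono) auto
  then show ?thesis
    unfolding 1[unfolded y_def] 2 \<delta>_def[symmetric] 3[symmetric] powr_add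
    by (simp only: y_def mult_ac)
qed

section \<open>Weak and strong bounds for the sum over the scales\<close>

lemma emeasure_gt_le_powr:
  assumes [measurable]: "u \<in> borel_measurable M" and "0 < \<tau>" "0 < r"
  shows "emeasure M {x \<in> space M. ennreal \<tau> < u x} \<le> ennreal (\<tau> powr - r) * (\<integral>\<^sup>+x. ennreal_powr (u x) r \<partial>M)"
proof -
  have "emeasure M {x \<in> space M. ennreal \<tau> < u x}
    \<le> emeasure M {x \<in> space M. 1 \<le> ennreal (\<tau> powr - r) * ennreal_powr (u x) r}"
  proof (intro emeasure_mono subsetI)
    fix x assume x: "x \<in> {x \<in> space M. ennreal \<tau> < u x}"
    have "1 = ennreal (\<tau> powr - r) * ennreal_powr (ennreal \<tau>) r"
      using assms by (simp add: ennreal_mult[symmetric] powr_add[symmetric])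
    also have "\<dots> \<le> ennreal (\<tau> powr - r) * ennreal_powr (u x) r"
      using x assms by (intro mult_left_mono ennreal_powr_mono) auto
    finally show "x \<in> {x \<in> space M. 1 \<le> ennreal (\<tau> powr - r) * ennreal_powr (u x) r}" using x by simp
  qed measurable
  also have "\<dots> \<le> ennreal (\<tau> powr - r) * (\<integral>\<^sup>+x\<in>space M. ennreal_powr (u x) r \<partial>M)"
    by (rule nn_integral_Markov_inequality) auto
  also have "(\<integral>\<^sup>+x\<in>space M. ennreal_powr (u x) r \<partial>M) = (\<integral>\<^sup>+x. ennreal_powr (u x) r \<partial>M)"
    by (intro nn_integral_cong) auto
  finally show ?thesis .
qed

text \<open>Of the power J ^ (r / s) all but one factor J is estimated by its size. The bound stays
  linear in J, so it can later be integrated in h by Tonelli's theorem.\<close>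

lemma scale_piece_bound:
  fixes k K p q s r \<beta> \<epsilon> W A h :: real
  assumes [measurable]: "u \<in> borel_measurable M"
    and pos: "0 < h" "0 < p" "0 < W" "0 \<le> A" "1 \<le> r" "0 < s" "0 < \<epsilon>" "0 < q" "s < r"
    and q: "1 / q = 1 / p - \<beta>" and K: "K = p * log 2 h"
    and sgn: "(k - K) * (1 / s - 1 / r - \<beta>) \<le> - (2 * \<epsilon> * \<bar>k - K\<bar>)"
    and u: "(\<integral>\<^sup>+x. ennreal_powr (u x) r \<partial>M) \<le> ennreal (A * 2 powr (k * r * (1 / s - 1 / r - \<beta>))) * ennreal_powr J (r / s)"
    and J: "J \<le> ennreal (h powr (s - p))"
  shows "emeasure M {x \<in> space M. ennreal (h powr (p / q) * (2 powr - \<epsilon>) powr \<bar>k - K\<bar> / (2 * W)) < u x}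
    \<le> ennreal (A * (2 * W) powr r * (2 powr - \<epsilon>) powr \<bar>k - K\<bar>) * (ennreal (h powr (- s)) * J)"
proof -
  let ?\<tau> = "h powr (p / q) * (2 powr - \<epsilon>) powr \<bar>k - K\<bar> / (2 * W)"
  let ?D = "A * 2 powr (k * r * (1 / s - 1 / r - \<beta>))"
  have "ennreal_powr J (r / s) = ennreal_powr J (r / s - 1) * J"
    using ennreal_powr_add[of "r / s - 1" 1 J] pos by simp
  also have "\<dots> \<le> ennreal_powr (ennreal (h powr (s - p))) (r / s - 1) * J"
    using pos by (intro mult_right_mono ennreal_powr_mono J) auto
  also have "\<dots> = ennreal (h powr ((s - p) * (r / s - 1))) * J" by (simp add: powr_powr)
  finally have J': "ennreal_powr J (r / s) \<le> ennreal (h powr ((s - p) * (r / s - 1))) * J" .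
  have "emeasure M {x \<in> space M. ennreal ?\<tau> < u x} \<le> ennreal (?\<tau> powr - r) * (\<integral>\<^sup>+x. ennreal_powr (u x) r \<partial>M)"
    using pos by (intro emeasure_gt_le_powr) auto
  also have "\<dots> \<le> ennreal (?\<tau> powr - r) * (ennreal ?D * (ennreal (h powr ((s - p) * (r / s - 1))) * J))"
    by (intro mult_left_mono order_trans[OF u] J') auto
  also have "\<dots> = ennreal (?\<tau> powr - r * (?D * h powr ((s - p) * (r / s - 1)))) * J"
    using pos by (simp add: ennreal_mult mult.assoc)
  also have "\<dots> \<le> ennreal (A * (2 * W) powr r * (2 powr - \<epsilon>) powr \<bar>k - K\<bar> * h powr (- s)) * J"
    by (intro mult_right_mono ennreal_leI scale_exponent_bound pos q K sgn) auto
  finally show ?thesis using pos by (simp add: ennreal_mult mult.assoc)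
qed

text \<open>At scale \<open>k\<close> the operator sees sets of measure about \<open>2\<^sup>-\<^sup>k\<close>.\<close>

definition scale_family ::
  "'a measure \<Rightarrow> real \<Rightarrow> real set \<Rightarrow> real set \<Rightarrow> real \<Rightarrow> (nat \<Rightarrow> ('a \<Rightarrow> real) \<Rightarrow> 'a \<Rightarrow> ennreal) \<Rightarrow> bool" where
  "scale_family M \<beta> S R A T \<longleftrightarrow>
     (\<forall>k. \<forall>F\<in>borel_measurable M. T k F \<in> borel_measurable M) \<and>
     (\<forall>k. \<forall>F\<in>borel_measurable M. \<forall>G\<in>borel_measurable M. (\<forall>x. 0 \<le> F x) \<longrightarrow> (\<forall>x. 0 \<le> G x) \<longrightarrow>
        (\<forall>x. T k (\<lambda>x. F x + G x) x \<le> T k F x + T k G x)) \<and>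
     (\<forall>k. \<forall>s\<in>S. \<forall>r\<in>R. \<forall>F\<in>borel_measurable M. (\<forall>x. 0 \<le> F x) \<longrightarrow>
        (\<integral>\<^sup>+x. ennreal_powr (T k F x) r \<partial>M) \<le> ennreal (A * 2 powr (real k * r * (1 / s - 1 / r - \<beta>)))
          * ennreal_powr (\<integral>\<^sup>+x. ennreal (F x powr s) \<partial>M) (r / s))"

text \<open>Real interpolation in the style of Hedberg and Marcinkiewicz: at height \<open>h\<close>, both \<open>F\<close> and the
  scales are cut, the scales at \<open>2\<^sup>k = h\<^sup>p\<close>.\<close>

lemma weak_bound_of_scales:
  fixes p q p0 p1 r0 r1 \<beta> A :: real
  assumes pos: "1 < p0" "p0 < p" "p < p1" "p1 < r0" "r0 < r1" "0 \<le> A" "0 < q"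
    and q: "1 / q = 1 / p - \<beta>"
    and small: "1 / p0 - 1 / r0 - \<beta> < 0" and large: "0 < 1 / p1 - 1 / r1 - \<beta>"
  obtains C :: real where "0 \<le> C"
    "\<And>(M :: 'a measure) T F h. scale_family M \<beta> {p0, p1} {r0, r1} A T \<Longrightarrow>
     F \<in> borel_measurable M \<Longrightarrow> (\<And>x. 0 \<le> F x) \<Longrightarrow> (\<integral>\<^sup>+x. ennreal (F x powr p) \<partial>M) \<le> 1 \<Longrightarrow> 0 < h \<Longrightarrow>
     emeasure M {x \<in> space M. ennreal (h powr (p / q)) < (\<Sum>k. T k F x)}
       \<le> ennreal C * (ennreal (h powr - p1) * (\<integral>\<^sup>+x. ennreal (F x powr p1) * indicator {x. F x \<le> h} x \<partial>M)
         + ennreal (h powr - p0) * (\<integral>\<^sup>+x. ennreal (F x powr p0) * indicator {x. h < F x} x \<partial>M))"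
proof -
  have inv: "1 / p1 < 1 / p0" "1 / r1 < 1 / r0" using pos by (simp_all add: frac_less2)
  \<comment> \<open>Half of the smaller of the two gaps in \<open>small\<close> and
    \<open>large\<close>: one half becomes the weight of the thresholds, the other absorbs
    it.\<close>
  define \<epsilon> where "\<epsilon> = min (\<beta> + 1 / r0 - 1 / p0) (1 / p1 - 1 / r1 - \<beta>) / 2"
  have "0 < \<epsilon>" using small large by (simp add: \<epsilon>_def)
  define \<rho> where "\<rho> = (2 powr - \<epsilon> :: real)"
  have "2 powr - \<epsilon> < (2 powr 0 :: real)" using \<open>0 < \<epsilon>\<close> by (subst powr_less_cancel_iff) auto
  then have \<rho>: "0 < \<rho>" "\<rho> < 1" by (simp_all add: \<rho>_def)
  define W where "W = 2 / (\<rho> * (1 - \<rho>))"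
  have "0 < W" using \<rho> by (simp add: W_def)
  define B where "B = A * ((2 * W) powr r0 + (2 * W) powr r1)"
  have "0 \<le> B" using pos by (simp add: B_def)
  show ?thesis
  proof (rule that[of "B * W"])
    show "0 \<le> B * W" using \<open>0 \<le> B\<close> \<open>0 < W\<close> by simp
    fix M :: "'a measure" and T :: "nat \<Rightarrow> ('a \<Rightarrow> real) \<Rightarrow> 'a \<Rightarrow> ennreal" and F :: "'a \<Rightarrow> real" and h :: real
    assume fam: "scale_family M \<beta> {p0, p1} {r0, r1} A T"
      and F [measurable]: "F \<in> borel_measurable M" and Fpos: "\<And>x. 0 \<le> F x"
      and norm: "(\<integral>\<^sup>+x. ennreal (F x powr p) \<partial>M) \<le> 1" and "0 < h"
    note fam' = fam[unfolded scale_family_def]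
    have meas: "T k F \<in> borel_measurable M" if "F \<in> borel_measurable M" for k F
      using fam' that by blast
    have subadd: "T k (\<lambda>x. F x + G x) x \<le> T k F x + T k G x"
      if "F \<in> borel_measurable M" "G \<in> borel_measurable M" "\<And>x. 0 \<le> F x" "\<And>x. 0 \<le> G x" for k F G x
      using fam' that by blast
    have bound: "(\<integral>\<^sup>+x. ennreal_powr (T k F x) r \<partial>M) \<le> ennreal (A * 2 powr (real k * r * (1 / s - 1 / r - \<beta>)))
          * ennreal_powr (\<integral>\<^sup>+x. ennreal (F x powr s) \<partial>M) (r / s)"
      if "s \<in> {p0, p1}" "r \<in> {r0, r1}" "F \<in> borel_measurable M" "\<And>x. 0 \<le> F x" for k s r F
      using fam' that by blast
    define F0 F1 where "F0 x = (if h < F x then F x else 0)" and "F1 x = (if F x \<le> h then F x else 0)" for x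
    have [measurable]: "F0 \<in> borel_measurable M" "F1 \<in> borel_measurable M"
      unfolding F0_def F1_def by measurable
    have F01: "0 \<le> F0 x" "0 \<le> F1 x" "F x = F0 x + F1 x" for x
      using Fpos by (auto simp: F0_def F1_def)
    define J0 where "J0 = (\<integral>\<^sup>+x. ennreal (F0 x powr p0) \<partial>M)"
    define J1 where "J1 = (\<integral>\<^sup>+x. ennreal (F1 x powr p1) \<partial>M)"
    have J0_eq: "J0 = (\<integral>\<^sup>+x. ennreal (F x powr p0) * indicator {x. h < F x} x \<partial>M)"
      unfolding J0_def by (intro nn_integral_cong) (auto simp: F0_def)
    have J1_eq: "J1 = (\<integral>\<^sup>+x. ennreal (F x powr p1) * indicator {x. F x \<le> h} x \<partial>M)"
      unfolding J1_def by (intro nn_integral_cong) (auto simp: F1_def)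
    \<comment> \<open>On the part above h a power s < p is at most h powr (s - p) times the p-th
      power, and on the part up to h the same holds for s > p. Both parts thus inherit the
      normalisation of F.\<close>
    have Jle: "(\<integral>\<^sup>+x. ennreal (G x powr s) \<partial>M) \<le> ennreal (h powr (s - p))"
      if "\<And>x. G x powr s \<le> h powr (s - p) * F x powr p" for G :: "'a \<Rightarrow> real" and s
    proof -
      have "(\<integral>\<^sup>+x. ennreal (G x powr s) \<partial>M) \<le> (\<integral>\<^sup>+x. ennreal (h powr (s - p)) * ennreal (F x powr p) \<partial>M)"
        using that by (intro nn_integral_mono) (auto simp: ennreal_mult[symmetric] intro!: ennreal_leI)
      also have "\<dots> = ennreal (h powr (s - p)) * (\<integral>\<^sup>+x. ennreal (F x powr p) \<partial>M)"
        by (intro nn_integral_cmult) measurable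
      also have "\<dots> \<le> ennreal (h powr (s - p)) * 1" by (intro mult_left_mono norm) auto
      finally show ?thesis by simp
    qed
    have J0: "J0 \<le> ennreal (h powr (p0 - p))"
      unfolding J0_def
    proof (rule Jle)
      fix x show "F0 x powr p0 \<le> h powr (p0 - p) * F x powr p"
      proof (cases "h < F x")
        case True
        have "F x powr p0 = F x powr (p0 - p) * F x powr p" by (simp add: powr_add[symmetric])
        also have "F x powr (p0 - p) \<le> h powr (p0 - p)"
          using True \<open>0 < h\<close> pos by (intro powr_mono2') auto
        finally show ?thesis using True by (simp add: F0_def mult_right_mono)
      qed (simp add: F0_def)
    qed
    have J1: "J1 \<le> ennreal (h powr (p1 - p))"
      unfolding J1_def
    proof (rule Jle)
      fix x show "F1 x powr p1 \<le> h powr (p1 - p) * F x powr p"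
      proof (cases "F x \<le> h")
        case True
        have "F x powr p1 = F x powr (p1 - p) * F x powr p" by (simp add: powr_add[symmetric])
        also have "F x powr (p1 - p) \<le> h powr (p1 - p)"
          using True Fpos pos by (intro powr_mono2) auto
        finally show ?thesis using True by (simp add: F1_def mult_right_mono)
      qed (simp add: F1_def)
    qed
    define K where "K = p * log 2 h"
    \<comment> \<open>The thresholds of the two parts, summed over all scales, stay below h powr (p
      / q), since W bounds the two-sided geometric series.\<close>
    define \<tau> where "\<tau> k = h powr (p / q) * \<rho> powr \<bar>real k - K\<bar> / (2 * W)" for k :: nat
    have piece: "emeasure M {x \<in> space M. ennreal (\<tau> k) < T k G x}
        \<le> ennreal (B * \<rho> powr \<bar>real k - K\<bar>) * (ennreal (h powr (- s)) * J)"
      if s: "s \<in> {p0, p1}" and G: "G \<in> borel_measurable M" "\<And>x. 0 \<le> G x"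
        and J: "J = (\<integral>\<^sup>+x. ennreal (G x powr s) \<partial>M)" "J \<le> ennreal (h powr (s - p))" for s G J k
    proof -
      \<comment> \<open>Beyond the critical scale the exponent must be negative, before it positive.
        One choice of r serves both s, because 1 / p1 < 1 / p0: the condition \<open>small\<close>
        at p0 implies the one at p1, and \<open>large\<close> at p1 the one at p0.\<close>
      define r where "r = (if K \<le> real k then r0 else r1)"
      have r: "r \<in> {r0, r1}" "1 \<le> r" "s < r" "0 < s" "0 < p" using pos s by (auto simp: r_def)
      have sgn: "(real k - K) * (1 / s - 1 / r - \<beta>) \<le> - (2 * \<epsilon> * \<bar>real k - K\<bar>)"
      proof (cases "K \<le> real k")
        case True
        have "1 / s - 1 / r - \<beta> \<le> - (2 * \<epsilon>)" using True s inv by (auto simp: r_def \<epsilon>_def min_def)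
        then have "(real k - K) * (1 / s - 1 / r - \<beta>) \<le> (real k - K) * (- (2 * \<epsilon>))"
          using True by (intro mult_left_mono) auto
        then show ?thesis using True by (simp add: mult_ac)
      next
        case False
        have "2 * \<epsilon> \<le> 1 / s - 1 / r - \<beta>" using False s inv by (auto simp: r_def \<epsilon>_def min_def)
        then have "(K - real k) * (2 * \<epsilon>) \<le> (K - real k) * (1 / s - 1 / r - \<beta>)"
          using False by (intro mult_left_mono) auto
        then show ?thesis using False by (simp add: algebra_simps)
      qed
      have "emeasure M {x \<in> space M. ennreal (\<tau> k) < T k G x}
        \<le> ennreal (A * (2 * W) powr r * (2 powr - \<epsilon>) powr \<bar>real k - K\<bar>) * (ennreal (h powr (- s)) * J)"
        unfolding \<tau>_def \<rho>_def
        by (rule scale_piece_bound[where \<beta> = \<beta>])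
           (use meas[OF G(1), of k] \<open>0 < h\<close> r \<open>0 < W\<close> pos \<open>0 < \<epsilon>\<close> q K_def sgn bound[OF s r(1) G, of k] J in auto)
      also have "\<dots> \<le> ennreal (B * \<rho> powr \<bar>real k - K\<bar>) * (ennreal (h powr (- s)) * J)"
        using pos r(1) unfolding \<rho>_def[symmetric] B_def
        by (intro mult_right_mono ennreal_leI mult_left_mono) auto
      finally show ?thesis .
    qed
    define Y where "Y = ennreal (h powr (- p1)) * J1 + ennreal (h powr (- p0)) * J0"
    \<comment> \<open>Pigeonhole: if no part at any scale exceeds its threshold, subadditivity and
      the choice of W keep the whole sum within the level.\<close>
    have incl: "{x \<in> space M. ennreal (h powr (p / q)) < (\<Sum>k. T k F x)}
      \<subseteq> (\<Union>k. {x \<in> space M. ennreal (\<tau> k) < T k F1 x} \<union> {x \<in> space M. ennreal (\<tau> k) < T k F0 x})"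
    proof (rule ccontr)
      assume "\<not> ?thesis"
      then obtain x where x: "x \<in> space M" "ennreal (h powr (p / q)) < (\<Sum>k. T k F x)"
        and notin: "x \<notin> (\<Union>k. {x \<in> space M. ennreal (\<tau> k) < T k F1 x} \<union> {x \<in> space M. ennreal (\<tau> k) < T k F0 x})"
        by blast
      have nx: "T k F1 x \<le> ennreal (\<tau> k)" "T k F0 x \<le> ennreal (\<tau> k)" for k
        using notin x(1) by (auto simp: not_less)
      have "(\<Sum>k. T k F x) \<le> (\<Sum>k. ennreal (h powr (p / q) / W) * ennreal (\<rho> powr \<bar>real k - K\<bar>))"
      proof (intro suminf_le)
        fix k
        have "T k F x = T k (\<lambda>x. F0 x + F1 x) x" using F01(3) by (metis (no_types) ext)
        also have "\<dots> \<le> T k F0 x + T k F1 x" by (intro subadd F01) auto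
        also have "\<dots> \<le> ennreal (\<tau> k) + ennreal (\<tau> k)" by (intro add_mono nx)
        also have "\<dots> = ennreal (h powr (p / q) / W) * ennreal (\<rho> powr \<bar>real k - K\<bar>)"
          using \<open>0 < W\<close> by (simp add: \<tau>_def ennreal_plus[symmetric] ennreal_mult[symmetric] field_simps del: ennreal_plus)
        finally show "T k F x \<le> ennreal (h powr (p / q) / W) * ennreal (\<rho> powr \<bar>real k - K\<bar>)" .
      qed auto
      also have "\<dots> = ennreal (h powr (p / q) / W) * (\<Sum>k. ennreal (\<rho> powr \<bar>real k - K\<bar>))"
        by (rule ennreal_suminf_cmult)
      also have "\<dots> \<le> ennreal (h powr (p / q) / W) * ennreal W"
        unfolding W_def by (intro mult_left_mono sum_two_sided_geometric \<rho>) auto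
      also have "\<dots> = ennreal (h powr (p / q))" using \<open>0 < W\<close> by (simp add: ennreal_mult[symmetric])
      finally show False using x by simp
    qed
    have [measurable]: "T k F0 \<in> borel_measurable M" "T k F1 \<in> borel_measurable M" for k
      by (auto intro: meas)
    have "emeasure M {x \<in> space M. ennreal (h powr (p / q)) < (\<Sum>k. T k F x)}
      \<le> emeasure M (\<Union>k. {x \<in> space M. ennreal (\<tau> k) < T k F1 x} \<union> {x \<in> space M. ennreal (\<tau> k) < T k F0 x})"
      by (intro emeasure_mono incl) measurable
    also have "\<dots> \<le> (\<Sum>k. emeasure M ({x \<in> space M. ennreal (\<tau> k) < T k F1 x} \<union> {x \<in> space M. ennreal (\<tau> k) < T k F0 x}))"
      by (intro emeasure_subadditive_countably) auto
    also have "\<dots> \<le> (\<Sum>k. ennreal B * Y * ennreal (\<rho> powr \<bar>real k - K\<bar>))"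
    proof (intro suminf_le)
      fix k
      have "emeasure M ({x \<in> space M. ennreal (\<tau> k) < T k F1 x} \<union> {x \<in> space M. ennreal (\<tau> k) < T k F0 x})
        \<le> emeasure M {x \<in> space M. ennreal (\<tau> k) < T k F1 x} + emeasure M {x \<in> space M. ennreal (\<tau> k) < T k F0 x}"
        by (intro emeasure_subadditive) auto
      also have "\<dots> \<le> ennreal (B * \<rho> powr \<bar>real k - K\<bar>) * (ennreal (h powr (- p1)) * J1)
          + ennreal (B * \<rho> powr \<bar>real k - K\<bar>) * (ennreal (h powr (- p0)) * J0)"
        by (intro add_mono piece[OF _ _ _ J1_def J1] piece[OF _ _ _ J0_def J0] F01) auto
      also have "\<dots> = ennreal B * Y * ennreal (\<rho> powr \<bar>real k - K\<bar>)"
        unfolding Y_def using \<open>0 \<le> B\<close> by (simp add: ennreal_mult distrib_left mult_ac)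
      finally show "emeasure M ({x \<in> space M. ennreal (\<tau> k) < T k F1 x} \<union> {x \<in> space M. ennreal (\<tau> k) < T k F0 x})
        \<le> ennreal B * Y * ennreal (\<rho> powr \<bar>real k - K\<bar>)" .
    qed auto
    also have "\<dots> = ennreal B * Y * (\<Sum>k. ennreal (\<rho> powr \<bar>real k - K\<bar>))"
      by (rule ennreal_suminf_cmult)
    also have "\<dots> \<le> ennreal B * Y * ennreal W"
      unfolding W_def by (intro mult_left_mono sum_two_sided_geometric \<rho>) auto
    also have "\<dots> = ennreal (B * W) * Y" using \<open>0 \<le> B\<close> \<open>0 < W\<close> by (simp add: ennreal_mult mult_ac)
    finally show "emeasure M {x \<in> space M. ennreal (h powr (p / q)) < (\<Sum>k. T k F x)}
      \<le> ennreal (B * W) * (ennreal (h powr - p1) * (\<integral>\<^sup>+x. ennreal (F x powr p1) * indicator {x. F x \<le> h} x \<partial>M)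
         + ennreal (h powr - p0) * (\<integral>\<^sup>+x. ennreal (F x powr p0) * indicator {x. h < F x} x \<partial>M))"
      unfolding Y_def J0_eq J1_eq .
  qed
qed

text \<open>Integrate the weak bound against h powr (p - 1) and exchange the integrals. The powers
  of h left over are integrable at infinity for the part below h and at 0 for the part above h, as
  p0 < p < p1, and both integrals return a multiple of F powr p.\<close>

lemma strong_bound_of_scales:
  fixes p q p0 p1 r0 r1 \<beta> A :: real
  assumes pos: "1 < p0" "p0 < p" "p < p1" "p1 < r0" "r0 < r1" "0 \<le> A" "0 < q"
    and q: "1 / q = 1 / p - \<beta>"
    and small: "1 / p0 - 1 / r0 - \<beta> < 0" and large: "0 < 1 / p1 - 1 / r1 - \<beta>"
  obtains C :: real where "0 \<le> C"
    "\<And>(M :: 'a measure) T F. sigma_finite_measure M \<Longrightarrow>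
     scale_family M \<beta> {p0, p1} {r0, r1} A T \<Longrightarrow>
     F \<in> borel_measurable M \<Longrightarrow> (\<And>x. 0 \<le> F x) \<Longrightarrow> (\<integral>\<^sup>+x. ennreal (F x powr p) \<partial>M) \<le> 1 \<Longrightarrow>
     (\<integral>\<^sup>+x. ennreal_powr (\<Sum>k. T k F x) q \<partial>M) \<le> ennreal C"
proof -
  obtain C1 :: real where "0 \<le> C1" and C1:
    "\<And>(M :: 'a measure) T F h. scale_family M \<beta> {p0, p1} {r0, r1} A T \<Longrightarrow>
     F \<in> borel_measurable M \<Longrightarrow> (\<And>x. 0 \<le> F x) \<Longrightarrow> (\<integral>\<^sup>+x. ennreal (F x powr p) \<partial>M) \<le> 1 \<Longrightarrow> 0 < h \<Longrightarrow>
     emeasure M {x \<in> space M. ennreal (h powr (p / q)) < (\<Sum>k. T k F x)}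
       \<le> ennreal C1 * (ennreal (h powr - p1) * (\<integral>\<^sup>+x. ennreal (F x powr p1) * indicator {x. F x \<le> h} x \<partial>M)
         + ennreal (h powr - p0) * (\<integral>\<^sup>+x. ennreal (F x powr p0) * indicator {x. h < F x} x \<partial>M))"
    by (rule weak_bound_of_scales[OF assms, where 'a='a]) blast
  define D where "D = p * C1 * (1 / (p1 - p) + 1 / (p - p0))"
  show ?thesis
  proof (rule that[of D])
    show "0 \<le> D" using pos \<open>0 \<le> C1\<close> by (simp add: D_def)
    fix M :: "'a measure" and T :: "nat \<Rightarrow> ('a \<Rightarrow> real) \<Rightarrow> 'a \<Rightarrow> ennreal" and F :: "'a \<Rightarrow> real"
    assume sf: "sigma_finite_measure M"
      and fam: "scale_family M \<beta> {p0, p1} {r0, r1} A T"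
      and F [measurable]: "F \<in> borel_measurable M" and Fpos: "\<And>x. 0 \<le> F x"
      and norm: "(\<integral>\<^sup>+x. ennreal (F x powr p) \<partial>M) \<le> 1"
    interpret sigma_finite_measure M by fact
    interpret pair_sigma_finite M "lborel :: real measure" ..
    have [measurable]: "T k F \<in> borel_measurable M" for k
      using fam F unfolding scale_family_def by blast
    define X where "X x = (\<Sum>k. T k F x)" for x
    have X [measurable]: "X \<in> borel_measurable M" unfolding X_def by measurable
    let ?w = "\<lambda>h x. ennreal (h powr (p - 1)) * indicator {h. ennreal (h powr (p / q)) < X x} h * indicator {0<..} h"
    have ind: "indicator {h. ennreal (h powr (p / q)) < X x} h = (if ennreal (h powr (p / q)) < X x then 1 else 0 :: ennreal)" for x h
      by (simp add: indicator_def)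
    have pw: "ennreal (h powr (p - 1)) * (indicator {0<..} h * emeasure M {x \<in> space M. ennreal (h powr (p / q)) < X x})
      \<le> ennreal C1 * ((\<integral>\<^sup>+x. ennreal (F x powr p1) * (ennreal (h powr (- (p1 - p) - 1)) * indicator {x. F x \<le> h \<and> 0 < h} x) \<partial>M)
         + (\<integral>\<^sup>+x. ennreal (F x powr p0) * (ennreal (h powr (p - p0 - 1)) * indicator {x. h < F x \<and> 0 < h} x) \<partial>M))" for h
    proof (cases "0 < h")
      case True
      have c1: "emeasure M {x \<in> space M. ennreal (h powr (p / q)) < X x}
        \<le> ennreal C1 * (ennreal (h powr - p1) * (\<integral>\<^sup>+x. ennreal (F x powr p1) * indicator {x. F x \<le> h} x \<partial>M)
         + ennreal (h powr - p0) * (\<integral>\<^sup>+x. ennreal (F x powr p0) * indicator {x. h < F x} x \<partial>M))"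
        unfolding X_def by (rule C1[of M T F h]) (fact fam F Fpos norm True)+
      have "ennreal (h powr (p - 1)) * (indicator {0<..} h * emeasure M {x \<in> space M. ennreal (h powr (p / q)) < X x})
        \<le> ennreal (h powr (p - 1)) * (ennreal C1 * (ennreal (h powr - p1) * (\<integral>\<^sup>+x. ennreal (F x powr p1) * indicator {x. F x \<le> h} x \<partial>M)
         + ennreal (h powr - p0) * (\<integral>\<^sup>+x. ennreal (F x powr p0) * indicator {x. h < F x} x \<partial>M)))"
        using True by (simp only: indicator_simps greaterThan_iff mult_1) (intro mult_left_mono c1 zero_le)
      also have "\<dots> = ennreal C1 * (ennreal (h powr (p - 1)) * ennreal (h powr - p1) * (\<integral>\<^sup>+x. ennreal (F x powr p1) * indicator {x. F x \<le> h} x \<partial>M)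
         + ennreal (h powr (p - 1)) * ennreal (h powr - p0) * (\<integral>\<^sup>+x. ennreal (F x powr p0) * indicator {x. h < F x} x \<partial>M))"
        by (simp add: distrib_left mult_ac)
      also have "ennreal (h powr (p - 1)) * ennreal (h powr - p1) = ennreal (h powr (- (p1 - p) - 1))"
        by (simp add: ennreal_mult[symmetric] powr_add[symmetric] algebra_simps)
      also have "ennreal (h powr (p - 1)) * ennreal (h powr - p0) = ennreal (h powr (p - p0 - 1))"
        by (simp add: ennreal_mult[symmetric] powr_add[symmetric] algebra_simps)
      also have "ennreal (h powr (- (p1 - p) - 1)) * (\<integral>\<^sup>+x. ennreal (F x powr p1) * indicator {x. F x \<le> h} x \<partial>M)
        = (\<integral>\<^sup>+x. ennreal (F x powr p1) * (ennreal (h powr (- (p1 - p) - 1)) * indicator {x. F x \<le> h \<and> 0 < h} x) \<partial>M)"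
        using True by (subst nn_integral_cmult[symmetric]) (auto intro!: nn_integral_cong simp: indicator_def mult_ac)
      also have "ennreal (h powr (p - p0 - 1)) * (\<integral>\<^sup>+x. ennreal (F x powr p0) * indicator {x. h < F x} x \<partial>M)
        = (\<integral>\<^sup>+x. ennreal (F x powr p0) * (ennreal (h powr (p - p0 - 1)) * indicator {x. h < F x \<and> 0 < h} x) \<partial>M)"
        using True by (subst nn_integral_cmult[symmetric]) (auto intro!: nn_integral_cong simp: indicator_def mult_ac)
      finally show ?thesis .
    qed simp
    have "(\<integral>\<^sup>+x. ennreal_powr (X x) q \<partial>M) \<le> (\<integral>\<^sup>+x. ennreal p * (\<integral>\<^sup>+h. ?w h x \<partial>lborel) \<partial>M)"
      using pos by (intro nn_integral_mono layer_cake_powr) auto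
    also have "\<dots> = ennreal p * (\<integral>\<^sup>+x. (\<integral>\<^sup>+h. ?w h x \<partial>lborel) \<partial>M)"
      unfolding ind by (intro nn_integral_cmult) measurable
    also have "(\<integral>\<^sup>+x. (\<integral>\<^sup>+h. ?w h x \<partial>lborel) \<partial>M) = (\<integral>\<^sup>+h. (\<integral>\<^sup>+x. ?w h x \<partial>M) \<partial>lborel)"
      unfolding ind by (intro Fubini'[symmetric]) measurable
    also have "\<dots> = (\<integral>\<^sup>+h. ennreal (h powr (p - 1)) * (indicator {0<..} h * emeasure M {x \<in> space M. ennreal (h powr (p / q)) < X x}) \<partial>lborel)"
    proof (intro nn_integral_cong)
      fix h :: real
      have "(\<integral>\<^sup>+x. ?w h x \<partial>M) = (\<integral>\<^sup>+x. (ennreal (h powr (p - 1)) * indicator {0<..} h) * indicator {x \<in> space M. ennreal (h powr (p / q)) < X x} x \<partial>M)"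
        by (intro nn_integral_cong) (auto simp: indicator_def)
      also have "\<dots> = (ennreal (h powr (p - 1)) * indicator {0<..} h) * emeasure M {x \<in> space M. ennreal (h powr (p / q)) < X x}"
        by (intro nn_integral_cmult_indicator) measurable
      finally show "(\<integral>\<^sup>+x. ?w h x \<partial>M) = ennreal (h powr (p - 1)) * (indicator {0<..} h * emeasure M {x \<in> space M. ennreal (h powr (p / q)) < X x})"
        by (simp add: mult_ac)
    qed
    also have "\<dots> \<le> (\<integral>\<^sup>+h. ennreal C1 * ((\<integral>\<^sup>+x. ennreal (F x powr p1) * (ennreal (h powr (- (p1 - p) - 1)) * indicator {x. F x \<le> h \<and> 0 < h} x) \<partial>M)
         + (\<integral>\<^sup>+x. ennreal (F x powr p0) * (ennreal (h powr (p - p0 - 1)) * indicator {x. h < F x \<and> 0 < h} x) \<partial>M)) \<partial>lborel)"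
      by (intro nn_integral_mono pw)
    also have "\<dots> = ennreal C1 * ((\<integral>\<^sup>+h. \<integral>\<^sup>+x. ennreal (F x powr p1) * (ennreal (h powr (- (p1 - p) - 1)) * indicator {x. F x \<le> h \<and> 0 < h} x) \<partial>M \<partial>lborel)
         + (\<integral>\<^sup>+h. \<integral>\<^sup>+x. ennreal (F x powr p0) * (ennreal (h powr (p - p0 - 1)) * indicator {x. h < F x \<and> 0 < h} x) \<partial>M \<partial>lborel))"
      unfolding indicator_def of_bool_def mem_Collect_eq
      by (subst nn_integral_cmult, measurable, subst nn_integral_add, measurable)
    also have "(\<integral>\<^sup>+h. \<integral>\<^sup>+x. ennreal (F x powr p1) * (ennreal (h powr (- (p1 - p) - 1)) * indicator {x. F x \<le> h \<and> 0 < h} x) \<partial>M \<partial>lborel)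
      \<le> ennreal (1 / (p1 - p))"
    proof -
      have "(\<integral>\<^sup>+h. \<integral>\<^sup>+x. ennreal (F x powr p1) * (ennreal (h powr (- (p1 - p) - 1)) * indicator {x. F x \<le> h \<and> 0 < h} x) \<partial>M \<partial>lborel)
        = (\<integral>\<^sup>+x. \<integral>\<^sup>+h. ennreal (F x powr p1) * (ennreal (h powr (- (p1 - p) - 1)) * indicator {x. F x \<le> h \<and> 0 < h} x) \<partial>lborel \<partial>M)"
        unfolding indicator_def of_bool_def mem_Collect_eq by (intro Fubini') measurable
      also have "\<dots> \<le> (\<integral>\<^sup>+x. ennreal (1 / (p1 - p)) * ennreal (F x powr p) \<partial>M)"
      proof (intro nn_integral_mono)
        fix x
        show "(\<integral>\<^sup>+h. ennreal (F x powr p1) * (ennreal (h powr (- (p1 - p) - 1)) * indicator {x. F x \<le> h \<and> 0 < h} x) \<partial>lborel)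
          \<le> ennreal (1 / (p1 - p)) * ennreal (F x powr p)"
        \<comment> \<open>For F x = 0 the integral in h would begin at its singularity; there the
          factor F x powr p1 is 0.\<close>
        proof (cases "F x = 0")
          case False
          then have "0 < F x" using Fpos[of x] by simp
          have "(\<integral>\<^sup>+h. ennreal (F x powr p1) * (ennreal (h powr (- (p1 - p) - 1)) * indicator {x. F x \<le> h \<and> 0 < h} x) \<partial>lborel)
            = (\<integral>\<^sup>+h. ennreal (F x powr p1) * (ennreal (h powr (- (p1 - p) - 1)) * indicator {F x..} h) \<partial>lborel)"
            using \<open>0 < F x\<close> by (intro nn_integral_cong) (auto simp: indicator_def)
          also have "\<dots> = ennreal (F x powr p1) * (\<integral>\<^sup>+h\<in>{F x..}. ennreal (h powr (- (p1 - p) - 1)) \<partial>lborel)"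
            by (intro nn_integral_cmult) measurable
          also have "\<dots> = ennreal (F x powr p1) * ennreal (F x powr (- (p1 - p)) / (p1 - p))"
            using \<open>0 < F x\<close> pos by (subst nn_integral_powr_to_inf) auto
          also have "\<dots> = ennreal (1 / (p1 - p)) * ennreal (F x powr p)"
            using pos by (simp add: ennreal_mult[symmetric] powr_add[symmetric])
          finally show ?thesis by simp
        qed simp
      qed
      also have "\<dots> = ennreal (1 / (p1 - p)) * (\<integral>\<^sup>+x. ennreal (F x powr p) \<partial>M)"
        by (intro nn_integral_cmult) measurable
      also have "\<dots> \<le> ennreal (1 / (p1 - p)) * 1" by (intro mult_left_mono norm) auto
      finally show ?thesis by simp
    qed
    also have "(\<integral>\<^sup>+h. \<integral>\<^sup>+x. ennreal (F x powr p0) * (ennreal (h powr (p - p0 - 1)) * indicator {x. h < F x \<and> 0 < h} x) \<partial>M \<partial>lborel)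
      \<le> ennreal (1 / (p - p0))"
    proof -
      have "(\<integral>\<^sup>+h. \<integral>\<^sup>+x. ennreal (F x powr p0) * (ennreal (h powr (p - p0 - 1)) * indicator {x. h < F x \<and> 0 < h} x) \<partial>M \<partial>lborel)
        = (\<integral>\<^sup>+x. \<integral>\<^sup>+h. ennreal (F x powr p0) * (ennreal (h powr (p - p0 - 1)) * indicator {x. h < F x \<and> 0 < h} x) \<partial>lborel \<partial>M)"
        unfolding indicator_def of_bool_def mem_Collect_eq by (intro Fubini') measurable
      also have "\<dots> \<le> (\<integral>\<^sup>+x. ennreal (1 / (p - p0)) * ennreal (F x powr p) \<partial>M)"
      proof (intro nn_integral_mono)
        fix x
        have "(\<integral>\<^sup>+h. ennreal (F x powr p0) * (ennreal (h powr (p - p0 - 1)) * indicator {x. h < F x \<and> 0 < h} x) \<partial>lborel)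
          \<le> (\<integral>\<^sup>+h. ennreal (F x powr p0) * (ennreal (h powr (p - p0 - 1)) * indicator {0..F x} h) \<partial>lborel)"
          by (intro nn_integral_mono) (auto simp: indicator_def)
        also have "\<dots> = ennreal (F x powr p0) * (\<integral>\<^sup>+h\<in>{0..F x}. ennreal (h powr (p - p0 - 1)) \<partial>lborel)"
          by (intro nn_integral_cmult) measurable
        also have "\<dots> = ennreal (F x powr p0) * ennreal (F x powr (p - p0) / (p - p0))"
          using Fpos pos by (subst nn_integral_powr_from_0) auto
        also have "\<dots> = ennreal (1 / (p - p0)) * ennreal (F x powr p)"
          using pos by (simp add: ennreal_mult[symmetric] powr_add[symmetric])
        finally show "(\<integral>\<^sup>+h. ennreal (F x powr p0) * (ennreal (h powr (p - p0 - 1)) * indicator {x. h < F x \<and> 0 < h} x) \<partial>lborel)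
          \<le> ennreal (1 / (p - p0)) * ennreal (F x powr p)" .
      qed
      also have "\<dots> = ennreal (1 / (p - p0)) * (\<integral>\<^sup>+x. ennreal (F x powr p) \<partial>M)"
        by (intro nn_integral_cmult) measurable
      also have "\<dots> \<le> ennreal (1 / (p - p0)) * 1" by (intro mult_left_mono norm) auto
      finally show ?thesis by simp
    qed
    also have "ennreal p * (ennreal C1 * (ennreal (1 / (p1 - p)) + ennreal (1 / (p - p0)))) = ennreal D"
      using pos \<open>0 \<le> C1\<close> unfolding D_def by (simp add: ennreal_mult ennreal_plus mult.assoc)
    finally show "(\<integral>\<^sup>+x. ennreal_powr (\<Sum>k. T k F x) q \<partial>M) \<le> ennreal D"
      unfolding X_def by (simp add: mult_left_mono add_mono)
  qed
qed

section \<open>The Gauss measure at the admissible scale\<close>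

lemma sets_ball_borel [measurable]: "ball x e \<in> sets borel"
  by simp

lemma admissible_pos [simp]: "0 < admissible x"
  by (simp add: admissible_def)

lemma admissible_nonneg [simp]: "0 \<le> admissible x"
  by (rule less_imp_le) simp

lemma admissible_le_1: "admissible x \<le> 1"
  by (simp add: admissible_def)

lemma admissible_mult_norm_le_1: "admissible x * norm x \<le> 1"
  by (auto simp: admissible_def min_def field_simps)

lemma admissible_ge:
  assumes "0 < t" "t \<le> 1" "t * norm x \<le> 1"
  shows "t \<le> admissible x"
  using assms by (auto simp: admissible_def field_simps)

lemma measurable_admissible [measurable]: "admissible \<in> borel_measurable borel"
  unfolding admissible_def by measurable

definition wt :: "real ^ 'n \<Rightarrow> real" where
  "wt x = exp (- (norm x)\<^sup>2)"

lemma wt_pos [simp]: "0 < wt x" by (simp add: wt_def)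

lemma wt_nonneg [simp]: "0 \<le> wt x"
  by (rule less_imp_le) simp

lemma wt_le_1: "wt x \<le> 1" by (simp add: wt_def)

lemma measurable_wt [measurable]: "wt \<in> borel_measurable borel"
  unfolding wt_def by measurable

text \<open>The difference of the squared norms is at most |x - y| (2 |x| + |x - y|), and
  \<open>admissible x * norm x \<le> 1\<close> bounds this by 2 A + A^2. The weight therefore
  changes by a bounded factor although its logarithm is unbounded.\<close>

lemma wt_admissible_comparable:
  fixes A :: real
  assumes "0 \<le> A"
  obtains D :: real where "1 \<le> D"
    "\<And>x y :: real ^ 'n. norm (x - y) \<le> A * admissible x \<Longrightarrow>
      wt x \<le> D * wt y \<and> wt y \<le> D * wt x \<and>
      admissible x \<le> D * admissible y \<and> admissible y \<le> D * admissible x"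
proof -
  define D where "D = max (exp (2 * A + A\<^sup>2)) (1 + A)"
  show ?thesis
  proof (rule that[of D])
    show "1 \<le> D" using assms by (simp add: D_def)
    then have "0 < D" by simp
    fix x y :: "real ^ 'n" assume xy: "norm (x - y) \<le> A * admissible x"
    have ny: "norm y \<le> norm x + norm (x - y)" "norm x \<le> norm y + norm (x - y)"
      using norm_triangle_sub[of y x] norm_triangle_sub[of x y] by (simp_all add: norm_minus_commute)
    have "\<bar>(norm x)\<^sup>2 - (norm y)\<^sup>2\<bar> = \<bar>norm x - norm y\<bar> * (norm x + norm y)"
      by (simp add: power2_eq_square square_diff_square_factored abs_mult mult.commute)
    also have "\<dots> \<le> norm (x - y) * (2 * norm x + norm (x - y))"
      using ny by (intro mult_mono) (auto simp: norm_triangle_ineq3)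
    also have "\<dots> \<le> (A * admissible x) * (2 * norm x + A * admissible x)"
      using xy assms by (intro mult_mono add_mono) auto
    also have "\<dots> = 2 * A * (admissible x * norm x) + A\<^sup>2 * (admissible x * admissible x)"
      by (simp add: power2_eq_square algebra_simps)
    also have "\<dots> \<le> 2 * A * 1 + A\<^sup>2 * (1 * 1)"
      using assms admissible_le_1[of x] less_imp_le[OF admissible_pos[of x]]
      by (intro add_mono mult_left_mono mult_mono admissible_mult_norm_le_1) auto
    finally have sq: "\<bar>(norm x)\<^sup>2 - (norm y)\<^sup>2\<bar> \<le> 2 * A + A\<^sup>2" by simp
    have e: "exp (u::real) \<le> D * exp v" if "u \<le> 2 * A + A\<^sup>2 + v" for u v
    proof -
      have "exp u \<le> exp (2 * A + A\<^sup>2) * exp v" using that by (simp add: exp_add[symmetric])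
      also have "\<dots> \<le> D * exp v" by (simp add: D_def)
      finally show ?thesis .
    qed
    have 1: "wt x \<le> D * wt y" "wt y \<le> D * wt x"
      using sq unfolding wt_def by (auto intro!: e)
    \<comment> \<open>By \<open>admissible_ge\<close> it is enough that the product of the left side
      with |y| is at most 1, which the triangle inequality gives with the bound 1 + A.\<close>
    have "admissible x / D \<le> admissible y"
    proof (rule admissible_ge)
      show "0 < admissible x / D" "admissible x / D \<le> 1"
        using \<open>1 \<le> D\<close> admissible_le_1[of x] by (auto simp: field_simps)
      have "admissible x * norm y \<le> admissible x * norm x + admissible x * norm (x - y)"
        using ny by (simp add: distrib_left[symmetric])
      also have "\<dots> \<le> 1 + 1 * A"
        using xy admissible_le_1[of x] admissible_mult_norm_le_1[of x] assms
        by (intro add_mono mult_mono) (auto intro: order_trans[OF _ mult_left_le])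
      also have "\<dots> \<le> D" by (simp add: D_def)
      finally show "admissible x / D * norm y \<le> 1" using \<open>0 < D\<close> by (simp add: field_simps)
    qed
    moreover have "admissible y / D \<le> admissible x"
    proof (rule admissible_ge)
      show "0 < admissible y / D" "admissible y / D \<le> 1"
        using \<open>1 \<le> D\<close> admissible_le_1[of y] by (auto simp: field_simps)
      have "admissible y * norm x \<le> admissible y * norm y + admissible y * norm (x - y)"
        using ny by (simp add: distrib_left[symmetric])
      also have "\<dots> \<le> 1 + 1 * A"
        using xy admissible_le_1[of x] admissible_le_1[of y] admissible_mult_norm_le_1[of y] assms
        by (intro add_mono mult_mono) (auto intro: order_trans[OF _ mult_left_le])
      also have "\<dots> \<le> D" by (simp add: D_def)
      finally show "admissible y / D * norm x \<le> 1" using \<open>0 < D\<close> by (simp add: field_simps)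
    qed
    ultimately show "wt x \<le> D * wt y \<and> wt y \<le> D * wt x \<and>
      admissible x \<le> D * admissible y \<and> admissible y \<le> D * admissible x"
      using 1 \<open>0 < D\<close> by (simp add: field_simps)
  qed
qed

lemma space_gauss [simp]: "space gauss = UNIV"
  by (simp add: gauss_def)

lemma sets_gauss [simp, measurable_cong]: "sets gauss = sets borel"
  by (simp add: gauss_def)

lemma borel_measurable_gauss [simp]: "borel_measurable gauss = borel_measurable borel"
  by (rule measurable_cong_sets) auto

definition gauss_const :: "'n itself \<Rightarrow> real" where
  "gauss_const _ = pi powr (- (real CARD('n) / 2))"

lemma gauss_const_pos [simp]: "0 < gauss_const TYPE('n)"
  by (simp add: gauss_const_def)

lemma gauss_const_nonneg [simp]: "0 \<le> gauss_const TYPE('n)"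
  by (rule less_imp_le) simp

lemma gauss_const_neq_0 [simp]: "gauss_const TYPE('n) \<noteq> 0"
  by (rule less_imp_neq[OF gauss_const_pos, symmetric])

lemma gauss_eq: "(gauss :: (real ^ 'n) measure) = density lborel (\<lambda>x. ennreal (gauss_const TYPE('n::finite) * wt x))"
  by (simp add: gauss_def gauss_const_def wt_def)

lemma nn_integral_gauss:
  fixes f :: "real ^ 'n \<Rightarrow> ennreal"
  assumes [measurable]: "f \<in> borel_measurable borel"
  shows "(\<integral>\<^sup>+x. f x \<partial>gauss) = (\<integral>\<^sup>+x. ennreal (gauss_const TYPE('n) * wt x) * f x \<partial>lborel)"
  unfolding gauss_eq by (rule nn_integral_density) auto

lemma AE_gauss_iff: "(AE x in gauss. P x) \<longleftrightarrow> (AE x in lborel. P x)"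
  unfolding gauss_eq by (subst AE_density) auto

lemma sigma_finite_gauss: "sigma_finite_measure (gauss :: (real ^ 'n) measure)"
proof -
  have "sigma_finite_measure (density lborel (\<lambda>x :: real ^ 'n. ennreal (gauss_const TYPE('n) * wt x)))"
    by (subst sigma_finite_measure.sigma_finite_iff_density_finite[OF lborel.sigma_finite_measure_axioms]) auto
  then show ?thesis by (simp only: gauss_eq)
qed

lemma nn_integral_gauss_le_local:
  fixes f :: "real ^ 'n \<Rightarrow> ennreal"
  assumes [measurable]: "f \<in> borel_measurable borel" "S \<in> sets borel"
    and D: "\<And>y. y \<in> S \<Longrightarrow> wt y \<le> D * w"
  shows "(\<integral>\<^sup>+x\<in>S. f x \<partial>gauss) \<le> ennreal (gauss_const TYPE('n) * (D * w)) * (\<integral>\<^sup>+x\<in>S. f x \<partial>lborel)"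
proof -
  have "(\<integral>\<^sup>+x\<in>S. f x \<partial>gauss) = (\<integral>\<^sup>+x. ennreal (gauss_const TYPE('n) * wt x) * (f x * indicator S x) \<partial>lborel)"
    by (rule nn_integral_gauss) measurable
  also have "\<dots> \<le> (\<integral>\<^sup>+x. ennreal (gauss_const TYPE('n) * (D * w)) * (f x * indicator S x) \<partial>lborel)"
  proof (intro nn_integral_mono)
    fix x
    show "ennreal (gauss_const TYPE('n) * wt x) * (f x * indicator S x) \<le> ennreal (gauss_const TYPE('n) * (D * w)) * (f x * indicator S x)"
      using D[of x]
      by (cases "x \<in> S") (auto intro!: mult_right_mono ennreal_leI mult_left_mono)
  qed
  also have "\<dots> = ennreal (gauss_const TYPE('n) * (D * w)) * (\<integral>\<^sup>+x\<in>S. f x \<partial>lborel)"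
    by (intro nn_integral_cmult) measurable
  finally show ?thesis .
qed

lemma nn_integral_lborel_le_gauss_local:
  fixes f :: "real ^ 'n \<Rightarrow> ennreal"
  assumes [measurable]: "f \<in> borel_measurable borel" "S \<in> sets borel"
    and D: "\<And>y. y \<in> S \<Longrightarrow> w \<le> D * wt y" and "0 < w" "0 < D"
  shows "(\<integral>\<^sup>+x\<in>S. f x \<partial>lborel) \<le> ennreal (D / (gauss_const TYPE('n) * w)) * (\<integral>\<^sup>+x\<in>S. f x \<partial>gauss)"
proof -
  let ?c = "gauss_const TYPE('n)"
  have "(\<integral>\<^sup>+x\<in>S. f x \<partial>lborel) \<le> (\<integral>\<^sup>+x. ennreal (D / (?c * w)) * (ennreal (?c * wt x) * (f x * indicator S x)) \<partial>lborel)"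
  proof (intro nn_integral_mono)
    fix x
    show "f x * indicator S x \<le> ennreal (D / (?c * w)) * (ennreal (?c * wt x) * (f x * indicator S x))"
    proof (cases "x \<in> S")
      case True
      have "1 \<le> D / (?c * w) * (?c * wt x)"
        using D[OF True] \<open>0 < w\<close> by (simp add: field_simps)
      then have "ennreal 1 \<le> ennreal (D / (?c * w)) * ennreal (?c * wt x)"
        using \<open>0 < w\<close> \<open>0 < D\<close> by (subst ennreal_mult[symmetric]) (auto intro!: ennreal_leI divide_nonneg_nonneg mult_nonneg_nonneg less_imp_le)
      then have "1 * f x \<le> (ennreal (D / (?c * w)) * ennreal (?c * wt x)) * f x"
        by (intro mult_right_mono) auto
      then show ?thesis using True by (simp add: mult.assoc)
    qed simp
  qed
  also have "\<dots> = ennreal (D / (?c * w)) * (\<integral>\<^sup>+x. ennreal (?c * wt x) * (f x * indicator S x) \<partial>lborel)"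
    by (intro nn_integral_cmult) measurable
  also have "(\<integral>\<^sup>+x. ennreal (?c * wt x) * (f x * indicator S x) \<partial>lborel) = (\<integral>\<^sup>+x\<in>S. f x \<partial>gauss)"
    by (rule nn_integral_gauss[symmetric]) measurable
  finally show ?thesis .
qed

lemma emeasure_gauss_le_local:
  fixes S :: "(real ^ 'n) set"
  assumes [measurable]: "S \<in> sets borel" and D: "\<And>y. y \<in> S \<Longrightarrow> wt y \<le> D * w"
  shows "emeasure gauss S \<le> ennreal (gauss_const TYPE('n) * (D * w)) * emeasure lborel S"
  using nn_integral_gauss_le_local[of "\<lambda>_. 1" S D w] D by simp

lemma emeasure_gauss_ge_local:
  fixes S :: "(real ^ 'n) set"
  assumes [measurable]: "S \<in> sets borel" and D: "\<And>y. y \<in> S \<Longrightarrow> w \<le> D * wt y" and "0 < w" "0 < D"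
  shows "emeasure lborel S \<le> ennreal (D / (gauss_const TYPE('n) * w)) * emeasure gauss S"
  using nn_integral_lborel_le_gauss_local[of "\<lambda>_. 1" S w D] assms by simp

lemma emeasure_gauss_finite:
  fixes S :: "(real ^ 'n) set"
  assumes [measurable]: "S \<in> sets borel" and "bounded S"
  shows "emeasure gauss S < \<infinity>"
proof -
  have "emeasure gauss S \<le> ennreal (gauss_const TYPE('n) * (1 * 1)) * emeasure lborel S"
    using wt_le_1 by (intro emeasure_gauss_le_local) auto
  also have "\<dots> < \<infinity>"
    using emeasure_bounded_finite[OF \<open>bounded S\<close>] by (simp add: ennreal_mult_less_top)
  finally show ?thesis .
qed

lemma emeasure_gauss_pos:
  fixes S :: "(real ^ 'n) set"
  assumes [measurable]: "S \<in> sets borel" and "emeasure lborel S \<noteq> 0"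
  shows "emeasure gauss S \<noteq> 0"
proof
  assume "emeasure gauss S = 0"
  then have "AE x in gauss. x \<notin> S" by (subst AE_iff_measurable[of S]) auto
  then have "AE x in lborel. x \<notin> S" by (simp only: AE_gauss_iff)
  then have "emeasure lborel S = 0" by (subst (asm) AE_iff_measurable[of S]) auto
  then show False using assms by simp
qed

definition vball :: "'n itself \<Rightarrow> real" where
  "vball _ = unit_ball_vol (real CARD('n))"

lemma vball_pos [simp]: "0 < vball TYPE('n)"
  by (simp add: vball_def)

lemma vball_nonneg [simp]: "0 \<le> vball TYPE('n)"
  by (rule less_imp_le) simp

lemma vball_neq_0 [simp]: "vball TYPE('n) \<noteq> 0"
  by (rule less_imp_neq[OF vball_pos, symmetric])

lemma emeasure_lborel_ball:
  "0 \<le> R \<Longrightarrow> emeasure lborel (ball (y :: real ^ 'n) R) = ennreal (vball TYPE('n) * R ^ CARD('n))"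
  by (simp add: emeasure_ball vball_def)

section \<open>Moments of BMO functions\<close>

lemma norm_corner_diff_le:
  fixes x c :: "real ^ 'n"
  assumes "x \<in> cube c l"
  shows "norm (x - c) \<le> real CARD('n) * l"
proof (rule norm_le_card_mult)
  fix i show "\<bar>(x - c) $ i\<bar> \<le> l"
    using assms[unfolded cube_def, simplified, rule_format, of i] by simp
qed

text \<open>The cube lies in a ball about its corner. Its points are within n l of the corner, and
  the factor 2 leaves room for the open ball. One D comes from each change of measure.\<close>

lemma osc_le_of_bmo:
  obtains K :: real where "0 < K"
    "\<And>(b :: real ^ 'n \<Rightarrow> real) c l. b \<in> borel_measurable borel \<Longrightarrow> bmo_seminorm b \<le> 1 \<Longrightarrow>
      0 < l \<Longrightarrow> 2 * real CARD('n) * l \<le> admissible c \<Longrightarrow> osc_le b K c l"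
proof -
  let ?n = "CARD('n)" and ?g = "gauss_const TYPE('n)" and ?v = "vball TYPE('n)"
  obtain D :: real where "1 \<le> D" and D: "\<And>x y :: real ^ 'n. norm (x - y) \<le> 1 * admissible x \<Longrightarrow>
      wt x \<le> D * wt y \<and> wt y \<le> D * wt x \<and>
      admissible x \<le> D * admissible y \<and> admissible y \<le> D * admissible x"
    using wt_admissible_comparable[of 1] by auto
  define K where "K = D\<^sup>2 * ?v * (2 * real ?n) ^ ?n"
  show ?thesis
  proof (rule that[of K])
    show "0 < K" using \<open>1 \<le> D\<close> by (simp add: K_def)
    fix b :: "real ^ 'n \<Rightarrow> real" and c :: "real ^ 'n" and l :: real
    assume [measurable]: "b \<in> borel_measurable borel" and semi: "bmo_seminorm b \<le> 1"
      and l: "0 < l" "2 * real ?n * l \<le> admissible c"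
    define B where "B = ball c (2 * real ?n * l)"
    have [measurable]: "B \<in> sets borel" by (simp add: B_def)
    define d where "d = ball_avg b B"
    have B: "B \<in> adm_balls 1"
      using l unfolding adm_balls_def B_def by (auto intro!: exI[of _ c] exI[of _ "2 * real ?n * l"])
    have fin: "emeasure gauss B < \<infinity>" by (intro emeasure_gauss_finite) (auto simp: B_def)
    have "(\<integral>\<^sup>+x\<in>B. ennreal \<bar>b x - d\<bar> \<partial>gauss) / emeasure gauss B \<le> bmo_seminorm b"
      unfolding bmo_seminorm_def d_def using B by (rule SUP_upper)
    then have "(\<integral>\<^sup>+x\<in>B. ennreal \<bar>b x - d\<bar> \<partial>gauss) / emeasure gauss B \<le> 1" using semi by simp
    then have "((\<integral>\<^sup>+x\<in>B. ennreal \<bar>b x - d\<bar> \<partial>gauss) / emeasure gauss B) * emeasure gauss B \<le> 1 * emeasure gauss B"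
      by (rule mult_right_mono) simp
    moreover have "emeasure lborel B \<noteq> 0" using l by (simp add: B_def emeasure_lborel_ball)
    then have "emeasure gauss B \<noteq> 0" by (intro emeasure_gauss_pos) auto
    ultimately have 1: "(\<integral>\<^sup>+x\<in>B. ennreal \<bar>b x - d\<bar> \<partial>gauss) \<le> emeasure gauss B"
      using fin by (simp add: ennreal_divide_times ennreal_times_divide divide_mult_eq mult_divide_eq_ennreal less_top)
    have near: "wt c \<le> D * wt y \<and> wt y \<le> D * wt c" if "y \<in> B" for y
      using D[of c y] that l by (auto simp: B_def dist_norm)
    have "cube c l \<subseteq> B"
    proof
      fix x assume "x \<in> cube c l"
      then have "norm (x - c) \<le> real ?n * l" by (rule norm_corner_diff_le)
      also have "\<dots> < 2 * real ?n * l" using l by simp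
      finally show "x \<in> B" by (simp add: B_def dist_norm norm_minus_commute)
    qed
    then have "(\<integral>\<^sup>+x\<in>cube c l. ennreal \<bar>b x - d\<bar> \<partial>lborel) \<le> (\<integral>\<^sup>+x\<in>B. ennreal \<bar>b x - d\<bar> \<partial>lborel)"
      by (intro nn_integral_mono) (auto simp: indicator_def)
    also have "\<dots> \<le> ennreal (D / (?g * wt c)) * (\<integral>\<^sup>+x\<in>B. ennreal \<bar>b x - d\<bar> \<partial>gauss)"
      using near \<open>1 \<le> D\<close> by (intro nn_integral_lborel_le_gauss_local) auto
    also have "\<dots> \<le> ennreal (D / (?g * wt c)) * (ennreal (?g * (D * wt c)) * emeasure lborel B)"
      using near by (intro mult_left_mono order_trans[OF 1] emeasure_gauss_le_local) auto
    also have "emeasure lborel B = ennreal (?v * (2 * real ?n * l) ^ ?n)"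
      using l unfolding B_def by (intro emeasure_lborel_ball) simp
    also have "ennreal (D / (?g * wt c)) * (ennreal (?g * (D * wt c)) * ennreal (?v * (2 * real ?n * l) ^ ?n))
      = ennreal (D / (?g * wt c) * (?g * (D * wt c) * (?v * (2 * real ?n * l) ^ ?n)))"
      using l \<open>1 \<le> D\<close> by (simp add: ennreal_mult[symmetric])
    also have "D / (?g * wt c) * (?g * (D * wt c) * (?v * (2 * real ?n * l) ^ ?n)) = K * l ^ ?n"
      using wt_pos[of c] by (simp add: K_def power_mult_distrib power2_eq_square field_simps del: wt_pos)
    finally show "osc_le b K c l" unfolding osc_le_def by blast
  qed
qed

text \<open>The size of the admissible class is immaterial up to constants: \<epsilon> may be tiny
  and A large. This carries BMO bounds to the balls of radius \<open>a * admissible x\<close>, and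
  in (ii) bounds on tiny cubes to all of \<open>adm_balls 1\<close>.\<close>

lemma osc_le_enlarge:
  fixes \<epsilon> A :: real
  assumes "0 < \<epsilon>" "0 \<le> A"
  obtains L :: real where "0 < L"
    "\<And>(b :: real ^ 'n \<Rightarrow> real) \<kappa> c l. b \<in> borel_measurable borel \<Longrightarrow> 0 \<le> \<kappa> \<Longrightarrow>
      (\<And>c l. 0 < l \<Longrightarrow> l \<le> \<epsilon> * admissible c \<Longrightarrow> osc_le b \<kappa> c l) \<Longrightarrow>
      0 < l \<Longrightarrow> l \<le> A * admissible c \<Longrightarrow> osc_le b (L * \<kappa>) c l"
proof -
  let ?n = "CARD('n)"
  obtain D :: real where "1 \<le> D" and D: "\<And>x y :: real ^ 'n. norm (x - y) \<le> real ?n * A * admissible x \<Longrightarrow>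
      wt x \<le> D * wt y \<and> wt y \<le> D * wt x \<and>
      admissible x \<le> D * admissible y \<and> admissible y \<le> D * admissible x"
    using wt_admissible_comparable[of "real ?n * A"] assms by auto
  \<comment> \<open>The number of halvings from A to \<epsilon> / D; the factor D allows for the
    variation of \<open>admissible\<close> over the cube.\<close>
  obtain j where j: "A * D / \<epsilon> < 2 ^ j"
    using real_arch_pow[of 2 "A * D / \<epsilon>"] by auto
  show ?thesis
  proof (rule that[of "(1 + 2 ^ (?n + 1)) ^ j"])
    show "(0::real) < (1 + 2 ^ (?n + 1)) ^ j" by (intro zero_less_power) (simp add: add_pos_pos)
    fix b :: "real ^ 'n \<Rightarrow> real" and c :: "real ^ 'n" and \<kappa> l :: real
    assume b: "b \<in> borel_measurable borel" and "0 \<le> \<kappa>"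
      and small: "\<And>c l. 0 < l \<Longrightarrow> l \<le> \<epsilon> * admissible c \<Longrightarrow> osc_le b \<kappa> c l"
      and l: "0 < l" "l \<le> A * admissible c"
    show "osc_le b ((1 + 2 ^ (?n + 1)) ^ j * \<kappa>) c l"
    proof (rule osc_le_scale_up[where \<delta> = "\<epsilon> / D * admissible c" and Q = "cube c l"])
      show "0 < \<epsilon> / D * admissible c" using assms \<open>1 \<le> D\<close> by simp
      have "A \<le> 2 ^ j * (\<epsilon> / D)" using j assms \<open>1 \<le> D\<close> by (simp add: field_simps)
      then have "A * admissible c \<le> 2 ^ j * (\<epsilon> / D) * admissible c" by (intro mult_right_mono) auto
      then show "l \<le> 2 ^ j * (\<epsilon> / D * admissible c)" using l by (simp add: mult.assoc)
      fix c' l' assume l': "0 < l'" "l' \<le> \<epsilon> / D * admissible c" "cube c' l' \<subseteq> cube c l"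
      have "norm (c' - c) \<le> real ?n * l"
        using l' corner_in_cube[of l' c'] by (intro norm_corner_diff_le) auto
      also have "\<dots> \<le> real ?n * A * admissible c"
        using l by (simp add: mult.assoc mult_left_mono)
      finally have "admissible c \<le> D * admissible c'"
        using D[of c c'] by (simp add: norm_minus_commute)
      then have "\<epsilon> / D * admissible c \<le> \<epsilon> / D * (D * admissible c')"
        using assms \<open>1 \<le> D\<close> by (intro mult_left_mono) auto
      then have "l' \<le> \<epsilon> * admissible c'" using l' \<open>1 \<le> D\<close> by simp
      then show "osc_le b \<kappa> c' l'" by (intro small l')
    qed (use b \<open>0 \<le> \<kappa>\<close> l in auto)
  qed
qed

text \<open>John--Nirenberg on the enclosing cube of side 2 R, transferred to the Gauss measure. One
  constant d serves the whole ball, so two arguments of b can be compared through it.\<close>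

lemma bmo_moment_ball:
  fixes t A :: real
  assumes "0 < t" "0 \<le> A"
  obtains C :: real where "0 < C"
    "\<And>(b :: real ^ 'n \<Rightarrow> real) y R. b \<in> borel_measurable borel \<Longrightarrow> bmo_seminorm b \<le> 1 \<Longrightarrow>
      0 < R \<Longrightarrow> R \<le> A * admissible y \<Longrightarrow>
      \<exists>d. (\<integral>\<^sup>+x\<in>ball y R. ennreal (\<bar>b x - d\<bar> powr t) \<partial>gauss) \<le> ennreal (C * (wt y * R ^ CARD('n)))"
proof -
  let ?n = "CARD('n)" and ?g = "gauss_const TYPE('n)"
  obtain D :: real where "1 \<le> D" and D: "\<And>x y :: real ^ 'n. norm (x - y) \<le> real ?n * A * admissible x \<Longrightarrow>
      wt x \<le> D * wt y \<and> wt y \<le> D * wt x \<and>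
      admissible x \<le> D * admissible y \<and> admissible y \<le> D * admissible x"
    using wt_admissible_comparable[of "real ?n * A"] assms by auto
  obtain K :: real where "0 < K" and K: "\<And>(b :: real ^ 'n \<Rightarrow> real) c l. b \<in> borel_measurable borel \<Longrightarrow> bmo_seminorm b \<le> 1 \<Longrightarrow>
      0 < l \<Longrightarrow> 2 * real CARD('n) * l \<le> admissible c \<Longrightarrow> osc_le b K c l"
    using osc_le_of_bmo[where 'n='n] by blast
  \<comment> \<open>Subcubes of the enclosing cube have side at most 2 R \<le> 2 A
    \<open>admissible y\<close>, and moving from y to their corner costs another D.\<close>
  obtain L :: real where "0 < L" and L:
    "\<And>(b :: real ^ 'n \<Rightarrow> real) \<kappa> c l. b \<in> borel_measurable borel \<Longrightarrow> 0 \<le> \<kappa> \<Longrightarrow>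
      (\<And>c l. 0 < l \<Longrightarrow> l \<le> 1 / (2 * real ?n) * admissible c \<Longrightarrow> osc_le b \<kappa> c l) \<Longrightarrow>
      0 < l \<Longrightarrow> l \<le> 2 * A * D * admissible c \<Longrightarrow> osc_le b (L * \<kappa>) c l"
    using osc_le_enlarge[where 'n='n, of "1 / (2 * real ?n)" "2 * A * D"] assms \<open>1 \<le> D\<close> by auto
  define \<kappa> where "\<kappa> = L * K"
  have "0 < \<kappa>" using \<open>0 < L\<close> \<open>0 < K\<close> by (simp add: \<kappa>_def)
  obtain C0 :: real where "0 < C0" and C0:
    "\<And>(b :: real ^ 'n \<Rightarrow> real) \<kappa> c0 l0. b \<in> borel_measurable borel \<Longrightarrow> 0 < \<kappa> \<Longrightarrow> 0 < l0 \<Longrightarrow>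
      (\<And>c l. 0 < l \<Longrightarrow> cube c l \<subseteq> cube c0 l0 \<Longrightarrow> osc_le b \<kappa> c l) \<Longrightarrow>
      \<exists>d. (\<integral>\<^sup>+x\<in>cube c0 l0. ennreal ((\<bar>b x - d\<bar> / \<kappa>) powr t) \<partial>lborel) \<le> ennreal (C0 * l0 ^ CARD('n))"
    using bmo_moment_cube[OF \<open>0 < t\<close>, where 'n='n] by blast
  define C where "C = ?g * D * \<kappa> powr t * C0 * 2 ^ ?n"
  show ?thesis
  proof (rule that[of C])
    show "0 < C" using \<open>1 \<le> D\<close> \<open>0 < \<kappa>\<close> \<open>0 < C0\<close> by (simp add: C_def)
    fix b :: "real ^ 'n \<Rightarrow> real" and y :: "real ^ 'n" and R :: real
    assume b [measurable]: "b \<in> borel_measurable borel" and semi: "bmo_seminorm b \<le> 1"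
      and R: "0 < R" "R \<le> A * admissible y"
    define c where "c = (\<chi> i. y $ i - R)"
    have osc: "osc_le b \<kappa> c' l'" if "0 < l'" "cube c' l' \<subseteq> cube c (2 * R)" for c' l'
    proof -
      have "\<bar>(c' - y) $ i\<bar> \<le> R" for i
      proof -
        have "c' \<in> cube c (2 * R)" using that corner_in_cube[of l' c'] by auto
        then show ?thesis unfolding cube_def c_def by (simp add: abs_le_iff) (smt (verit))
      qed
      then have "norm (c' - y) \<le> real ?n * R" by (rule norm_le_card_mult)
      also have "\<dots> \<le> real ?n * A * admissible y" using R by (simp add: mult.assoc mult_left_mono)
      finally have "admissible y \<le> D * admissible c'" using D[of y c'] by (simp add: norm_minus_commute)
      then have "2 * A * admissible y \<le> 2 * A * (D * admissible c')"
        using assms by (intro mult_left_mono) auto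
      moreover have "l' \<le> 2 * R" using iffD1[OF cube_subset_cube_iff[OF that(1)] that(2), rule_format, of undefined] by linarith
      ultimately have "l' \<le> 2 * A * D * admissible c'" using R by simp
      then show ?thesis unfolding \<kappa>_def
        using that \<open>0 < K\<close> semi b by (intro L K) (auto simp: field_simps)
    qed
    obtain d where d: "(\<integral>\<^sup>+x\<in>cube c (2 * R). ennreal ((\<bar>b x - d\<bar> / \<kappa>) powr t) \<partial>lborel) \<le> ennreal (C0 * (2 * R) ^ ?n)"
      using C0[of b \<kappa> "2 * R" c] osc \<open>0 < \<kappa>\<close> R by auto
    have sub: "ball y R \<subseteq> cube c (2 * R)"
    proof
      fix x assume "x \<in> ball y R"
      then have "norm (x - y) < R" by (simp add: dist_norm norm_minus_commute)
      then have "\<bar>x $ i - y $ i\<bar> < R" for i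
        using component_le_norm_cart[of "x - y" i] by simp
      then show "x \<in> cube c (2 * R)" by (auto simp: cube_def c_def abs_less_iff) (smt (verit))+
    qed
    have near: "wt x \<le> D * wt y" if "x \<in> ball y R" for x
    proof -
      have "1 \<le> real ?n" by (simp add: Suc_leI)
      then have "1 * A * admissible y \<le> real ?n * A * admissible y"
        using assms by (intro mult_right_mono) auto
      then have "norm (y - x) \<le> real ?n * A * admissible y"
        using that R by (simp add: dist_norm)
      then show ?thesis using D by blast
    qed
    have "(\<integral>\<^sup>+x\<in>ball y R. ennreal (\<bar>b x - d\<bar> powr t) \<partial>gauss)
      \<le> ennreal (?g * (D * wt y)) * (\<integral>\<^sup>+x\<in>ball y R. ennreal (\<bar>b x - d\<bar> powr t) \<partial>lborel)"
      using near by (intro nn_integral_gauss_le_local) auto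
    also have "\<dots> \<le> ennreal (?g * (D * wt y)) * (\<integral>\<^sup>+x. ennreal (\<kappa> powr t) * (ennreal ((\<bar>b x - d\<bar> / \<kappa>) powr t) * indicator (cube c (2 * R)) x) \<partial>lborel)"
    proof (intro mult_left_mono nn_integral_mono)
      fix x
      have "ennreal (\<bar>b x - d\<bar> powr t) = ennreal (\<kappa> powr t) * ennreal ((\<bar>b x - d\<bar> / \<kappa>) powr t)"
        using \<open>0 < \<kappa>\<close> by (simp add: ennreal_mult[symmetric] powr_mult[symmetric])
      then show "ennreal (\<bar>b x - d\<bar> powr t) * indicator (ball y R) x
        \<le> ennreal (\<kappa> powr t) * (ennreal ((\<bar>b x - d\<bar> / \<kappa>) powr t) * indicator (cube c (2 * R)) x)"
        using sub by (auto simp: indicator_def)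
    qed simp
    also have "(\<integral>\<^sup>+x. ennreal (\<kappa> powr t) * (ennreal ((\<bar>b x - d\<bar> / \<kappa>) powr t) * indicator (cube c (2 * R)) x) \<partial>lborel)
       = ennreal (\<kappa> powr t) * (\<integral>\<^sup>+x\<in>cube c (2 * R). ennreal ((\<bar>b x - d\<bar> / \<kappa>) powr t) \<partial>lborel)"
      by (intro nn_integral_cmult) measurable
    also have "ennreal (?g * (D * wt y)) * (ennreal (\<kappa> powr t) * (\<integral>\<^sup>+x\<in>cube c (2 * R). ennreal ((\<bar>b x - d\<bar> / \<kappa>) powr t) \<partial>lborel))
      \<le> ennreal (?g * (D * wt y)) * (ennreal (\<kappa> powr t) * ennreal (C0 * (2 * R) ^ ?n))"
      by (intro mult_left_mono d) auto
    also have "\<dots> = ennreal (C * (wt y * R ^ ?n))"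
      using \<open>1 \<le> D\<close> \<open>0 < C0\<close> R
      by (simp add: C_def ennreal_mult[symmetric] power_mult_distrib mult_ac)
    finally show "\<exists>d. (\<integral>\<^sup>+x\<in>ball y R. ennreal (\<bar>b x - d\<bar> powr t) \<partial>gauss) \<le> ennreal (C * (wt y * R ^ ?n))"
      by blast
  qed
qed

section \<open>Scales of the positive commutator\<close>

text \<open>Here \<open>wt x * norm (x - y) ^ CARD('n)\<close> stands for the comparable quantity \<open>V x y\<close>. It is less than
  \<open>a ^ CARD('n)\<close> where \<open>norm (x - y) < a * admissible x\<close>, so no negative scales occur.\<close>

definition scale_nbhd :: "real \<Rightarrow> nat \<Rightarrow> real ^ 'n \<Rightarrow> (real ^ 'n) set" where
  "scale_nbhd a k x = {y. norm (x - y) < a * admissible x \<and> wt x * norm (x - y) ^ CARD('n) < a ^ CARD('n) / 2 ^ k}"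

text \<open>The factor is the size of V powr - (1 - \<beta>) where V is about 2 powr - k. The
  integral runs over a full neighbourhood instead of a shell, which can only increase it.\<close>

definition scale_op :: "real \<Rightarrow> real \<Rightarrow> (real ^ 'n \<Rightarrow> real) \<Rightarrow> nat \<Rightarrow> (real ^ 'n \<Rightarrow> real) \<Rightarrow> real ^ 'n \<Rightarrow> ennreal" where
  "scale_op a \<beta> b k F x = ennreal (2 powr (real k * (1 - \<beta>))) *
     (\<integral>\<^sup>+y. ennreal \<bar>b x - b y\<bar> * (ennreal (F y) * indicator (scale_nbhd a k x) y) \<partial>gauss)"

lemma measurable_indicator_scale_nbhd [measurable]:
  "(\<lambda>p. indicator (scale_nbhd a k (fst p)) (snd p) :: ennreal) \<in> borel_measurable (borel \<Otimes>\<^sub>M borel)"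
  unfolding scale_nbhd_def indicator_def of_bool_def mem_Collect_eq by measurable

lemma measurable_indicator_scale_nbhd' [measurable (raw)]:
  assumes [measurable]: "f \<in> M \<rightarrow>\<^sub>M borel" "g \<in> M \<rightarrow>\<^sub>M borel"
  shows "(\<lambda>p. indicator (scale_nbhd a k (f p)) (g p) :: ennreal) \<in> borel_measurable M"
  using measurable_compose[OF measurable_Pair[OF assms] measurable_indicator_scale_nbhd] by simp

lemma measurable_scale_op:
  fixes b F :: "real ^ 'n \<Rightarrow> real"
  assumes [measurable]: "b \<in> borel_measurable borel" "F \<in> borel_measurable borel"
  shows "scale_op a \<beta> b k F \<in> borel_measurable borel"
proof -
  interpret sigma_finite_measure "gauss :: (real ^ 'n) measure" by (rule sigma_finite_gauss)
  show ?thesis unfolding scale_op_def[abs_def] by measurable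
qed

lemma scale_op_add:
  fixes b F G :: "real ^ 'n \<Rightarrow> real"
  assumes [measurable]: "b \<in> borel_measurable borel" "F \<in> borel_measurable borel" "G \<in> borel_measurable borel"
    and "\<And>x. 0 \<le> F x" "\<And>x. 0 \<le> G x"
  shows "scale_op a \<beta> b k (\<lambda>x. F x + G x) x = scale_op a \<beta> b k F x + scale_op a \<beta> b k G x"
  unfolding scale_op_def using assms(4,5)
  by (simp add: distrib_right distrib_left nn_integral_add)

lemma scale_nbhd_moment:
  fixes a s r :: real
  assumes "0 < a" "1 < s" "s < r"
  defines "s' \<equiv> s / (s - 1)"
  obtains C :: real where "0 < C"
    "\<And>(b :: real ^ 'n \<Rightarrow> real) y k. b \<in> borel_measurable borel \<Longrightarrow> bmo_seminorm b \<le> 1 \<Longrightarrow>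
      (\<integral>\<^sup>+x. ennreal_powr (\<integral>\<^sup>+z. ennreal_powr (ennreal \<bar>b x - b z\<bar>) s' * indicator (scale_nbhd a k x) z \<partial>gauss) (r / s')
         * indicator (scale_nbhd a k x) y \<partial>gauss) \<le> ennreal (C * 2 powr (- real k * (1 + r / s')))"
proof -
  let ?n = "CARD('n)" and ?g = "gauss_const TYPE('n)" and ?v = "vball TYPE('n)"
  have s': "1 < s'" using assms by (simp add: s'_def field_simps)
  \<comment> \<open>The two orders of moments that occur; the power t plus 1 dominates both.\<close>
  define t where "t = max r s'"
  have t: "0 < t" "r \<le> t" "s' \<le> t" using assms s' by (auto simp: t_def)
  obtain D0 :: real where "1 \<le> D0" and D0: "\<And>x y :: real ^ 'n. norm (x - y) \<le> a * admissible x \<Longrightarrow>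
      wt x \<le> D0 * wt y \<and> wt y \<le> D0 * wt x \<and>
      admissible x \<le> D0 * admissible y \<and> admissible y \<le> D0 * admissible x"
    using wt_admissible_comparable[of a] assms by auto
  define A where "A = 2 * a * D0"
  have "0 < A" using assms \<open>1 \<le> D0\<close> by (simp add: A_def)
  obtain D1 :: real where "1 \<le> D1" and D1: "\<And>x y :: real ^ 'n. norm (x - y) \<le> A * admissible x \<Longrightarrow>
      wt x \<le> D1 * wt y \<and> wt y \<le> D1 * wt x \<and>
      admissible x \<le> D1 * admissible y \<and> admissible y \<le> D1 * admissible x"
    using wt_admissible_comparable[of A] \<open>0 < A\<close> by auto
  obtain C1 :: real where "0 < C1" and C1:
    "\<And>(b :: real ^ 'n \<Rightarrow> real) y R. b \<in> borel_measurable borel \<Longrightarrow> bmo_seminorm b \<le> 1 \<Longrightarrow>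
      0 < R \<Longrightarrow> R \<le> A * admissible y \<Longrightarrow>
      \<exists>d. (\<integral>\<^sup>+x\<in>ball y R. ennreal (\<bar>b x - d\<bar> powr t) \<partial>gauss) \<le> ennreal (C1 * (wt y * R ^ ?n))"
    using bmo_moment_ball[OF \<open>0 < t\<close>, of A, where 'n='n] \<open>0 < A\<close> by auto
  define C2 where "C2 = ?g * D1 * ?v"
  define E where "E = 2 ^ ?n * D0 * a ^ ?n"
  define C3 where "C3 = 2 powr s' * (C1 + C2) * E"
  have pos: "0 < C2" "0 < E" "0 < C3"
    using \<open>1 \<le> D1\<close> \<open>1 \<le> D0\<close> \<open>0 < a\<close> \<open>0 < C1\<close> by (auto simp: C2_def E_def C3_def intro!: mult_pos_pos add_pos_pos)
  define C where "C = (C3 * 2) powr (r / s') * (2 * C2 + C1) * E"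
  show ?thesis
  proof (rule that[of C])
    show "0 < C" using pos \<open>0 < C1\<close> by (simp add: C_def)
    fix b :: "real ^ 'n \<Rightarrow> real" and y :: "real ^ 'n" and k :: nat
    assume b [measurable]: "b \<in> borel_measurable borel" and semi: "bmo_seminorm b \<le> 1"
    \<comment> \<open>The two conditions in \<open>scale_nbhd\<close>, restated with the weight and
      the admissible radius of y in place of x at the cost of D0. The minimum is both an admissible
      radius and small enough in measure.\<close>
    define \<rho> where "\<rho> = min (a * D0 * admissible y) (root ?n (D0 * (a ^ ?n / 2 ^ k) / wt y))"
    define R where "R = 2 * \<rho>"
    have "0 < \<rho>" using assms \<open>1 \<le> D0\<close> by (simp add: \<rho>_def)
    then have "0 < R" by (simp add: R_def)
    have "R \<le> A * admissible y" by (simp add: R_def A_def \<rho>_def)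
    have "\<rho> ^ ?n \<le> root ?n (D0 * (a ^ ?n / 2 ^ k) / wt y) ^ ?n"
      using \<open>0 < \<rho>\<close> by (intro power_mono) (auto simp: \<rho>_def)
    also have "\<dots> = D0 * (a ^ ?n / 2 ^ k) / wt y"
      using assms \<open>1 \<le> D0\<close> by (intro real_root_pow_pos2) auto
    finally have "wt y * \<rho> ^ ?n \<le> D0 * (a ^ ?n / 2 ^ k)"
      using wt_pos[of y] by (simp add: field_simps del: wt_pos)
    then have "2 ^ ?n * (wt y * \<rho> ^ ?n) \<le> 2 ^ ?n * (D0 * (a ^ ?n / 2 ^ k))" by (rule mult_left_mono) simp
    then have wR: "wt y * R ^ ?n \<le> E * 2 powr - real k"
      by (simp add: R_def E_def power_mult_distrib powr_minus powr_realpow divide_inverse mult_ac)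
    \<comment> \<open>Used also with z = y: then both y and z are within \<rho> of x, hence within R
      = 2 \<rho> of each other.\<close>
    have near: "norm (x - z) < \<rho>" if y: "y \<in> scale_nbhd a k x" and z: "z \<in> scale_nbhd a k x" for x z
    proof -
      have "norm (x - y) \<le> a * admissible x" using y by (simp add: scale_nbhd_def)
      note D = D0[OF this]
      have "norm (x - z) < a * admissible x" using z by (simp add: scale_nbhd_def)
      also have "\<dots> \<le> a * (D0 * admissible y)" using D assms by (intro mult_left_mono) auto
      finally have 1: "norm (x - z) < a * D0 * admissible y" by (simp add: mult.assoc)
      have "wt y * norm (x - z) ^ ?n \<le> D0 * wt x * norm (x - z) ^ ?n" using D by (intro mult_right_mono) auto
      also have "\<dots> < D0 * (a ^ ?n / 2 ^ k)"
        using z \<open>1 \<le> D0\<close> by (simp add: scale_nbhd_def mult.assoc del: times_divide_eq_right)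
      finally have "norm (x - z) ^ ?n < D0 * (a ^ ?n / 2 ^ k) / wt y"
        using wt_pos[of y] by (simp add: pos_less_divide_eq mult_ac del: wt_pos)
      then have "root ?n (norm (x - z) ^ ?n) < root ?n (D0 * (a ^ ?n / 2 ^ k) / wt y)"
        by (intro real_root_less_mono) auto
      then have "norm (x - z) < root ?n (D0 * (a ^ ?n / 2 ^ k) / wt y)"
        by (simp add: real_root_power_cancel)
      with 1 show ?thesis by (simp add: \<rho>_def)
    qed
    obtain d where d: "(\<integral>\<^sup>+x\<in>ball y R. ennreal (\<bar>b x - d\<bar> powr t) \<partial>gauss) \<le> ennreal (C1 * (wt y * R ^ ?n))"
      using C1[OF b semi \<open>0 < R\<close> \<open>R \<le> A * admissible y\<close>] by blast
    have gB: "emeasure gauss (ball y R) \<le> ennreal (C2 * (wt y * R ^ ?n))"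
    proof -
      have "emeasure gauss (ball y R) \<le> ennreal (?g * (D1 * wt y)) * emeasure lborel (ball y R)"
      proof (intro emeasure_gauss_le_local)
        fix x assume "x \<in> ball y R"
        then have "norm (y - x) \<le> A * admissible y" using \<open>R \<le> A * admissible y\<close> by (simp add: dist_norm)
        then show "wt x \<le> D1 * wt y" using D1 by blast
      qed auto
      also have "\<dots> = ennreal (C2 * (wt y * R ^ ?n))"
        using \<open>0 < R\<close> \<open>1 \<le> D1\<close> by (simp add: emeasure_lborel_ball ennreal_mult[symmetric] C2_def mult_ac)
      finally show ?thesis .
    qed
    have [measurable]: "ball y R \<in> sets borel" by simp
    define v where "v x = \<bar>b x - d\<bar>" for x
    have [measurable]: "v \<in> borel_measurable borel" unfolding v_def by measurable
    have vpos: "0 \<le> v x" for x by (simp add: v_def)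
    have powr_le: "v x powr e \<le> 1 + v x powr t" if "0 < e" "e \<le> t" for x e
    proof (cases "v x \<le> 1")
      case True
      then have "v x powr e \<le> 1 powr e" using that vpos by (intro powr_mono2) auto
      then show ?thesis by (simp add: add_increasing2)
    next
      case False
      then have "v x powr e \<le> v x powr t" using that by (intro powr_mono) auto
      then show ?thesis by linarith
    qed
    have moment: "(\<integral>\<^sup>+x\<in>ball y R. ennreal (B + v x powr t) \<partial>gauss) \<le> ennreal ((B * C2 + C1) * (wt y * R ^ ?n))"
      if "0 \<le> B" for B
    proof -
      have "(\<integral>\<^sup>+x\<in>ball y R. ennreal (B + v x powr t) \<partial>gauss)
        = (\<integral>\<^sup>+x. ennreal B * indicator (ball y R) x + ennreal (v x powr t) * indicator (ball y R) x \<partial>gauss)"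
        using that by (intro nn_integral_cong) (auto simp: indicator_def ennreal_plus)
      also have "\<dots> = ennreal B * emeasure gauss (ball y R) + (\<integral>\<^sup>+x\<in>ball y R. ennreal (v x powr t) \<partial>gauss)"
      proof -
        have "indicator (ball y R) \<in> borel_measurable (gauss :: (real ^ 'n) measure)"
          by (intro borel_measurable_indicator) simp
        then have "(\<lambda>x. ennreal B * indicator (ball y R) x) \<in> borel_measurable gauss"
          "(\<lambda>x. ennreal (v x powr t) * indicator (ball y R) x) \<in> borel_measurable gauss"
          by (intro borel_measurable_times_ennreal; measurable)+
        note nn_integral_add[OF this]
        also have "(\<integral>\<^sup>+x. ennreal B * indicator (ball y R) x \<partial>gauss) = ennreal B * emeasure gauss (ball y R)"
          by (intro nn_integral_cmult_indicator) simp
        finally show ?thesis .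
      qed
      also have "\<dots> \<le> ennreal B * ennreal (C2 * (wt y * R ^ ?n)) + ennreal (C1 * (wt y * R ^ ?n))"
        using d by (intro add_mono mult_left_mono gB) (auto simp: v_def)
      also have "\<dots> = ennreal ((B * C2 + C1) * (wt y * R ^ ?n))"
        using that pos \<open>0 < C1\<close> \<open>0 < R\<close> by (simp add: ennreal_mult[symmetric] ennreal_plus[symmetric] algebra_simps del: ennreal_plus)
      finally show ?thesis .
    qed
    have inner: "(\<integral>\<^sup>+z. ennreal_powr (ennreal \<bar>b x - b z\<bar>) s' * indicator (scale_nbhd a k x) z \<partial>gauss)
      \<le> ennreal (C3 * 2 powr - real k * (1 + v x powr s'))" if y: "y \<in> scale_nbhd a k x" for x
    proof -
      have "(\<integral>\<^sup>+z. ennreal_powr (ennreal \<bar>b x - b z\<bar>) s' * indicator (scale_nbhd a k x) z \<partial>gauss)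
        \<le> (\<integral>\<^sup>+z. ennreal (2 powr s') * (ennreal ((1 + v x powr s') + v z powr t) * indicator (ball y R) z) \<partial>gauss)"
      proof (intro nn_integral_mono)
        fix z
        show "ennreal_powr (ennreal \<bar>b x - b z\<bar>) s' * indicator (scale_nbhd a k x) z
          \<le> ennreal (2 powr s') * (ennreal ((1 + v x powr s') + v z powr t) * indicator (ball y R) z)"
        proof (cases "z \<in> scale_nbhd a k x")
          case True
          have "norm (y - z) \<le> norm (x - y) + norm (x - z)"
            using norm_triangle_ineq[of "y - x" "x - z"] by (simp add: norm_minus_commute)
          also have "\<dots> < R" using near[OF y y] near[OF y True] by (simp add: R_def)
          finally have zB: "z \<in> ball y R" by (simp add: dist_norm)
          have "\<bar>b x - b z\<bar> powr s' \<le> (2 * max (v x) (v z)) powr s'"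
          proof (rule powr_mono2)
            have "\<bar>b x - b z\<bar> \<le> v x + v z" unfolding v_def by linarith
            then show "\<bar>b x - b z\<bar> \<le> 2 * max (v x) (v z)" by linarith
          qed (use s' in auto)
          also have "\<dots> = 2 powr s' * max (v x) (v z) powr s'" by (rule powr_mult)
          also have "max (v x) (v z) powr s' \<le> v x powr s' + v z powr s'" by (auto simp: max_def)
          also have "\<dots> \<le> (1 + v x powr s') + v z powr t" using powr_le[of s' z] s' t by simp
          finally have "\<bar>b x - b z\<bar> powr s' \<le> 2 powr s' * ((1 + v x powr s') + v z powr t)" by simp
          then have "ennreal (\<bar>b x - b z\<bar> powr s') \<le> ennreal (2 powr s' * ((1 + v x powr s') + v z powr t))"
            by (rule ennreal_leI)
          also have "\<dots> = ennreal (2 powr s') * ennreal ((1 + v x powr s') + v z powr t)"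
            by (rule ennreal_mult) auto
          finally show ?thesis using True zB by (simp del: ennreal_plus)
        qed simp
      qed
      also have "\<dots> = ennreal (2 powr s') * (\<integral>\<^sup>+z\<in>ball y R. ennreal ((1 + v x powr s') + v z powr t) \<partial>gauss)"
        by (intro nn_integral_cmult) measurable
      also have "\<dots> \<le> ennreal (2 powr s') * ennreal (((1 + v x powr s') * C2 + C1) * (wt y * R ^ ?n))"
        by (intro mult_left_mono moment) auto
      also have "\<dots> \<le> ennreal (C3 * 2 powr - real k * (1 + v x powr s'))"
      proof -
        have "((1 + v x powr s') * C2 + C1) * (wt y * R ^ ?n) \<le> ((1 + v x powr s') * (C1 + C2)) * (E * 2 powr - real k)"
        proof (rule mult_mono[OF _ wR])
          show "(1 + v x powr s') * C2 + C1 \<le> (1 + v x powr s') * (C1 + C2)"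
            using \<open>0 < C1\<close> by (simp add: distrib_left distrib_right)
        qed (use \<open>0 < C1\<close> pos \<open>0 < R\<close> in \<open>auto simp: add_nonneg_nonneg\<close>)
        then have "2 powr s' * (((1 + v x powr s') * C2 + C1) * (wt y * R ^ ?n)) \<le> 2 powr s' * (((1 + v x powr s') * (C1 + C2)) * (E * 2 powr - real k))"
          by (intro mult_left_mono) auto
        then show ?thesis
          using pos \<open>0 < C1\<close> \<open>0 < R\<close> by (subst ennreal_mult[symmetric]) (auto simp: C3_def mult_ac add_nonneg_nonneg intro!: ennreal_leI)
      qed
      finally show ?thesis .
    qed
    have "(\<integral>\<^sup>+x. ennreal_powr (\<integral>\<^sup>+z. ennreal_powr (ennreal \<bar>b x - b z\<bar>) s' * indicator (scale_nbhd a k x) z \<partial>gauss) (r / s')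
         * indicator (scale_nbhd a k x) y \<partial>gauss)
      \<le> (\<integral>\<^sup>+x. ennreal ((C3 * 2 * 2 powr - real k) powr (r / s')) * (ennreal (2 + v x powr t) * indicator (ball y R) x) \<partial>gauss)"
    proof (intro nn_integral_mono)
      fix x
      show "ennreal_powr (\<integral>\<^sup>+z. ennreal_powr (ennreal \<bar>b x - b z\<bar>) s' * indicator (scale_nbhd a k x) z \<partial>gauss) (r / s')
         * indicator (scale_nbhd a k x) y
        \<le> ennreal ((C3 * 2 * 2 powr - real k) powr (r / s')) * (ennreal (2 + v x powr t) * indicator (ball y R) x)"
      proof (cases "y \<in> scale_nbhd a k x")
        case True
        have "x \<in> ball y R" using near[OF True True] \<open>0 < \<rho>\<close> by (simp add: dist_norm norm_minus_commute R_def)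
        have "ennreal_powr (\<integral>\<^sup>+z. ennreal_powr (ennreal \<bar>b x - b z\<bar>) s' * indicator (scale_nbhd a k x) z \<partial>gauss) (r / s')
          \<le> ennreal_powr (ennreal (C3 * 2 powr - real k * (1 + v x powr s'))) (r / s')"
          using assms s' by (intro ennreal_powr_mono inner True) auto
        also have "\<dots> = ennreal ((C3 * 2 powr - real k * (1 + v x powr s')) powr (r / s'))"
          using pos by (intro ennreal_powr_ennreal) (auto simp: add_nonneg_nonneg)
        also have "\<dots> \<le> ennreal ((C3 * 2 * 2 powr - real k) powr (r / s') * (2 + v x powr t))"
        proof (intro ennreal_leI)
          have "(C3 * 2 powr - real k * (1 + v x powr s')) powr (r / s')
            \<le> ((C3 * 2 * 2 powr - real k) * max 1 (v x powr s')) powr (r / s')"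
            using pos assms s' by (intro powr_mono2) (auto simp: mult_ac add_nonneg_nonneg intro!: mult_left_mono)
          also have "\<dots> = (C3 * 2 * 2 powr - real k) powr (r / s') * max 1 (v x powr s') powr (r / s')"
            by (rule powr_mult)
          also have "max 1 (v x powr s') powr (r / s') \<le> 1 + v x powr r"
            using s' by (auto simp: max_def powr_powr)
          also have "\<dots> \<le> 2 + v x powr t" using powr_le[of r x] t assms by simp
          finally show "(C3 * 2 powr - real k * (1 + v x powr s')) powr (r / s') \<le> (C3 * 2 * 2 powr - real k) powr (r / s') * (2 + v x powr t)"
            by (simp add: mult_left_mono)
        qed
        finally show ?thesis using True \<open>x \<in> ball y R\<close> by (simp add: ennreal_mult)
      qed simp
    qed
    also have "\<dots> = ennreal ((C3 * 2 * 2 powr - real k) powr (r / s')) * (\<integral>\<^sup>+x\<in>ball y R. ennreal (2 + v x powr t) \<partial>gauss)"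
      by (intro nn_integral_cmult) measurable
    also have "\<dots> \<le> ennreal ((C3 * 2 * 2 powr - real k) powr (r / s')) * ennreal ((2 * C2 + C1) * (wt y * R ^ ?n))"
      by (intro mult_left_mono moment) auto
    also have "\<dots> \<le> ennreal ((C3 * 2 * 2 powr - real k) powr (r / s')) * ennreal ((2 * C2 + C1) * (E * 2 powr - real k))"
      using wR pos \<open>0 < C1\<close> by (intro mult_left_mono ennreal_leI) auto
    also have "\<dots> = ennreal (C * 2 powr (- real k * (1 + r / s')))"
    proof -
      have "(C3 * 2 * 2 powr - real k) powr (r / s') * ((2 * C2 + C1) * (E * 2 powr - real k))
        = C * ((2 powr - real k) powr (r / s') * 2 powr - real k)"
        unfolding C_def powr_mult[of "C3 * 2" "2 powr - real k"] by (simp only: mult_ac)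
      also have "(2 powr - real k) powr (r / s') * 2 powr - real k = 2 powr (- real k * (1 + r / s'))"
        by (simp only: powr_powr powr_add[symmetric]) (simp add: algebra_simps)
      finally show ?thesis
        using pos \<open>0 < C1\<close> by (simp add: ennreal_mult[symmetric])
    qed
    finally show "(\<integral>\<^sup>+x. ennreal_powr (\<integral>\<^sup>+z. ennreal_powr (ennreal \<bar>b x - b z\<bar>) s' * indicator (scale_nbhd a k x) z \<partial>gauss) (r / s')
         * indicator (scale_nbhd a k x) y \<partial>gauss) \<le> ennreal (C * 2 powr (- real k * (1 + r / s')))" .
  qed
qed

text \<open>Hoelder's inequality separates b from F, leaving the local s-norm of F to the power r.
  Only one local factor is kept for Fubini's theorem; the others are enlarged to the global norm.
  The powers of 2 are k r (1 - \<beta>) from the kernel and - k (1 + r / s') from the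
  measures.\<close>

lemma scale_op_bound:
  fixes a \<beta> s r :: real
  assumes "0 < a" "1 < s" "s < r"
  obtains C :: real where "0 < C"
    "\<And>(b :: real ^ 'n \<Rightarrow> real) F k. b \<in> borel_measurable borel \<Longrightarrow> bmo_seminorm b \<le> 1 \<Longrightarrow>
      F \<in> borel_measurable borel \<Longrightarrow> (\<And>x. 0 \<le> F x) \<Longrightarrow>
      (\<integral>\<^sup>+x. ennreal_powr (scale_op a \<beta> b k F x) r \<partial>gauss)
        \<le> ennreal (C * 2 powr (real k * r * (1 / s - 1 / r - \<beta>)))
          * ennreal_powr (\<integral>\<^sup>+x. ennreal (F x powr s) \<partial>gauss) (r / s)"
proof -
  define s' where "s' = s / (s - 1)"
  have s': "1 < s'" "1 / s' + 1 / s = 1" using assms by (auto simp: s'_def field_simps)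
  obtain C :: real where "0 < C" and C:
    "\<And>(b :: real ^ 'n \<Rightarrow> real) y k. b \<in> borel_measurable borel \<Longrightarrow> bmo_seminorm b \<le> 1 \<Longrightarrow>
      (\<integral>\<^sup>+x. ennreal_powr (\<integral>\<^sup>+z. ennreal_powr (ennreal \<bar>b x - b z\<bar>) s' * indicator (scale_nbhd a k x) z \<partial>gauss) (r / s')
         * indicator (scale_nbhd a k x) y \<partial>gauss) \<le> ennreal (C * 2 powr (- real k * (1 + r / s')))"
    using scale_nbhd_moment[OF assms, where 'n='n] unfolding s'_def by blast
  show ?thesis
  proof (rule that[of C])
    show "0 < C" by fact
    fix b F :: "real ^ 'n \<Rightarrow> real" and k
    assume b [measurable]: "b \<in> borel_measurable borel" and semi: "bmo_seminorm b \<le> 1"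
      and [measurable]: "F \<in> borel_measurable borel" and Fpos: "\<And>x. 0 \<le> F x"
    interpret sigma_finite_measure "gauss :: (real ^ 'n) measure" by (rule sigma_finite_gauss)
    interpret pair_sigma_finite "gauss :: (real ^ 'n) measure" "gauss :: (real ^ 'n) measure" ..
    let ?I = "\<lambda>x y. indicator (scale_nbhd a k x) y :: ennreal"
    define \<Phi> where "\<Phi> = (\<integral>\<^sup>+x. ennreal (F x powr s) \<partial>gauss)"
    define G where "G x = ennreal_powr (\<integral>\<^sup>+z. ennreal_powr (ennreal \<bar>b x - b z\<bar>) s' * ?I x z \<partial>gauss) (r / s')" for x
    have [measurable]: "G \<in> borel_measurable borel" unfolding G_def by measurable
    define c where "c = (2 powr (real k * (1 - \<beta>))) powr r"
    have pt: "ennreal_powr (scale_op a \<beta> b k F x) r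
      \<le> ennreal c * (ennreal_powr \<Phi> (r / s - 1) * (\<integral>\<^sup>+y. ennreal (F y powr s) * (G x * ?I x y) \<partial>gauss))" for x
    proof -
      let ?H = "\<integral>\<^sup>+y. ennreal (F y powr s) * ?I x y \<partial>gauss"
      \<comment> \<open>The indicator is idempotent, so each of the two factors may carry a
        copy.\<close>
      have "(\<integral>\<^sup>+y. ennreal \<bar>b x - b y\<bar> * (ennreal (F y) * ?I x y) \<partial>gauss)
        = (\<integral>\<^sup>+y. (ennreal \<bar>b x - b y\<bar> * ?I x y) * (ennreal (F y) * ?I x y) \<partial>gauss)"
        by (intro nn_integral_cong) (auto simp: indicator_def)
      also have "\<dots> \<le> ennreal_powr (\<integral>\<^sup>+y. ennreal_powr (ennreal \<bar>b x - b y\<bar> * ?I x y) s' \<partial>gauss) (1 / s')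
        * ennreal_powr (\<integral>\<^sup>+y. ennreal_powr (ennreal (F y) * ?I x y) s \<partial>gauss) (1 / s)"
        using s' assms by (intro nn_integral_Hoelder) auto
      also have "(\<integral>\<^sup>+y. ennreal_powr (ennreal \<bar>b x - b y\<bar> * ?I x y) s' \<partial>gauss)
        = (\<integral>\<^sup>+y. ennreal_powr (ennreal \<bar>b x - b y\<bar>) s' * ?I x y \<partial>gauss)"
        by (intro nn_integral_cong) (auto simp: indicator_def)
      also have "(\<integral>\<^sup>+y. ennreal_powr (ennreal (F y) * ?I x y) s \<partial>gauss) = ?H"
        using Fpos by (intro nn_integral_cong) (auto simp: indicator_def)
      finally have "ennreal_powr (scale_op a \<beta> b k F x) r \<le> ennreal_powr (ennreal (2 powr (real k * (1 - \<beta>))) *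
          (ennreal_powr (\<integral>\<^sup>+y. ennreal_powr (ennreal \<bar>b x - b y\<bar>) s' * ?I x y \<partial>gauss) (1 / s') * ennreal_powr ?H (1 / s))) r"
        unfolding scale_op_def using assms by (intro ennreal_powr_mono mult_left_mono) auto
      also have "\<dots> = ennreal c * (G x * ennreal_powr ?H (r / s))"
        using assms s' by (simp add: ennreal_powr_mult ennreal_powr_powr G_def c_def)
      also have "ennreal_powr ?H (r / s) = ennreal_powr ?H (r / s - 1) * ?H"
        using ennreal_powr_add[of "r / s - 1" 1 ?H] assms by simp
      \<comment> \<open>The last \<open>?H\<close> stays local: it ties y to x and makes the
        x-integral an instance of the moment bound.\<close>
      also have "\<dots> \<le> ennreal_powr \<Phi> (r / s - 1) * ?H"
        unfolding \<Phi>_def using assms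
        by (intro mult_right_mono ennreal_powr_mono nn_integral_mono) (auto simp: indicator_def)
      also have "ennreal c * (G x * (ennreal_powr \<Phi> (r / s - 1) * ?H))
        = ennreal c * (ennreal_powr \<Phi> (r / s - 1) * (G x * ?H))" by (simp add: mult_ac)
      also have "G x * ?H = (\<integral>\<^sup>+y. ennreal (F y powr s) * (G x * ?I x y) \<partial>gauss)"
        by (subst nn_integral_cmult[symmetric]) (auto intro!: nn_integral_cong simp: mult_ac)
      finally show ?thesis by (simp add: mult_left_mono)
    qed
    have "(\<integral>\<^sup>+x. ennreal_powr (scale_op a \<beta> b k F x) r \<partial>gauss)
      \<le> (\<integral>\<^sup>+x. ennreal c * (ennreal_powr \<Phi> (r / s - 1) * (\<integral>\<^sup>+y. ennreal (F y powr s) * (G x * ?I x y) \<partial>gauss)) \<partial>gauss)"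
      by (intro nn_integral_mono pt)
    also have "\<dots> = ennreal c * (ennreal_powr \<Phi> (r / s - 1) * (\<integral>\<^sup>+x. \<integral>\<^sup>+y. ennreal (F y powr s) * (G x * ?I x y) \<partial>gauss \<partial>gauss))"
      by (subst nn_integral_cmult, measurable, subst nn_integral_cmult, measurable)
    also have "(\<integral>\<^sup>+x. \<integral>\<^sup>+y. ennreal (F y powr s) * (G x * ?I x y) \<partial>gauss \<partial>gauss)
      = (\<integral>\<^sup>+y. \<integral>\<^sup>+x. ennreal (F y powr s) * (G x * ?I x y) \<partial>gauss \<partial>gauss)"
      by (rule Fubini') measurable
    also have "\<dots> = (\<integral>\<^sup>+y. ennreal (F y powr s) * (\<integral>\<^sup>+x. G x * ?I x y \<partial>gauss) \<partial>gauss)"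
      by (intro nn_integral_cong nn_integral_cmult) measurable
    also have "\<dots> \<le> (\<integral>\<^sup>+y. ennreal (F y powr s) * ennreal (C * 2 powr (- real k * (1 + r / s'))) \<partial>gauss)"
      unfolding G_def by (intro nn_integral_mono mult_left_mono C b semi) auto
    also have "\<dots> = \<Phi> * ennreal (C * 2 powr (- real k * (1 + r / s')))"
      unfolding \<Phi>_def by (intro nn_integral_multc) measurable
    also have "ennreal c * (ennreal_powr \<Phi> (r / s - 1) * (\<Phi> * ennreal (C * 2 powr (- real k * (1 + r / s')))))
      = (ennreal c * ennreal (C * 2 powr (- real k * (1 + r / s')))) * (ennreal_powr \<Phi> (r / s - 1) * \<Phi>)"
      by (simp add: mult_ac)
    also have "ennreal_powr \<Phi> (r / s - 1) * \<Phi> = ennreal_powr \<Phi> (r / s)"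
      using ennreal_powr_add[of "r / s - 1" 1 \<Phi>] assms by simp
    also have "ennreal c * ennreal (C * 2 powr (- real k * (1 + r / s')))
      = ennreal (C * 2 powr (real k * r * (1 / s - 1 / r - \<beta>)))"
    proof -
      have "c * 2 powr (- real k * (1 + r / s')) = 2 powr (real k * (1 - \<beta>) * r + (- real k * (1 + r / s')))"
        by (simp only: c_def powr_powr powr_add)
      also have "real k * (1 - \<beta>) * r + (- real k * (1 + r / s')) = real k * r * (1 / s - 1 / r - \<beta>)"
      proof -
        define i where "i = 1 / s"
        have "1 / s' = 1 - i" using s' by (simp add: i_def)
        then have "r / s' = r * (1 - i)" by (metis times_divide_eq_right mult.right_neutral)
        moreover have "r * (1 / r) = 1" using assms by simp
        ultimately show ?thesis unfolding i_def[symmetric] by algebra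
      qed
      finally have "c * (C * 2 powr (- real k * (1 + r / s'))) = C * 2 powr (real k * r * (1 / s - 1 / r - \<beta>))"
        by (simp add: mult_ac)
      then show ?thesis using \<open>0 < C\<close> by (simp add: ennreal_mult[symmetric] c_def)
    qed
    finally show "(\<integral>\<^sup>+x. ennreal_powr (scale_op a \<beta> b k F x) r \<partial>gauss)
        \<le> ennreal (C * 2 powr (real k * r * (1 / s - 1 / r - \<beta>)))
          * ennreal_powr (\<integral>\<^sup>+x. ennreal (F x powr s) \<partial>gauss) (r / s)"
      by (simp add: \<Phi>_def mult_left_mono)
  qed
qed

text \<open>V stands in a denominator, so the kernel is dominated through this lower bound.\<close>

lemma V_ge:
  fixes a :: real
  assumes "0 < a"
  obtains c :: real where "0 < c"
    "\<And>x y :: real ^ 'n. norm (x - y) < a * admissible x \<Longrightarrow> c * (wt x * norm (x - y) ^ CARD('n)) \<le> V x y"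
proof -
  let ?n = "CARD('n)" and ?g = "gauss_const TYPE('n)" and ?v = "vball TYPE('n)"
  obtain D :: real where "1 \<le> D" and D: "\<And>x y :: real ^ 'n. norm (x - y) \<le> a * admissible x \<Longrightarrow>
      wt x \<le> D * wt y \<and> wt y \<le> D * wt x \<and>
      admissible x \<le> D * admissible y \<and> admissible y \<le> D * admissible x"
    using wt_admissible_comparable[of a] assms by auto
  show ?thesis
  proof (rule that[of "?g * ?v / D"])
    show "0 < ?g * ?v / D" using \<open>1 \<le> D\<close> by simp
    fix x y :: "real ^ 'n" assume xy: "norm (x - y) < a * admissible x"
    let ?B = "ball x (norm (x - y))"
    have fin: "emeasure gauss ?B = ennreal (V x y)"
      using emeasure_gauss_finite[of ?B] unfolding V_def
      by (intro emeasure_eq_ennreal_measure) auto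
    have "ennreal (?v * norm (x - y) ^ ?n) = emeasure lborel ?B" by (simp add: emeasure_lborel_ball)
    also have "\<dots> \<le> ennreal (D / (?g * wt x)) * emeasure gauss ?B"
    proof (intro emeasure_gauss_ge_local)
      fix z assume "z \<in> ?B"
      then have "norm (x - z) \<le> a * admissible x" using xy by (simp add: dist_norm)
      then show "wt x \<le> D * wt z" using D by blast
    qed (use \<open>1 \<le> D\<close> in auto)
    also have "\<dots> = ennreal (D / (?g * wt x) * V x y)"
      unfolding fin using \<open>1 \<le> D\<close> by (simp add: ennreal_mult[symmetric] V_def)
    finally have "?v * norm (x - y) ^ ?n \<le> D / (?g * wt x) * V x y"
      using \<open>1 \<le> D\<close> by (subst (asm) ennreal_le_iff) (auto simp: V_def)
    moreover have "0 < ?g * wt x" by simp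
    ultimately have "?v * norm (x - y) ^ ?n * (?g * wt x) \<le> D * V x y"
      by (simp add: pos_le_divide_eq del: mult_pos_pos)
    then show "?g * ?v / D * (wt x * norm (x - y) ^ ?n) \<le> V x y"
      using \<open>1 \<le> D\<close> by (simp add: field_simps)
  qed
qed

lemma dyadic_scale_exists:
  fixes \<tau> :: real
  assumes "0 < \<tau>" "\<tau> < 1"
  obtains k :: nat where "(1 / 2) ^ Suc k \<le> \<tau>" "\<tau> < (1 / 2) ^ k"
proof -
  obtain j where "(1 / 2) ^ j < \<tau>" using real_arch_pow_inv[OF assms(1), of "1 / 2"] by auto
  then have ex: "(1 / 2) ^ j \<le> \<tau>" by simp
  define m where "m = (LEAST j. (1 / 2) ^ j \<le> \<tau>)"
  have m: "(1 / 2) ^ m \<le> \<tau>" unfolding m_def using ex by (rule LeastI)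
  then have "m \<noteq> 0" using assms by (cases m) auto
  then obtain k where k: "m = Suc k" by (cases m) auto
  have "\<not> (1 / 2) ^ k \<le> \<tau>" using not_less_Least[of k "\<lambda>j. (1 / 2) ^ j \<le> \<tau>"] k by (simp add: m_def)
  then show ?thesis using that[of k] m k by simp
qed

text \<open>V is the integral in z of a function jointly measurable in x, y and z, so Tonelli's
  theorem applies.\<close>

lemma measurable_V [measurable]:
  "(\<lambda>p. V (fst p) (snd p :: real ^ 'n)) \<in> borel_measurable (borel \<Otimes>\<^sub>M borel)"
proof -
  interpret sigma_finite_measure "gauss :: (real ^ 'n) measure" by (rule sigma_finite_gauss)
  have "V x y = enn2real (\<integral>\<^sup>+z. (if dist x z < norm (x - y) then 1 else 0) \<partial>gauss)" for x y :: "real ^ 'n"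
  proof -
    have "emeasure gauss (ball x (norm (x - y))) = (\<integral>\<^sup>+z. indicator (ball x (norm (x - y))) z \<partial>gauss)" by simp
    also have "\<dots> = (\<integral>\<^sup>+z. (if dist x z < norm (x - y) then 1 else 0) \<partial>gauss)"
      by (intro nn_integral_cong) (auto simp: indicator_def)
    finally show ?thesis by (simp add: V_def measure_def)
  qed
  then show ?thesis by simp
qed

lemma measurable_abs_commutator:
  fixes b f :: "real ^ 'n \<Rightarrow> real"
  assumes [measurable]: "b \<in> borel_measurable borel" "f \<in> borel_measurable borel"
  shows "abs_commutator a \<beta> b f \<in> borel_measurable borel"
proof -
  interpret sigma_finite_measure "gauss :: (real ^ 'n) measure" by (rule sigma_finite_gauss)
  have [measurable]: "(\<lambda>p. V (fst p) (snd p :: real ^ 'n)) \<in> borel_measurable (borel \<Otimes>\<^sub>M gauss)"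
    using measurable_V by (rule measurable_cong_sets[THEN eqset_imp_iff, THEN iffD1, rotated -1]) (auto intro: sets_pair_measure_cong)
  have "abs_commutator a \<beta> b f x = (\<integral>\<^sup>+y. ennreal (\<bar>b x - b y\<bar> * \<bar>f y\<bar> / V x y powr (1 - \<beta>))
      * (if dist x y < a * admissible x then 1 else 0) \<partial>gauss)" for x
    unfolding abs_commutator_def by (intro nn_integral_cong) (auto simp: indicator_def)
  moreover have "(\<lambda>x. \<integral>\<^sup>+y. (\<lambda>p. ennreal (\<bar>b (fst p) - b (snd p)\<bar> * \<bar>f (snd p)\<bar> / V (fst p) (snd p) powr (1 - \<beta>))
      * (if dist (fst p) (snd p) < a * admissible (fst p) then 1 else 0)) (x, y) \<partial>gauss) \<in> borel_measurable borel"
    by (intro borel_measurable_nn_integral_fst) measurable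
  ultimately show ?thesis by (simp cong: measurable_cong_simp)
qed

lemma one_over_powr_antimono:
  fixes s t e :: real
  assumes "0 < s" "s \<le> t" "0 \<le> e"
  shows "1 / t powr e \<le> 1 / s powr e"
  using assms by (intro divide_left_mono powr_mono2 mult_pos_pos) auto

text \<open>Every y other than x belongs to one dyadic range of the normalised quantity \<tau>, and
  the summand of that scale already dominates the integrand. The others are added without
  harm.\<close>

lemma abs_commutator_le_scales:
  fixes a \<beta> :: real
  assumes "0 < a" "\<beta> < 1"
  obtains c :: real where "0 < c"
    "\<And>(b :: real ^ 'n \<Rightarrow> real) f x. b \<in> borel_measurable borel \<Longrightarrow> f \<in> borel_measurable borel \<Longrightarrow>
      abs_commutator a \<beta> b f x \<le> ennreal c * (\<Sum>k. scale_op a \<beta> b k (\<lambda>y. \<bar>f y\<bar>) x)"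
proof -
  let ?n = "CARD('n)"
  obtain c0 :: real where "0 < c0" and c0:
    "\<And>x y :: real ^ 'n. norm (x - y) < a * admissible x \<Longrightarrow> c0 * (wt x * norm (x - y) ^ ?n) \<le> V x y"
    using V_ge[OF \<open>0 < a\<close>, where 'n='n] by blast
  define c where "c = (2 / (c0 * a ^ ?n)) powr (1 - \<beta>)"
  show ?thesis
  proof (rule that[of c])
    show "0 < c" using \<open>0 < c0\<close> \<open>0 < a\<close> by (simp add: c_def)
    fix b f :: "real ^ 'n \<Rightarrow> real" and x
    assume [measurable]: "b \<in> borel_measurable borel" "f \<in> borel_measurable borel"
    let ?S = "\<lambda>k y. ennreal (2 powr (real k * (1 - \<beta>))) * (ennreal \<bar>b x - b y\<bar> * (ennreal \<bar>f y\<bar> * indicator (scale_nbhd a k x) y))"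
    have pt: "ennreal (\<bar>b x - b y\<bar> * \<bar>f y\<bar> / V x y powr (1 - \<beta>)) * indicator (ball x (a * admissible x)) y
      \<le> ennreal c * (\<Sum>k. ?S k y)" for y
    \<comment> \<open>At y = x the factor |b x - b y| vanishes.\<close>
    proof (cases "y \<in> ball x (a * admissible x) \<and> y \<noteq> x")
      case True
      then have xy: "norm (x - y) < a * admissible x" "0 < norm (x - y)" by (auto simp: dist_norm)
      define \<tau> where "\<tau> = wt x * norm (x - y) ^ ?n / a ^ ?n"
      have "norm (x - y) < a" using xy admissible_le_1[of x] \<open>0 < a\<close> by (meson mult_left_le less_imp_le order_less_le_trans)
      then have "norm (x - y) ^ ?n < a ^ ?n" by (intro power_strict_mono) auto
      then have "wt x * norm (x - y) ^ ?n < a ^ ?n"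
        using wt_le_1[of x] by (smt (verit) mult_left_le_one_le wt_nonneg zero_le_power norm_ge_zero)
      then have "0 < \<tau>" "\<tau> < 1" using xy \<open>0 < a\<close> by (auto simp: \<tau>_def)
      then obtain k where k: "(1 / 2) ^ Suc k \<le> \<tau>" "\<tau> < (1 / 2) ^ k" by (rule dyadic_scale_exists)
      have E: "y \<in> scale_nbhd a k x"
        using k(2) xy \<open>0 < a\<close> by (simp add: scale_nbhd_def \<tau>_def field_simps power_divide)
      have "c0 * a ^ ?n / 2 * (1 / 2) ^ k \<le> c0 * a ^ ?n * \<tau>"
        using k(1) \<open>0 < c0\<close> \<open>0 < a\<close> by (simp add: mult_left_mono)
      also have "\<dots> = c0 * (wt x * norm (x - y) ^ ?n)" using \<open>0 < a\<close> by (simp add: \<tau>_def)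
      also have "\<dots> \<le> V x y" by (rule c0[OF xy(1)])
      finally have V: "c0 * a ^ ?n / 2 * (1 / 2) ^ k \<le> V x y" .
      have "1 / V x y powr (1 - \<beta>) \<le> 1 / (c0 * a ^ ?n / 2 * (1 / 2) ^ k) powr (1 - \<beta>)"
      proof -
        have "0 < c0 * a ^ ?n / 2 * (1 / 2) ^ k" using \<open>0 < c0\<close> \<open>0 < a\<close> by simp
        then show ?thesis using V \<open>\<beta> < 1\<close> by (intro one_over_powr_antimono) auto
      qed
      also have "\<dots> = (1 / (c0 * a ^ ?n / 2 * (1 / 2) ^ k)) powr (1 - \<beta>)" by (simp add: powr_divide)
      also have "1 / (c0 * a ^ ?n / 2 * (1 / 2) ^ k) = 2 / (c0 * a ^ ?n) * 2 powr real k"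
        by (simp add: powr_realpow power_divide)
      also have "\<dots> powr (1 - \<beta>) = c * 2 powr (real k * (1 - \<beta>))"
        by (simp only: powr_mult c_def powr_powr)
      finally have "\<bar>b x - b y\<bar> * \<bar>f y\<bar> * (1 / V x y powr (1 - \<beta>)) \<le> \<bar>b x - b y\<bar> * \<bar>f y\<bar> * (c * 2 powr (real k * (1 - \<beta>)))"
        by (intro mult_left_mono) auto
      then have "ennreal (\<bar>b x - b y\<bar> * \<bar>f y\<bar> / V x y powr (1 - \<beta>)) \<le> ennreal (\<bar>b x - b y\<bar> * \<bar>f y\<bar> * (c * 2 powr (real k * (1 - \<beta>))))"
        by (intro ennreal_leI) simp
      also have "\<dots> = ennreal c * ?S k y"
        using E \<open>0 < c\<close> by (simp add: ennreal_mult mult_ac)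
      also have "\<dots> \<le> ennreal c * (\<Sum>k. ?S k y)"
        by (intro mult_left_mono ennreal_le_suminf) auto
      finally show ?thesis using True by simp
    qed (auto simp: indicator_def)
    have "abs_commutator a \<beta> b f x \<le> (\<integral>\<^sup>+y. ennreal c * (\<Sum>k. ?S k y) \<partial>gauss)"
      unfolding abs_commutator_def by (intro nn_integral_mono pt)
    also have "\<dots> = ennreal c * (\<Sum>k. \<integral>\<^sup>+y. ?S k y \<partial>gauss)"
      by (subst nn_integral_cmult, measurable, subst nn_integral_suminf, measurable)
    also have "(\<Sum>k. \<integral>\<^sup>+y. ?S k y \<partial>gauss) = (\<Sum>k. scale_op a \<beta> b k (\<lambda>y. \<bar>f y\<bar>) x)"
      unfolding scale_op_def by (intro suminf_cong nn_integral_cmult) measurable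
    finally show "abs_commutator a \<beta> b f x \<le> ennreal c * (\<Sum>k. scale_op a \<beta> b k (\<lambda>y. \<bar>f y\<bar>) x)" .
  qed
qed

text \<open>Shift the reciprocals: 1 / p by \<delta> up or down, 1 / q by twice as much in the same
  direction. The larger shift of 1 / q decides the sign of the exponent, which becomes - \<delta> or
  \<delta>. The bound of \<delta> by a quarter keeps i - \<delta> above j + 2 \<delta>, all
  reciprocals positive and i + \<delta> below 1.\<close>

lemma interpolation_exponents:
  fixes p q \<beta> :: real
  assumes "1 < p" "p < q" "1 / q = 1 / p - \<beta>"
  obtains p0 p1 r0 r1 :: real where "1 < p0" "p0 < p" "p < p1" "p1 < r0" "r0 < r1"
    "1 / p0 - 1 / r0 - \<beta> < 0" "0 < 1 / p1 - 1 / r1 - \<beta>"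
proof -
  define i j where "i = 1 / p" and "j = 1 / q"
  have ij: "0 < j" "j < i" "i < 1" "i - j = \<beta>"
    using assms by (auto simp: i_def j_def field_simps)
  define \<delta> where "\<delta> = min j (min (i - j) (1 - i)) / 4"
  have \<delta>: "0 < \<delta>" "4 * \<delta> \<le> j" "4 * \<delta> \<le> i - j" "4 * \<delta> \<le> 1 - i"
    using ij by (auto simp: \<delta>_def)
  have p: "p = 1 / i" using assms by (simp add: i_def)
  show ?thesis
  proof (rule that[of "1 / (i + \<delta>)" "1 / (i - \<delta>)" "1 / (j + 2 * \<delta>)" "1 / (j - 2 * \<delta>)"])
    show "1 < 1 / (i + \<delta>)" using \<delta> ij by (subst less_divide_eq_1_pos) linarith+
    show "1 / (i + \<delta>) < p" unfolding p using \<delta> ij by (intro divide_strict_left_mono mult_pos_pos) linarith+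
    show "p < 1 / (i - \<delta>)" unfolding p using \<delta> ij by (intro divide_strict_left_mono mult_pos_pos) linarith+
    show "1 / (i - \<delta>) < 1 / (j + 2 * \<delta>)" using \<delta> ij by (intro divide_strict_left_mono mult_pos_pos) linarith+
    show "1 / (j + 2 * \<delta>) < 1 / (j - 2 * \<delta>)" using \<delta> ij by (intro divide_strict_left_mono mult_pos_pos) linarith+
    show "1 / (1 / (i + \<delta>)) - 1 / (1 / (j + 2 * \<delta>)) - \<beta> < 0" using \<delta> ij by simp
    show "0 < 1 / (1 / (i - \<delta>)) - 1 / (1 / (j - 2 * \<delta>)) - \<beta>" using \<delta> ij by simp
  qed
qed

lemma abs_commutator_normalized_bound:
  fixes a \<beta> p q :: real
  assumes "0 < a" "\<beta> < 1" "1 < p" "p < q" "1 / q = 1 / p - \<beta>"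
  obtains C :: real where "0 \<le> C"
    "\<And>(b :: real ^ 'n \<Rightarrow> real) f. b \<in> borel_measurable borel \<Longrightarrow> bmo_seminorm b \<le> 1 \<Longrightarrow>
      f \<in> borel_measurable borel \<Longrightarrow> (\<integral>\<^sup>+x. ennreal (\<bar>f x\<bar> powr p) \<partial>gauss) \<le> 1 \<Longrightarrow>
      (\<integral>\<^sup>+x. ennreal_powr (abs_commutator a \<beta> b f x) q \<partial>gauss) \<le> ennreal C"
proof -
  obtain p0 p1 r0 r1 :: real where e: "1 < p0" "p0 < p" "p < p1" "p1 < r0" "r0 < r1"
    "1 / p0 - 1 / r0 - \<beta> < 0" "0 < 1 / p1 - 1 / r1 - \<beta>"
    using interpolation_exponents[OF assms(3-5)] by blast
  have "\<exists>A. 0 < A \<and> (\<forall>(b :: real ^ 'n \<Rightarrow> real) F k. b \<in> borel_measurable borel \<longrightarrow> bmo_seminorm b \<le> 1 \<longrightarrow>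
      F \<in> borel_measurable borel \<longrightarrow> (\<forall>x. 0 \<le> F x) \<longrightarrow>
      (\<integral>\<^sup>+x. ennreal_powr (scale_op a \<beta> b k F x) r \<partial>gauss)
        \<le> ennreal (A * 2 powr (real k * r * (1 / s - 1 / r - \<beta>)))
          * ennreal_powr (\<integral>\<^sup>+x. ennreal (F x powr s) \<partial>gauss) (r / s))"
    if "1 < s" "s < r" for s r
    using scale_op_bound[OF assms(1) that, where 'n='n and \<beta>=\<beta>] by metis
  then obtain A :: "real \<Rightarrow> real \<Rightarrow> real" where A: "\<And>s r. 1 < s \<Longrightarrow> s < r \<Longrightarrow> 0 < A s r"
    "\<And>s r (b :: real ^ 'n \<Rightarrow> real) F k. 1 < s \<Longrightarrow> s < r \<Longrightarrow> b \<in> borel_measurable borel \<Longrightarrow> bmo_seminorm b \<le> 1 \<Longrightarrow>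
      F \<in> borel_measurable borel \<Longrightarrow> (\<And>x. 0 \<le> F x) \<Longrightarrow>
      (\<integral>\<^sup>+x. ennreal_powr (scale_op a \<beta> b k F x) r \<partial>gauss)
        \<le> ennreal (A s r * 2 powr (real k * r * (1 / s - 1 / r - \<beta>)))
          * ennreal_powr (\<integral>\<^sup>+x. ennreal (F x powr s) \<partial>gauss) (r / s)"
    by metis
  \<comment> \<open>\<open>scale_family\<close> has a single constant for the four pairs of
    exponents; the sum exceeds each of them.\<close>
  define A0 where "A0 = A p0 r0 + A p0 r1 + A p1 r0 + A p1 r1"
  have Apos: "0 < A p0 r0" "0 < A p0 r1" "0 < A p1 r0" "0 < A p1 r1" using e by (auto intro!: A(1))
  have A0: "A s r \<le> A0" if "s \<in> {p0, p1}" "r \<in> {r0, r1}" for s r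
    using that Apos by (auto simp: A0_def)
  have A0_nonneg: "0 \<le> A0" using Apos by (simp add: A0_def)
  have q_pos: "0 < q" using assms by simp
  obtain C0 :: real where "0 \<le> C0" and C0:
    "\<And>(M :: (real ^ 'n) measure) T F. sigma_finite_measure M \<Longrightarrow>
     scale_family M \<beta> {p0, p1} {r0, r1} A0 T \<Longrightarrow>
     F \<in> borel_measurable M \<Longrightarrow> (\<And>x. 0 \<le> F x) \<Longrightarrow> (\<integral>\<^sup>+x. ennreal (F x powr p) \<partial>M) \<le> 1 \<Longrightarrow>
     (\<integral>\<^sup>+x. ennreal_powr (\<Sum>k. T k F x) q \<partial>M) \<le> ennreal C0"
    by (rule strong_bound_of_scales[OF e(1-5) A0_nonneg q_pos assms(5) e(6,7), where 'a = "real ^ 'n"]) blast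
  obtain c :: real where "0 < c" and c:
    "\<And>(b :: real ^ 'n \<Rightarrow> real) f x. b \<in> borel_measurable borel \<Longrightarrow> f \<in> borel_measurable borel \<Longrightarrow>
      abs_commutator a \<beta> b f x \<le> ennreal c * (\<Sum>k. scale_op a \<beta> b k (\<lambda>y. \<bar>f y\<bar>) x)"
    using abs_commutator_le_scales[OF assms(1,2), where 'n='n] by blast
  show ?thesis
  proof (rule that[of "c powr q * C0"])
    show "0 \<le> c powr q * C0" using \<open>0 \<le> C0\<close> by simp
    fix b f :: "real ^ 'n \<Rightarrow> real"
    assume b [measurable]: "b \<in> borel_measurable borel" and semi: "bmo_seminorm b \<le> 1"
      and f [measurable]: "f \<in> borel_measurable borel" and norm: "(\<integral>\<^sup>+x. ennreal (\<bar>f x\<bar> powr p) \<partial>gauss) \<le> 1"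
    have fam: "scale_family gauss \<beta> {p0, p1} {r0, r1} A0 (scale_op a \<beta> b)"
      unfolding scale_family_def
    proof (intro conjI allI ballI impI)
      fix k x and F G :: "real ^ 'n \<Rightarrow> real"
      assume "F \<in> borel_measurable gauss" "G \<in> borel_measurable gauss" "\<forall>x. 0 \<le> F x" "\<forall>x. 0 \<le> G x"
      then show "scale_op a \<beta> b k (\<lambda>x. F x + G x) x \<le> scale_op a \<beta> b k F x + scale_op a \<beta> b k G x"
        by (subst scale_op_add) auto
    next
      fix k s r and F :: "real ^ 'n \<Rightarrow> real"
      assume s: "s \<in> {p0, p1}" and r: "r \<in> {r0, r1}" and F: "F \<in> borel_measurable gauss" "\<forall>x. 0 \<le> F x"
      have "(\<integral>\<^sup>+x. ennreal_powr (scale_op a \<beta> b k F x) r \<partial>gauss)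
        \<le> ennreal (A s r * 2 powr (real k * r * (1 / s - 1 / r - \<beta>)))
          * ennreal_powr (\<integral>\<^sup>+x. ennreal (F x powr s) \<partial>gauss) (r / s)"
        using s r F e by (intro A(2) b semi) auto
      also have "\<dots> \<le> ennreal (A0 * 2 powr (real k * r * (1 / s - 1 / r - \<beta>)))
          * ennreal_powr (\<integral>\<^sup>+x. ennreal (F x powr s) \<partial>gauss) (r / s)"
        using A0[OF s r] by (intro mult_right_mono ennreal_leI) auto
      finally show "(\<integral>\<^sup>+x. ennreal_powr (scale_op a \<beta> b k F x) r \<partial>gauss)
        \<le> ennreal (A0 * 2 powr (real k * r * (1 / s - 1 / r - \<beta>)))
          * ennreal_powr (\<integral>\<^sup>+x. ennreal (F x powr s) \<partial>gauss) (r / s)" .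
    qed (simp add: measurable_scale_op)
    have [measurable]: "scale_op a \<beta> b k (\<lambda>y. \<bar>f y\<bar>) \<in> borel_measurable borel" for k
      by (intro measurable_scale_op) measurable
    have "(\<integral>\<^sup>+x. ennreal_powr (abs_commutator a \<beta> b f x) q \<partial>gauss)
      \<le> (\<integral>\<^sup>+x. ennreal_powr (ennreal c * (\<Sum>k. scale_op a \<beta> b k (\<lambda>y. \<bar>f y\<bar>) x)) q \<partial>gauss)"
      using assms by (intro nn_integral_mono ennreal_powr_mono c b f) auto
    also have "\<dots> = ennreal (c powr q) * (\<integral>\<^sup>+x. ennreal_powr (\<Sum>k. scale_op a \<beta> b k (\<lambda>y. \<bar>f y\<bar>) x) q \<partial>gauss)"
      using assms \<open>0 < c\<close> by (simp add: ennreal_powr_mult nn_integral_cmult)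
    also have "\<dots> \<le> ennreal (c powr q) * ennreal C0"
      using norm by (intro mult_left_mono C0[OF sigma_finite_gauss fam]) auto
    finally show "(\<integral>\<^sup>+x. ennreal_powr (abs_commutator a \<beta> b f x) q \<partial>gauss) \<le> ennreal (c powr q * C0)"
      using \<open>0 \<le> C0\<close> by (simp add: ennreal_mult)
  qed
qed

section \<open>The extension to Lp\<close>

lemma nn_integral_powr_eq_eLp_norm:
  assumes "0 < p"
  shows "(\<integral>\<^sup>+x. ennreal_powr (g x) p \<partial>gauss) = ennreal_powr (eLp_norm p g) p"
  using assms by (simp add: eLp_norm_def ennreal_powr_powr)

lemma eLp_norm_le_iff:
  assumes "0 < p"
  shows "eLp_norm p g \<le> X \<longleftrightarrow> (\<integral>\<^sup>+x. ennreal_powr (g x) p \<partial>gauss) \<le> ennreal_powr X p"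
  using assms by (simp add: nn_integral_powr_eq_eLp_norm ennreal_powr_le_iff)

lemma eLp_norm_cmult:
  fixes g :: "real ^ 'n \<Rightarrow> ennreal"
  assumes "0 < p" and [measurable]: "g \<in> borel_measurable borel"
  shows "eLp_norm p (\<lambda>x. c * g x) = c * eLp_norm p g"
  using assms by (simp add: eLp_norm_def ennreal_powr_mult nn_integral_cmult ennreal_powr_powr)

lemma eLp_norm_cong_AE:
  assumes "AE x in gauss. f x = g x"
  shows "eLp_norm p f = eLp_norm p g"
proof -
  have "AE x in gauss. ennreal_powr (f x) p = ennreal_powr (g x) p" using assms by eventually_elim simp
  then show ?thesis unfolding eLp_norm_def by (simp cong: nn_integral_cong_AE)
qed

lemma AE_finite_of_eLp_norm:
  fixes g :: "real ^ 'n \<Rightarrow> ennreal"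
  assumes "0 < p" and [measurable]: "g \<in> borel_measurable borel" and "eLp_norm p g < \<infinity>"
  shows "AE x in gauss. g x < \<infinity>"
proof -
  have "(\<integral>\<^sup>+x. ennreal_powr (g x) p \<partial>gauss) \<noteq> \<infinity>"
    using assms by (simp add: nn_integral_powr_eq_eLp_norm less_top)
  then have "AE x in gauss. ennreal_powr (g x) p \<noteq> \<infinity>" by (intro nn_integral_PInf_AE) auto
  then show ?thesis by eventually_elim (simp add: less_top)
qed

lemma Lp_norm_eq: "Lp_norm p f = ennreal_powr (\<integral>\<^sup>+x. ennreal (\<bar>f x\<bar> powr p) \<partial>gauss) (1 / p)"
  by (simp add: Lp_norm_def eLp_norm_def)

lemma bmo_seminorm_divide_le_1:
  fixes b :: "real ^ 'n \<Rightarrow> real"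
  assumes [measurable]: "b \<in> borel_measurable borel" and "0 < \<kappa>" and "bmo_seminorm b \<le> ennreal \<kappa>"
  shows "bmo_seminorm (\<lambda>x. b x / \<kappa>) \<le> 1"
  unfolding bmo_seminorm_def
proof (rule SUP_least)
  fix B :: "(real ^ 'n) set" assume B: "B \<in> adm_balls 1"
  then have [measurable]: "B \<in> sets borel" by (auto simp: adm_balls_def)
  have avg: "ball_avg (\<lambda>x. b x / \<kappa>) B = ball_avg b B / \<kappa>"
    by (simp add: ball_avg_def set_integral_divide_zero)
  have "(\<integral>\<^sup>+x\<in>B. ennreal \<bar>b x / \<kappa> - ball_avg (\<lambda>x. b x / \<kappa>) B\<bar> \<partial>gauss)
    = (\<integral>\<^sup>+x. ennreal (1 / \<kappa>) * (ennreal \<bar>b x - ball_avg b B\<bar> * indicator B x) \<partial>gauss)"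
    unfolding avg diff_divide_distrib[symmetric] using \<open>0 < \<kappa>\<close>
    by (intro nn_integral_cong) (auto simp: indicator_def ennreal_mult[symmetric])
  also have "\<dots> = ennreal (1 / \<kappa>) * (\<integral>\<^sup>+x\<in>B. ennreal \<bar>b x - ball_avg b B\<bar> \<partial>gauss)"
    by (intro nn_integral_cmult) measurable
  finally have "(\<integral>\<^sup>+x\<in>B. ennreal \<bar>b x / \<kappa> - ball_avg (\<lambda>x. b x / \<kappa>) B\<bar> \<partial>gauss) / emeasure gauss B
    = ennreal (1 / \<kappa>) * ((\<integral>\<^sup>+x\<in>B. ennreal \<bar>b x - ball_avg b B\<bar> \<partial>gauss) / emeasure gauss B)"
    by (simp add: ennreal_times_divide)
  also have "\<dots> \<le> ennreal (1 / \<kappa>) * bmo_seminorm b"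
    unfolding bmo_seminorm_def using B by (intro mult_left_mono SUP_upper) auto
  also have "\<dots> \<le> ennreal (1 / \<kappa>) * ennreal \<kappa>" by (intro mult_left_mono assms) auto
  also have "\<dots> = 1" using \<open>0 < \<kappa>\<close> by (simp add: ennreal_mult[symmetric])
  finally show "(\<integral>\<^sup>+x\<in>B. ennreal \<bar>b x / \<kappa> - ball_avg (\<lambda>x. b x / \<kappa>) B\<bar> \<partial>gauss) / emeasure gauss B \<le> 1" .
qed

lemma abs_commutator_divide:
  fixes b f :: "real ^ 'n \<Rightarrow> real"
  assumes [measurable]: "b \<in> borel_measurable borel" "f \<in> borel_measurable borel" and "0 < \<kappa>"
  shows "abs_commutator a \<beta> (\<lambda>x. b x / \<kappa>) (\<lambda>x. c * f x) x = ennreal (\<bar>c\<bar> / \<kappa>) * abs_commutator a \<beta> b f x"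
proof -
  have [measurable]: "(\<lambda>y. V x (y :: real ^ 'n)) \<in> borel_measurable borel"
    using measurable_compose[OF measurable_Pair1'[of x borel borel] measurable_V] by simp
  have "abs_commutator a \<beta> (\<lambda>x. b x / \<kappa>) (\<lambda>x. c * f x) x
    = (\<integral>\<^sup>+y. ennreal (\<bar>c\<bar> / \<kappa>) * (ennreal (\<bar>b x - b y\<bar> * \<bar>f y\<bar> / V x y powr (1 - \<beta>)) * indicator (ball x (a * admissible x)) y) \<partial>gauss)"
    unfolding abs_commutator_def diff_divide_distrib[symmetric] using \<open>0 < \<kappa>\<close>
    by (intro nn_integral_cong) (auto simp: indicator_def ennreal_mult[symmetric] abs_mult)
  also have "\<dots> = ennreal (\<bar>c\<bar> / \<kappa>) * abs_commutator a \<beta> b f x"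
    unfolding abs_commutator_def by (intro nn_integral_cmult) measurable
  finally show ?thesis .
qed

lemma abs_commutator_add_le:
  fixes b f g :: "real ^ 'n \<Rightarrow> real"
  assumes [measurable]: "b \<in> borel_measurable borel" "f \<in> borel_measurable borel" "g \<in> borel_measurable borel"
  shows "abs_commutator a \<beta> b (\<lambda>y. f y + g y) x \<le> abs_commutator a \<beta> b f x + abs_commutator a \<beta> b g x"
proof -
  have [measurable]: "(\<lambda>y. V x (y :: real ^ 'n)) \<in> borel_measurable borel"
    using measurable_compose[OF measurable_Pair1'[of x borel borel] measurable_V] by simp
  let ?k = "\<lambda>f y. ennreal (\<bar>b x - b y\<bar> * \<bar>f y\<bar> / V x y powr (1 - \<beta>)) * indicator (ball x (a * admissible x)) y"
  have "abs_commutator a \<beta> b (\<lambda>y. f y + g y) x \<le> (\<integral>\<^sup>+y. ?k f y + ?k g y \<partial>gauss)"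
    unfolding abs_commutator_def
  proof (intro nn_integral_mono)
    fix y
    have "\<bar>b x - b y\<bar> * \<bar>f y + g y\<bar> / V x y powr (1 - \<beta>)
      \<le> \<bar>b x - b y\<bar> * (\<bar>f y\<bar> + \<bar>g y\<bar>) / V x y powr (1 - \<beta>)"
      by (intro divide_right_mono mult_left_mono) auto
    also have "\<dots> = \<bar>b x - b y\<bar> * \<bar>f y\<bar> / V x y powr (1 - \<beta>) + \<bar>b x - b y\<bar> * \<bar>g y\<bar> / V x y powr (1 - \<beta>)"
      by (simp add: distrib_left add_divide_distrib)
    finally have "ennreal (\<bar>b x - b y\<bar> * \<bar>f y + g y\<bar> / V x y powr (1 - \<beta>))
      \<le> ennreal (\<bar>b x - b y\<bar> * \<bar>f y\<bar> / V x y powr (1 - \<beta>)) + ennreal (\<bar>b x - b y\<bar> * \<bar>g y\<bar> / V x y powr (1 - \<beta>))"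
      by (subst ennreal_plus[symmetric]) (simp_all add: ennreal_leI del: ennreal_plus)
    then show "?k (\<lambda>y. f y + g y) y \<le> ?k f y + ?k g y" by (auto simp: indicator_def)
  qed
  also have "\<dots> = abs_commutator a \<beta> b f x + abs_commutator a \<beta> b g x"
    unfolding abs_commutator_def by (intro nn_integral_add) measurable
  finally show ?thesis .
qed

lemma abs_commutator_bound:
  fixes a \<beta> p q :: real
  assumes "0 < a" "\<beta> < 1" "1 < p" "p < q" "1 / q = 1 / p - \<beta>"
  obtains C :: real where "0 \<le> C"
    "\<And>(b :: real ^ 'n \<Rightarrow> real) f. b \<in> borel_measurable borel \<Longrightarrow> bmo_seminorm b < \<infinity> \<Longrightarrow>
      f \<in> borel_measurable borel \<Longrightarrow> Lp_norm p f < \<infinity> \<Longrightarrow>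
      eLp_norm q (abs_commutator a \<beta> b f) \<le> ennreal C * bmo_seminorm b * Lp_norm p f"
proof -
  obtain C0 :: real where "0 \<le> C0" and C0:
    "\<And>(b :: real ^ 'n \<Rightarrow> real) f. b \<in> borel_measurable borel \<Longrightarrow> bmo_seminorm b \<le> 1 \<Longrightarrow>
      f \<in> borel_measurable borel \<Longrightarrow> (\<integral>\<^sup>+x. ennreal (\<bar>f x\<bar> powr p) \<partial>gauss) \<le> 1 \<Longrightarrow>
      (\<integral>\<^sup>+x. ennreal_powr (abs_commutator a \<beta> b f x) q \<partial>gauss) \<le> ennreal C0"
    using abs_commutator_normalized_bound[OF assms, where 'n='n] by blast
  define C where "C = C0 powr (1 / q)"
  show ?thesis
  proof (rule that[of C])
    show "0 \<le> C" by (simp add: C_def)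
    fix b f :: "real ^ 'n \<Rightarrow> real"
    assume b [measurable]: "b \<in> borel_measurable borel" and semi: "bmo_seminorm b < \<infinity>"
      and f [measurable]: "f \<in> borel_measurable borel" and fin: "Lp_norm p f < \<infinity>"
    obtain \<kappa> where \<kappa>: "bmo_seminorm b = ennreal \<kappa>" "0 \<le> \<kappa>" using semi by (cases "bmo_seminorm b") auto
    obtain N where N: "Lp_norm p f = ennreal N" "0 \<le> N" using fin by (cases "Lp_norm p f") auto
    \<comment> \<open>The seminorm and the norm may be 0, so the normalisation divides by slightly
      larger numbers, which are then let decrease to them.\<close>
    have "eLp_norm q (abs_commutator a \<beta> b f) \<le> ennreal (C * K * L)" if "\<kappa> < K" "N < L" for K L
    proof -
      have pos: "0 < K" "0 < L" using that \<kappa> N by auto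
      have "(\<integral>\<^sup>+x. ennreal (\<bar>1 / L * f x\<bar> powr p) \<partial>gauss) = (\<integral>\<^sup>+x. ennreal ((1 / L) powr p) * ennreal (\<bar>f x\<bar> powr p) \<partial>gauss)"
        using pos by (intro nn_integral_cong) (simp add: abs_mult powr_mult ennreal_mult[symmetric] powr_divide)
      also have "\<dots> = ennreal ((1 / L) powr p) * (\<integral>\<^sup>+x. ennreal (\<bar>f x\<bar> powr p) \<partial>gauss)"
        by (intro nn_integral_cmult) measurable
      also have "(\<integral>\<^sup>+x. ennreal (\<bar>f x\<bar> powr p) \<partial>gauss) = ennreal_powr (ennreal N) p"
        using assms nn_integral_powr_eq_eLp_norm[of p "\<lambda>x. ennreal \<bar>f x\<bar>"] N by (simp add: Lp_norm_def)
      also have "ennreal ((1 / L) powr p) * ennreal_powr (ennreal N) p \<le> ennreal ((1 / L) powr p) * ennreal_powr (ennreal L) p"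
        using that assms by (intro mult_left_mono ennreal_powr_mono ennreal_leI) auto
      also have "\<dots> = 1" using pos by (simp add: ennreal_mult[symmetric] powr_mult[symmetric])
      finally have fL: "(\<integral>\<^sup>+x. ennreal (\<bar>1 / L * f x\<bar> powr p) \<partial>gauss) \<le> 1" .
      have "(\<integral>\<^sup>+x. ennreal_powr (abs_commutator a \<beta> (\<lambda>x. b x / K) (\<lambda>x. 1 / L * f x) x) q \<partial>gauss) \<le> ennreal C0"
        using that \<kappa> pos by (intro C0 fL bmo_seminorm_divide_le_1) (auto intro: ennreal_leI)
      also have "\<dots> = ennreal_powr (ennreal C) q"
        using \<open>1 < p\<close> \<open>p < q\<close> \<open>0 \<le> C0\<close> by (simp add: C_def powr_powr)
      finally have "eLp_norm q (abs_commutator a \<beta> (\<lambda>x. b x / K) (\<lambda>x. 1 / L * f x)) \<le> ennreal C"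
        using assms by (subst eLp_norm_le_iff) auto
      moreover have "abs_commutator a \<beta> (\<lambda>x. b x / K) (\<lambda>x. 1 / L * f x) = (\<lambda>x. ennreal (1 / L / K) * abs_commutator a \<beta> b f x)"
        using pos by (intro ext) (subst abs_commutator_divide, auto)
      ultimately have "ennreal (1 / L / K) * eLp_norm q (abs_commutator a \<beta> b f) \<le> ennreal C"
        using assms measurable_abs_commutator[OF b f] by (simp add: eLp_norm_cmult)
      then have "ennreal (K * L) * (ennreal (1 / L / K) * eLp_norm q (abs_commutator a \<beta> b f)) \<le> ennreal (K * L) * ennreal C"
        by (rule mult_left_mono) simp
      moreover have "ennreal (K * L) * ennreal (1 / L / K) = 1"
        using pos by (simp add: ennreal_mult[symmetric])
      moreover have "ennreal (K * L) * ennreal C = ennreal (C * K * L)"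
        using pos \<open>0 \<le> C\<close> by (subst ennreal_mult[symmetric]) (auto simp: mult_ac)
      ultimately show ?thesis by (simp only: mult.assoc[symmetric] mult_1)
    qed
    then have "eLp_norm q (abs_commutator a \<beta> b f)
      \<le> ennreal (C * (\<kappa> + inverse (real (Suc j))) * (N + inverse (real (Suc j))))" for j by simp
    moreover have "(\<lambda>j. ennreal (C * (\<kappa> + inverse (real (Suc j))) * (N + inverse (real (Suc j))))) \<longlonglongrightarrow> ennreal (C * \<kappa> * N)"
      by (intro tendsto_ennrealI tendsto_intros LIMSEQ_inverse_real_of_nat_add)
    ultimately have "eLp_norm q (abs_commutator a \<beta> b f) \<le> ennreal (C * \<kappa> * N)"
      by (intro LIMSEQ_le_const) auto
    then show "eLp_norm q (abs_commutator a \<beta> b f) \<le> ennreal C * bmo_seminorm b * Lp_norm p f"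
      using \<open>0 \<le> C\<close> \<kappa> N by (simp add: ennreal_mult)
  qed
qed

section \<open>Density of \<open>Linf_c\<close> and uniqueness of sublinear extensions\<close>

lemma Linf_c_subset_Lp:
  assumes "0 < p"
  shows "(Linf_c :: (real ^ 'n \<Rightarrow> real) set) \<subseteq> Lp p"
proof
  fix f :: "real ^ 'n \<Rightarrow> real" assume "f \<in> Linf_c"
  then obtain M K where f [measurable]: "f \<in> borel_measurable borel" and M: "AE x in gauss. \<bar>f x\<bar> \<le> M"
    and "compact K" and K: "AE x in gauss. x \<notin> K \<longrightarrow> f x = 0"
    by (auto simp: Linf_c_def)
  have [measurable]: "K \<in> sets borel" using \<open>compact K\<close> by (intro borel_compact)
  have "(\<integral>\<^sup>+x. ennreal (\<bar>f x\<bar> powr p) \<partial>gauss) \<le> (\<integral>\<^sup>+x. ennreal (M powr p) * indicator K x \<partial>gauss)"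
  proof (intro nn_integral_mono_AE)
    show "AE x in gauss. ennreal (\<bar>f x\<bar> powr p) \<le> ennreal (M powr p) * indicator K x"
      using M K by eventually_elim (use assms in \<open>auto simp: indicator_def intro!: ennreal_leI powr_mono2\<close>)
  qed
  also have "\<dots> = ennreal (M powr p) * emeasure gauss K" by (intro nn_integral_cmult_indicator) simp
  also have "\<dots> < \<infinity>"
    using emeasure_gauss_finite[of K] compact_imp_bounded[OF \<open>compact K\<close>] by (simp add: ennreal_mult_less_top)
  finally show "f \<in> Lp p" using f by (simp add: Lp_def Lp_norm_eq)
qed

lemma Lp_add:
  fixes f g :: "real ^ 'n \<Rightarrow> real"
  assumes "1 \<le> p" "f \<in> Lp p" "g \<in> Lp p"
  shows "(\<lambda>x. f x + g x) \<in> Lp p"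
proof -
  have [measurable]: "f \<in> borel_measurable borel" "g \<in> borel_measurable borel" using assms by (auto simp: Lp_def)
  have "(\<integral>\<^sup>+x. ennreal_powr (ennreal \<bar>f x + g x\<bar>) p \<partial>gauss)
    \<le> (\<integral>\<^sup>+x. ennreal (2 powr p) * (ennreal_powr (ennreal \<bar>f x\<bar>) p + ennreal_powr (ennreal \<bar>g x\<bar>) p) \<partial>gauss)"
  proof (intro nn_integral_mono order_trans[OF ennreal_powr_mono ennreal_powr_sum_le[OF assms(1)]])
    show "ennreal \<bar>f x + g x\<bar> \<le> ennreal \<bar>f x\<bar> + ennreal \<bar>g x\<bar>" for x
      by (subst ennreal_plus[symmetric]) (simp_all add: ennreal_leI del: ennreal_plus)
  qed (use assms in auto)
  also have "\<dots> = ennreal (2 powr p) * (ennreal_powr (Lp_norm p f) p + ennreal_powr (Lp_norm p g) p)"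
    using assms unfolding Lp_norm_def
    by (subst nn_integral_cmult, measurable, subst nn_integral_add, measurable) (simp add: nn_integral_powr_eq_eLp_norm[symmetric])
  also have "\<dots> < \<infinity>" using assms by (simp add: Lp_def ennreal_mult_less_top)
  finally have "Lp_norm p (\<lambda>x. f x + g x) < \<infinity>" by (simp add: Lp_norm_def eLp_norm_def)
  then show ?thesis by (simp add: Lp_def)
qed

lemma Lp_cmult:
  fixes f :: "real ^ 'n \<Rightarrow> real"
  assumes "0 < p" "f \<in> Lp p"
  shows "(\<lambda>x. c * f x) \<in> Lp p"
proof -
  have [measurable]: "f \<in> borel_measurable borel" using assms by (auto simp: Lp_def)
  have "Lp_norm p (\<lambda>x. c * f x) = ennreal \<bar>c\<bar> * Lp_norm p f"
    unfolding Lp_norm_def using assms by (subst eLp_norm_cmult[symmetric]) (auto simp: abs_mult ennreal_mult)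
  then show ?thesis using assms by (simp add: Lp_def ennreal_mult_less_top)
qed

text \<open>The reverse triangle inequality of a seminorm: write f = g + (f - g) and g = f - (f -
  g), and note that T takes the same value on a function and on its negative.\<close>

lemma sublinear_op_diff_le:
  fixes T :: "(real ^ 'n \<Rightarrow> real) \<Rightarrow> real ^ 'n \<Rightarrow> real"
  assumes T: "sublinear_op (Lp p) T" and "1 \<le> p" and f: "f \<in> Lp p" and g: "g \<in> Lp p"
  shows "AE x in gauss. \<bar>T f x - T g x\<bar> \<le> T (\<lambda>x. f x - g x) x"
proof -
  define h where "h = (\<lambda>x. f x - g x)"
  have h: "h \<in> Lp p"
    using Lp_add[OF \<open>1 \<le> p\<close> f Lp_cmult[OF _ g, of "-1"]] \<open>1 \<le> p\<close> by (simp add: h_def)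
  have h': "(\<lambda>x. - 1 * h x) \<in> Lp p" using h \<open>1 \<le> p\<close> by (intro Lp_cmult) auto
  have add: "AE x in gauss. T (\<lambda>y. f y + g y) x \<le> T f x + T g x" if "f \<in> Lp p" "g \<in> Lp p" for f g
    using T that by (simp add: sublinear_op_def)
  have eqs: "(\<lambda>y. g y + h y) = f" "(\<lambda>y. f y + (- 1 * h y)) = g" by (auto simp: h_def)
  have "AE x in gauss. T (\<lambda>y. - 1 * h y) x = \<bar>- 1\<bar> * T h x"
    using T h unfolding sublinear_op_def by blast
  with add[OF g h, unfolded eqs] add[OF f h', unfolded eqs]
  have "AE x in gauss. \<bar>T f x - T g x\<bar> \<le> T h x"
    by eventually_elim (simp add: abs_le_iff)
  then show ?thesis by (simp add: h_def)
qed

text \<open>Apply the difference estimate to f + f and f: the bound for an absolute value is then T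
  f itself.\<close>

lemma sublinear_op_nonneg:
  fixes T :: "(real ^ 'n \<Rightarrow> real) \<Rightarrow> real ^ 'n \<Rightarrow> real"
  assumes T: "sublinear_op (Lp p) T" and "1 \<le> p" and f: "f \<in> Lp p"
  shows "AE x in gauss. 0 \<le> T f x"
  using sublinear_op_diff_le[OF T \<open>1 \<le> p\<close> Lp_add[OF \<open>1 \<le> p\<close> f f] f]
  by (auto elim!: eventually_mono intro: order_trans[OF abs_ge_zero])

lemma Lp_truncation:
  fixes f :: "real ^ 'n \<Rightarrow> real"
  assumes "0 < p" and f: "f \<in> Lp p" and "0 < (\<epsilon>::real)"
  obtains g where "g \<in> Linf_c" "Lp_norm p (\<lambda>x. f x - g x) \<le> ennreal \<epsilon>"
proof -
  have [measurable]: "f \<in> borel_measurable borel" using f by (auto simp: Lp_def)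
  define g where "g j x = (if \<bar>f x\<bar> \<le> real j \<and> norm x \<le> real j then f x else 0)" for j :: nat and x
  have [measurable]: "g j \<in> borel_measurable borel" for j unfolding g_def by measurable
  have "(\<lambda>j. \<integral>\<^sup>+x. ennreal (\<bar>f x - g j x\<bar> powr p) \<partial>gauss) \<longlonglongrightarrow> nn_integral gauss (\<lambda>_ :: real ^ 'n. 0)"
  proof (rule nn_integral_dominated_convergence)
    have "ennreal_powr (Lp_norm p f) p < \<infinity>" using f by (simp add: Lp_def)
    then show "(\<integral>\<^sup>+x. ennreal (\<bar>f x\<bar> powr p) \<partial>gauss) < \<infinity>"
      using \<open>0 < p\<close> by (simp add: Lp_norm_eq ennreal_powr_powr)
    show "AE x in gauss. ennreal (\<bar>f x - g j x\<bar> powr p) \<le> ennreal (\<bar>f x\<bar> powr p)" for j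
      by (auto simp: g_def)
    show "AE x in gauss. (\<lambda>j. ennreal (\<bar>f x - g j x\<bar> powr p)) \<longlonglongrightarrow> 0"
    proof (intro AE_I2 tendsto_eventually)
      fix x
      have "eventually (\<lambda>j. nat \<lceil>max \<bar>f x\<bar> (norm x)\<rceil> \<le> j) sequentially" by (rule eventually_ge_at_top)
      then show "eventually (\<lambda>j. ennreal (\<bar>f x - g j x\<bar> powr p) = 0) sequentially"
      proof eventually_elim
        case (elim j)
        then have "max \<bar>f x\<bar> (norm x) \<le> real j" by linarith
        then show ?case by (simp add: g_def)
      qed
    qed
  qed auto
  then have "eventually (\<lambda>j. (\<integral>\<^sup>+x. ennreal (\<bar>f x - g j x\<bar> powr p) \<partial>gauss) < ennreal (\<epsilon> powr p)) sequentially"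
    using \<open>0 < \<epsilon>\<close> by (intro order_tendstoD(2)) auto
  then obtain j where j: "(\<integral>\<^sup>+x. ennreal (\<bar>f x - g j x\<bar> powr p) \<partial>gauss) < ennreal (\<epsilon> powr p)"
    by (auto simp: eventually_sequentially)
  show ?thesis
  proof (rule that[of "g j"])
    show "g j \<in> Linf_c"
      unfolding Linf_c_def
      by (auto simp: g_def intro!: exI[of _ "real j"] exI[of _ "cball 0 (real j)"])
    show "Lp_norm p (\<lambda>x. f x - g j x) \<le> ennreal \<epsilon>"
      unfolding Lp_norm_def using j \<open>0 < p\<close> \<open>0 < \<epsilon>\<close> by (subst eLp_norm_le_iff) auto
  qed
qed

text \<open>Approximate f by g in \<open>Linf_c\<close>, where T and T' agree. Then T f and T' f
  each differ from the common value by at most the operator applied to f - g, whose norm is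
  arbitrarily small.\<close>

lemma bounded_sublinear_extension_unique:
  fixes T T' :: "(real ^ 'n \<Rightarrow> real) \<Rightarrow> real ^ 'n \<Rightarrow> real"
  assumes T: "bounded_sublinear_extension p q S T" and T': "bounded_sublinear_extension p q S T'"
    and "1 \<le> p" "1 \<le> q" and f: "f \<in> Lp p"
  shows "AE x in gauss. T' f x = T f x"
proof -
  have sub: "sublinear_op (Lp p) T" "sublinear_op (Lp p) T'"
    and bd: "bounded_op p q (Lp p) T" "bounded_op p q (Lp p) T'"
    and ext: "\<And>f. f \<in> Linf_c \<Longrightarrow> AE x in gauss. S f x = ennreal (T f x)"
      "\<And>f. f \<in> Linf_c \<Longrightarrow> AE x in gauss. S f x = ennreal (T' f x)"
    using T T' by (auto simp: bounded_sublinear_extension_def)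
  obtain C C' :: real where C: "0 \<le> C" "\<And>f. f \<in> Lp p \<Longrightarrow> T f \<in> Lp q \<and> Lp_norm q (T f) \<le> ennreal C * Lp_norm p f"
    and C': "0 \<le> C'" "\<And>f. f \<in> Lp p \<Longrightarrow> T' f \<in> Lp q \<and> Lp_norm q (T' f) \<le> ennreal C' * Lp_norm p f"
    using bd unfolding bounded_op_def by metis
  have [measurable]: "T f \<in> borel_measurable borel" "T' f \<in> borel_measurable borel"
    using C(2)[OF f] C'(2)[OF f] by (auto simp: Lp_def)
  let ?I = "\<integral>\<^sup>+x. ennreal_powr (ennreal \<bar>T' f x - T f x\<bar>) q \<partial>gauss"
  have le: "?I \<le> ennreal (2 powr q * (2 * \<delta> powr q))" if "0 < \<delta>" for \<delta>
  proof -
    define \<epsilon> where "\<epsilon> = \<delta> / (C + C' + 1)"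
    have \<epsilon>: "0 < \<epsilon>" "C * \<epsilon> \<le> \<delta>" "C' * \<epsilon> \<le> \<delta>"
      using that C(1) C'(1) by (auto simp: \<epsilon>_def field_simps)
    obtain g where g: "g \<in> Linf_c" "Lp_norm p (\<lambda>x. f x - g x) \<le> ennreal \<epsilon>"
      using Lp_truncation[OF _ f \<epsilon>(1)] \<open>1 \<le> p\<close> by auto
    have gL: "g \<in> Lp p" using g Linf_c_subset_Lp[of p] \<open>1 \<le> p\<close> by auto
    define h where "h = (\<lambda>x. f x - g x)"
    have hL: "h \<in> Lp p"
      using Lp_add[OF \<open>1 \<le> p\<close> f Lp_cmult[OF _ gL, of "-1"]] \<open>1 \<le> p\<close> by (simp add: h_def)
    have [measurable]: "T h \<in> borel_measurable borel" "T' h \<in> borel_measurable borel"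
      using C(2)[OF hL] C'(2)[OF hL] by (auto simp: Lp_def)
    have "AE x in gauss. \<bar>T f x - T g x\<bar> \<le> T h x" "AE x in gauss. \<bar>T' f x - T' g x\<bar> \<le> T' h x"
      unfolding h_def using sub by (auto intro!: sublinear_op_diff_le[where p = p] f gL \<open>1 \<le> p\<close>)
    \<comment> \<open>Negative reals are mapped to 0 by \<open>ennreal\<close>, so agreement of the
      two extensions on g can be read off from \<open>S\<close> only because both are
      nonnegative.\<close>
    moreover have "AE x in gauss. 0 \<le> T g x" "AE x in gauss. 0 \<le> T' g x"
      by (intro sublinear_op_nonneg[of p] sub gL \<open>1 \<le> p\<close>)+
    ultimately have "AE x in gauss. \<bar>T' f x - T f x\<bar> \<le> \<bar>T' h x\<bar> + \<bar>T h x\<bar>"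
      using ext(1)[OF g(1)] ext(2)[OF g(1)]
    proof eventually_elim
      case (elim x)
      then have "T g x = T' g x" by simp
      then show ?case using elim(1,2) by linarith
    qed
    then have "?I \<le> (\<integral>\<^sup>+x. ennreal (2 powr q) * (ennreal_powr (ennreal \<bar>T' h x\<bar>) q + ennreal_powr (ennreal \<bar>T h x\<bar>) q) \<partial>gauss)"
    proof (intro nn_integral_mono_AE, eventually_elim)
      case (elim x)
      have "ennreal_powr (ennreal \<bar>T' f x - T f x\<bar>) q \<le> ennreal_powr (ennreal \<bar>T' h x\<bar> + ennreal \<bar>T h x\<bar>) q"
        using elim \<open>1 \<le> q\<close> by (intro ennreal_powr_mono) (auto simp: ennreal_plus[symmetric] intro!: ennreal_leI simp del: ennreal_plus)
      also have "\<dots> \<le> ennreal (2 powr q) * (ennreal_powr (ennreal \<bar>T' h x\<bar>) q + ennreal_powr (ennreal \<bar>T h x\<bar>) q)"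
        by (rule ennreal_powr_sum_le[OF \<open>1 \<le> q\<close>])
      finally show ?case .
    qed
    also have "\<dots> = ennreal (2 powr q) * (ennreal_powr (Lp_norm q (T' h)) q + ennreal_powr (Lp_norm q (T h)) q)"
      using \<open>1 \<le> q\<close> unfolding Lp_norm_def
      by (subst nn_integral_cmult, measurable, subst nn_integral_add, measurable) (simp add: nn_integral_powr_eq_eLp_norm[symmetric])
    also have "\<dots> \<le> ennreal (2 powr q) * (ennreal_powr (ennreal \<delta>) q + ennreal_powr (ennreal \<delta>) q)"
    proof (intro mult_left_mono add_mono ennreal_powr_mono)
      have "Lp_norm q (T h) \<le> ennreal C * ennreal \<epsilon>"
        using C(2)[OF hL] g(2) unfolding h_def[symmetric] by (meson mult_left_mono order_trans zero_le)
      also have "\<dots> \<le> ennreal \<delta>" using \<epsilon> C(1) by (simp add: ennreal_mult[symmetric] ennreal_leI)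
      finally show "Lp_norm q (T h) \<le> ennreal \<delta>" .
      have "Lp_norm q (T' h) \<le> ennreal C' * ennreal \<epsilon>"
        using C'(2)[OF hL] g(2) unfolding h_def[symmetric] by (meson mult_left_mono order_trans zero_le)
      also have "\<dots> \<le> ennreal \<delta>" using \<epsilon> C'(1) by (simp add: ennreal_mult[symmetric] ennreal_leI)
      finally show "Lp_norm q (T' h) \<le> ennreal \<delta>" .
    qed (use \<open>1 \<le> q\<close> in auto)
    also have "\<dots> = ennreal (2 powr q * (2 * \<delta> powr q))"
      using that by (simp add: ennreal_plus[symmetric] ennreal_mult[symmetric] del: ennreal_plus)
    finally show ?thesis .
  qed
  have "?I \<le> 0"
  proof (rule ennreal_le_epsilon)
    fix e :: real assume "0 < e"
    define \<delta> where "\<delta> = (e / (2 * 2 powr q)) powr (1 / q)"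
    have "0 < \<delta>" "2 powr q * (2 * \<delta> powr q) = e" using \<open>0 < e\<close> \<open>1 \<le> q\<close> by (auto simp: \<delta>_def powr_powr)
    then show "?I \<le> 0 + ennreal e" using le[of \<delta>] by simp
  qed
  then have "?I = 0" by simp
  then have "AE x in gauss. ennreal_powr (ennreal \<bar>T' f x - T f x\<bar>) q = 0"
    by (subst (asm) nn_integral_0_iff_AE) auto
  then show ?thesis by eventually_elim simp
qed

text \<open>The extension is given by the same integral: by the norm bound it is finite almost
  everywhere for every f in Lp, and where it is infinite \<open>enn2real\<close> gives the value
  0.\<close>

lemma abs_commutator_extension:
  fixes b :: "real ^ 'n \<Rightarrow> real"
  assumes b: "b \<in> borel_measurable borel" and semi: "bmo_seminorm b < \<infinity>" and "1 \<le> p" "1 \<le> q" "0 \<le> C"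
    and bound: "\<And>f. f \<in> borel_measurable borel \<Longrightarrow> Lp_norm p f < \<infinity> \<Longrightarrow>
      eLp_norm q (abs_commutator a \<beta> b f) \<le> ennreal C * bmo_seminorm b * Lp_norm p f"
  defines "T \<equiv> \<lambda>f x. enn2real (abs_commutator a \<beta> b f x)"
  shows "bounded_sublinear_extension p q (abs_commutator a \<beta> b) T"
    and "op_norm p q (Lp p) T \<le> ennreal C * bmo_seminorm b"
proof -
  have meas: "f \<in> borel_measurable borel" if "f \<in> Lp p" for f :: "real ^ 'n \<Rightarrow> real"
    using that by (simp add: Lp_def)
  have fin: "AE x in gauss. abs_commutator a \<beta> b f x < \<infinity>" if "f \<in> Lp p" for f
  proof (rule AE_finite_of_eLp_norm[of q])
    have "ennreal C * bmo_seminorm b * Lp_norm p f < \<infinity>"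
      using that semi by (simp add: Lp_def ennreal_mult_less_top)
    then show "eLp_norm q (abs_commutator a \<beta> b f) < \<infinity>"
      using bound[OF meas[OF that]] that by (auto simp: Lp_def intro: order_le_less_trans)
  qed (use \<open>1 \<le> q\<close> measurable_abs_commutator[OF b meas[OF that]] in auto)
  have eq: "AE x in gauss. abs_commutator a \<beta> b f x = ennreal (T f x)" if "f \<in> Lp p" for f
    using fin[OF that] by eventually_elim (simp add: T_def)
  have norm: "Lp_norm q (T f) \<le> ennreal C * bmo_seminorm b * Lp_norm p f" if "f \<in> Lp p" for f
  proof -
    have "AE x in gauss. ennreal \<bar>T f x\<bar> = abs_commutator a \<beta> b f x"
      using eq[OF that] by eventually_elim (simp add: T_def)
    then have "Lp_norm q (T f) = eLp_norm q (abs_commutator a \<beta> b f)"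
      unfolding Lp_norm_def by (rule eLp_norm_cong_AE)
    then show ?thesis using bound[OF meas[OF that]] that by (simp add: Lp_def)
  qed
  have "sublinear_op (Lp p) T"
    unfolding sublinear_op_def
  proof (intro conjI ballI allI)
    fix f g :: "real ^ 'n \<Rightarrow> real" assume f: "f \<in> Lp p" and g: "g \<in> Lp p"
    show "AE x in gauss. T (\<lambda>y. f y + g y) x \<le> T f x + T g x"
      using fin[OF f] fin[OF g]
    proof eventually_elim
      case (elim x)
      have "enn2real (abs_commutator a \<beta> b (\<lambda>y. f y + g y) x) \<le> enn2real (abs_commutator a \<beta> b f x + abs_commutator a \<beta> b g x)"
        using elim by (intro enn2real_mono abs_commutator_add_le b meas f g) auto
      then show ?case using elim by (simp add: T_def enn2real_plus)
    qed
  next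
    fix f :: "real ^ 'n \<Rightarrow> real" and c assume f: "f \<in> Lp p"
    have "abs_commutator a \<beta> b (\<lambda>y. c * f y) x = ennreal \<bar>c\<bar> * abs_commutator a \<beta> b f x" for x
      using abs_commutator_divide[OF b meas[OF f], of 1] by simp
    then show "AE x in gauss. T (\<lambda>y. c * f y) x = \<bar>c\<bar> * T f x"
      by (simp add: T_def enn2real_mult)
  qed
  moreover have "bounded_op p q (Lp p) T"
    unfolding bounded_op_def
  proof (intro exI[of _ "C * enn2real (bmo_seminorm b)"] conjI ballI)
    fix f :: "real ^ 'n \<Rightarrow> real" assume f: "f \<in> Lp p"
    have *: "ennreal (C * enn2real (bmo_seminorm b)) = ennreal C * bmo_seminorm b"
      using semi \<open>0 \<le> C\<close> by (simp add: ennreal_mult)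
    show 1: "Lp_norm q (T f) \<le> ennreal (C * enn2real (bmo_seminorm b)) * Lp_norm p f"
      unfolding * by (rule norm[OF f])
    have "Lp_norm q (T f) < \<infinity>"
      using 1 f by (rule_tac order_le_less_trans) (auto simp: Lp_def ennreal_mult_less_top)
    then show "T f \<in> Lp q"
      using measurable_abs_commutator[OF b meas[OF f]] by (simp add: Lp_def T_def)
  qed (use \<open>0 \<le> C\<close> in simp)
  ultimately show "bounded_sublinear_extension p q (abs_commutator a \<beta> b) T"
    unfolding bounded_sublinear_extension_def
    using eq Linf_c_subset_Lp[of p] \<open>1 \<le> p\<close> by auto
  show "op_norm p q (Lp p) T \<le> ennreal C * bmo_seminorm b"
    unfolding op_norm_def
  proof (rule SUP_least)
    fix f :: "real ^ 'n \<Rightarrow> real" assume "f \<in> {f \<in> Lp p. Lp_norm p f = 1}"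
    then show "Lp_norm q (T f) \<le> ennreal C * bmo_seminorm b" using norm[of f] by simp
  qed
qed

section \<open>Necessity of BMO\<close>

text \<open>The singularity is of order n (1 - \<beta>) < n. Shells are enlarged to balls whose
  volumes halve from one to the next; the kernel grows by at most 2 powr (1 - \<beta>), so the
  series has ratio 2 powr - \<beta>.\<close>

lemma riesz_kernel_integrable:
  fixes \<beta> R :: real
  assumes "0 < \<beta>" "\<beta> < 1" "0 < R"
  obtains K :: real where "0 \<le> K"
    "\<And>x :: real ^ 'n. (\<integral>\<^sup>+y\<in>ball x R. ennreal (1 / (norm (x - y) ^ CARD('n)) powr (1 - \<beta>)) \<partial>lborel) \<le> ennreal K"
proof -
  let ?n = "CARD('n)" and ?v = "vball TYPE('n)"
  define \<rho> where "\<rho> = (2 powr - \<beta> :: real)"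
  have "2 powr - \<beta> < (2 powr 0 :: real)" using \<open>0 < \<beta>\<close> by (subst powr_less_cancel_iff) auto
  then have \<rho>: "0 < \<rho>" "\<rho> < 1" by (simp_all add: \<rho>_def)
  define c where "c = (2 / R ^ ?n) powr (1 - \<beta>)"
  define rad where "rad k = R * 2 powr (- (real k / real ?n))" for k :: nat
  have rad: "0 < rad k" "rad k ^ ?n = R ^ ?n * 2 powr - real k" for k
  proof -
    show "0 < rad k" using \<open>0 < R\<close> by (simp add: rad_def)
    have "(2 powr (- (real k / real ?n))) ^ ?n = (2 :: real) powr (- (real k / real ?n) * real ?n)"
      by (simp add: powr_realpow[symmetric] powr_powr)
    then show "rad k ^ ?n = R ^ ?n * 2 powr - real k" by (simp add: rad_def power_mult_distrib)
  qed
  define K where "K = c * ?v * R ^ ?n * (1 / (1 - \<rho>))"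
  show ?thesis
  proof (rule that[of K])
    show "0 \<le> K" using \<rho> \<open>0 < R\<close> by (simp add: K_def c_def)
    fix x :: "real ^ 'n"
    let ?S = "\<lambda>k y. ennreal (c * 2 powr (real k * (1 - \<beta>))) * indicator (ball x (rad k)) y"
    have pt: "ennreal (1 / (norm (x - y) ^ ?n) powr (1 - \<beta>)) * indicator (ball x R) y \<le> (\<Sum>k. ?S k y)" for y
    \<comment> \<open>At y = x the kernel has the value 0, because 1 / 0 = 0.\<close>
    proof (cases "y \<in> ball x R \<and> y \<noteq> x")
      case True
      then have xy: "0 < norm (x - y)" "norm (x - y) < R" by (auto simp: dist_norm)
      define \<tau> where "\<tau> = norm (x - y) ^ ?n / R ^ ?n"
      have "norm (x - y) ^ ?n < R ^ ?n" using xy by (intro power_strict_mono) auto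
      then have "0 < \<tau>" "\<tau> < 1" using xy \<open>0 < R\<close> by (auto simp: \<tau>_def)
      then obtain k where k: "(1 / 2) ^ Suc k \<le> \<tau>" "\<tau> < (1 / 2) ^ k" by (rule dyadic_scale_exists)
      have pw: "(1 / 2 :: real) ^ k = 2 powr - real k" by (simp add: powr_minus powr_realpow power_one_over inverse_eq_divide)
      have "norm (x - y) ^ ?n = \<tau> * R ^ ?n" using \<open>0 < R\<close> by (simp add: \<tau>_def)
      also have "\<dots> < (1 / 2) ^ k * R ^ ?n" using k(2) \<open>0 < R\<close> by (intro mult_strict_right_mono) auto
      also have "\<dots> = rad k ^ ?n" unfolding rad(2) pw by (rule mult.commute)
      finally have "norm (x - y) ^ ?n < rad k ^ ?n" .
      then have "norm (x - y) < rad k" by (rule power_less_imp_less_base) (rule less_imp_le[OF rad(1)])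
      then have yk: "y \<in> ball x (rad k)" by (simp add: dist_norm)
      have low: "0 < R ^ ?n / 2 * (1 / 2) ^ k" using \<open>0 < R\<close> by simp
      have "R ^ ?n / 2 * (1 / 2) ^ k \<le> norm (x - y) ^ ?n"
        using k(1) \<open>0 < R\<close> by (simp add: \<tau>_def field_simps)
      then have "1 / (norm (x - y) ^ ?n) powr (1 - \<beta>) \<le> 1 / (R ^ ?n / 2 * (1 / 2) ^ k) powr (1 - \<beta>)"
        using low assms by (intro one_over_powr_antimono) auto
      also have "\<dots> = (1 / (R ^ ?n / 2 * (1 / 2) ^ k)) powr (1 - \<beta>)" by (simp add: powr_divide)
      also have "1 / (R ^ ?n / 2 * (1 / 2) ^ k) = 2 / R ^ ?n * 2 powr real k"
        by (simp add: powr_realpow power_divide)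
      also have "\<dots> powr (1 - \<beta>) = c * 2 powr (real k * (1 - \<beta>))"
        by (simp only: powr_mult c_def powr_powr)
      finally have "ennreal (1 / (norm (x - y) ^ ?n) powr (1 - \<beta>)) \<le> ?S k y"
        using yk by (simp add: ennreal_leI)
      also have "\<dots> \<le> (\<Sum>k. ?S k y)" by (rule ennreal_le_suminf)
      finally show ?thesis using True by simp
    qed (auto simp: indicator_def zero_power[OF zero_less_card_finite])
    have "(\<integral>\<^sup>+y\<in>ball x R. ennreal (1 / (norm (x - y) ^ ?n) powr (1 - \<beta>)) \<partial>lborel) \<le> (\<integral>\<^sup>+y. (\<Sum>k. ?S k y) \<partial>lborel)"
      by (intro nn_integral_mono pt)
    also have "\<dots> = (\<Sum>k. \<integral>\<^sup>+y. ?S k y \<partial>lborel)"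
      by (intro nn_integral_suminf) measurable
    also have "\<dots> = (\<Sum>k. ennreal (c * ?v * R ^ ?n * \<rho> ^ k))"
    proof (intro suminf_cong)
      fix k
      have "(\<integral>\<^sup>+y. ?S k y \<partial>lborel) = ennreal (c * 2 powr (real k * (1 - \<beta>))) * emeasure lborel (ball x (rad k))"
        by (intro nn_integral_cmult_indicator) simp
      also have "\<dots> = ennreal (c * 2 powr (real k * (1 - \<beta>)) * (?v * (R ^ ?n * 2 powr - real k)))"
        using rad(1)[of k] \<open>0 < R\<close> by (simp add: emeasure_lborel_ball rad(2) ennreal_mult[symmetric] c_def)
      also have "c * 2 powr (real k * (1 - \<beta>)) * (?v * (R ^ ?n * 2 powr - real k)) = c * ?v * R ^ ?n * (2 powr (real k * (1 - \<beta>)) * 2 powr - real k)"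
        by (simp only: mult_ac)
      also have "2 powr (real k * (1 - \<beta>)) * 2 powr - real k = \<rho> powr real k"
        by (simp add: \<rho>_def powr_powr powr_add[symmetric] algebra_simps)
      also have "\<rho> powr real k = \<rho> ^ k" using \<rho> by (simp add: powr_realpow)
      finally show "(\<integral>\<^sup>+y. ?S k y \<partial>lborel) = ennreal (c * ?v * R ^ ?n * \<rho> ^ k)" .
    qed
    also have "\<dots> = ennreal K"
    proof -
      have "(\<lambda>k. c * ?v * R ^ ?n * \<rho> ^ k) sums K"
        unfolding K_def using \<rho> by (intro sums_mult geometric_sums) simp
      moreover have "0 \<le> c * ?v * R ^ ?n * \<rho> ^ k" for k using \<rho> \<open>0 < R\<close> by (simp add: c_def)
      ultimately show ?thesis
        by (intro sums_unique[symmetric]) (subst sums_ennreal, auto simp: K_def c_def \<rho> less_imp_le \<open>0 < R\<close>)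
    qed
    finally show "(\<integral>\<^sup>+y\<in>ball x R. ennreal (1 / (norm (x - y) ^ ?n) powr (1 - \<beta>)) \<partial>lborel) \<le> ennreal K" .
  qed
qed

text \<open>Tonelli's theorem and the symmetry of the kernel: the integral over x is bounded
  independently of y, and b is integrable. Without this, \<open>frac_int\<close> applied to b times
  an indicator might be the default value 0 of a divergent integral.\<close>

lemma AE_riesz_potential_finite:
  fixes b :: "real ^ 'n \<Rightarrow> real"
  assumes "0 < \<beta>" "\<beta> < 1" and b: "b \<in> Lp 1" and Q [measurable]: "Q \<in> sets borel" and "0 < R"
    and diam: "\<And>x y. x \<in> Q \<Longrightarrow> y \<in> Q \<Longrightarrow> norm (x - y) < R"
  shows "AE x in lborel. x \<in> Q \<longrightarrow>
    (\<integral>\<^sup>+y\<in>Q. ennreal (\<bar>b y\<bar> * (1 / (norm (x - y) ^ CARD('n)) powr (1 - \<beta>))) \<partial>gauss) < \<infinity>"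
proof -
  let ?k = "\<lambda>x y. 1 / (norm (x - y) ^ CARD('n)) powr (1 - \<beta>)"
  have [measurable]: "b \<in> borel_measurable borel" using b by (simp add: Lp_def)
  interpret g: sigma_finite_measure "gauss :: (real ^ 'n) measure" by (rule sigma_finite_gauss)
  interpret pair_sigma_finite "gauss :: (real ^ 'n) measure" "lborel :: (real ^ 'n) measure" ..
  obtain K :: real where "0 \<le> K" and K: "\<And>x :: real ^ 'n. (\<integral>\<^sup>+y\<in>ball x R. ennreal (?k x y) \<partial>lborel) \<le> ennreal K"
    using riesz_kernel_integrable[OF assms(1,2) \<open>0 < R\<close>, where 'n='n] by blast
  let ?I = "\<lambda>x. \<integral>\<^sup>+y. ennreal (\<bar>b y\<bar> * ?k x y) * indicator Q y \<partial>gauss"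
  have "(\<integral>\<^sup>+x. ?I x * indicator Q x \<partial>lborel) = (\<integral>\<^sup>+x. \<integral>\<^sup>+y. ennreal (\<bar>b y\<bar> * ?k x y) * indicator Q y * indicator Q x \<partial>gauss \<partial>lborel)"
    by (intro nn_integral_cong nn_integral_multc[symmetric]) measurable
  also have "\<dots> = (\<integral>\<^sup>+y. \<integral>\<^sup>+x. ennreal (\<bar>b y\<bar> * ?k x y) * indicator Q y * indicator Q x \<partial>lborel \<partial>gauss)"
    by (rule Fubini') measurable
  also have "\<dots> \<le> (\<integral>\<^sup>+y. ennreal \<bar>b y\<bar> * ennreal K \<partial>gauss)"
  proof (intro nn_integral_mono)
    fix y
    have "(\<integral>\<^sup>+x. ennreal (\<bar>b y\<bar> * ?k x y) * indicator Q y * indicator Q x \<partial>lborel)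
      \<le> (\<integral>\<^sup>+x. ennreal \<bar>b y\<bar> * (ennreal (?k y x) * indicator (ball y R) x) \<partial>lborel)"
      using diam by (intro nn_integral_mono)
        (auto simp: indicator_def ennreal_mult[symmetric] norm_minus_commute dist_norm)
    also have "\<dots> = ennreal \<bar>b y\<bar> * (\<integral>\<^sup>+x\<in>ball y R. ennreal (?k y x) \<partial>lborel)"
      by (intro nn_integral_cmult) measurable
    also have "\<dots> \<le> ennreal \<bar>b y\<bar> * ennreal K" by (intro mult_left_mono K) auto
    finally show "(\<integral>\<^sup>+x. ennreal (\<bar>b y\<bar> * ?k x y) * indicator Q y * indicator Q x \<partial>lborel) \<le> ennreal \<bar>b y\<bar> * ennreal K" .
  qed
  also have "\<dots> = (\<integral>\<^sup>+y. ennreal \<bar>b y\<bar> \<partial>gauss) * ennreal K" by (intro nn_integral_multc) measurable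
  also have "\<dots> < \<infinity>" using b by (simp add: Lp_def Lp_norm_def eLp_norm_def ennreal_mult_less_top)
  finally have "(\<integral>\<^sup>+x. ?I x * indicator Q x \<partial>lborel) \<noteq> \<infinity>" by simp
  then have "AE x in lborel. ?I x * indicator Q x \<noteq> \<infinity>"
    by (intro nn_integral_PInf_AE) measurable
  then show ?thesis by eventually_elim (auto simp: less_top)
qed

text \<open>The median is the supremum of all t with at most half of the mass where b < t.
  Continuity of the measure along m - 1 / (j + 1) and m + 1 / (j + 1) gives the two inequalities,
  and along the integers that the supremum is over a nonempty bounded set.\<close>

lemma (in finite_measure) median_exists:
  fixes b :: "'a \<Rightarrow> real"
  assumes [measurable]: "b \<in> borel_measurable M"
  obtains m where "measure M (space M) / 2 \<le> measure M {x \<in> space M. m \<le> b x}"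
    "measure M (space M) / 2 \<le> measure M {x \<in> space M. b x \<le> m}"
proof (cases "measure M (space M) = 0")
  case True
  then show ?thesis using that[of 0] by simp
next
  case False
  then have pos: "0 < measure M (space M)" by (simp add: zero_less_measure_iff)
  let ?h = "measure M (space M) / 2"
  define F where "F t = measure M {x \<in> space M. b x < t}" for t
  have mono: "F s \<le> F t" if "s \<le> t" for s t
    unfolding F_def using that by (intro finite_measure_mono) auto
  define S where "S = {t. F t \<le> ?h}"
  have "(\<lambda>j. F (real j)) \<longlonglongrightarrow> measure M (\<Union>j. {x \<in> space M. b x < real j})"
    unfolding F_def by (intro finite_Lim_measure_incseq) (auto simp: incseq_def intro: order_less_le_trans)
  moreover have "(\<Union>j. {x \<in> space M. b x < real j}) = space M" using reals_Archimedean2 by auto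
  ultimately have "eventually (\<lambda>j. ?h < F (real j)) sequentially"
    using pos by (intro order_tendstoD(1)) auto
  then obtain j where j: "?h < F (real j)" by (auto simp: eventually_sequentially)
  have bdd: "t \<le> real j" if "t \<in> S" for t
  proof (rule ccontr)
    assume "\<not> t \<le> real j"
    then have "F (real j) \<le> F t" by (intro mono) simp
    then show False using that j by (simp add: S_def)
  qed
  then have bdd': "bdd_above S" by (auto simp: bdd_above_def)
  have "(\<lambda>j. F (- real j)) \<longlonglongrightarrow> measure M (\<Inter>j. {x \<in> space M. b x < - real j})"
    unfolding F_def by (intro finite_Lim_measure_decseq) (auto simp: decseq_def intro: order_less_le_trans)
  moreover have "(\<Inter>j. {x \<in> space M. b x < - real j}) = {}"
  proof -
    have "\<exists>j. \<not> b x < - real j" for x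
    proof -
      obtain n where "- b x < real n" using reals_Archimedean2 by blast
      then have "\<not> b x < - real n" by linarith
      then show ?thesis by blast
    qed
    then show ?thesis by auto
  qed
  ultimately have "eventually (\<lambda>j. F (- real j) < ?h) sequentially"
    using pos by (intro order_tendstoD(2)) auto
  then obtain i where "F (- real i) < ?h" by (auto simp: eventually_sequentially)
  then have ne: "S \<noteq> {}" by (auto simp: S_def intro: less_imp_le)
  define m where "m = Sup S"
  have low: "F t \<le> ?h" if "t < m" for t
  proof -
    obtain s where "s \<in> S" "t < s" using \<open>t < m\<close> less_cSup_iff[OF ne bdd', of t] by (auto simp: m_def)
    then show ?thesis using mono[of t s] by (simp add: S_def)
  qed
  have high: "?h < F t" if "m < t" for t
  proof (rule ccontr)
    assume "\<not> ?h < F t"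
    then have "t \<in> S" by (simp add: S_def)
    then show False using cSup_upper[OF _ bdd', of t] that by (simp add: m_def)
  qed
  have "(\<lambda>j. F (m - inverse (real (Suc j)))) \<longlonglongrightarrow> measure M (\<Union>j. {x \<in> space M. b x < m - inverse (real (Suc j))})"
    unfolding F_def
  proof (intro finite_Lim_measure_incseq)
    show "incseq (\<lambda>j. {x \<in> space M. b x < m - inverse (real (Suc j))})"
    proof (rule incseq_SucI, safe)
      fix n x assume "b x < m - inverse (real (Suc n))"
      moreover have "inverse (real (Suc (Suc n))) \<le> inverse (real (Suc n))" by (intro le_imp_inverse_le) auto
      ultimately show "b x < m - inverse (real (Suc (Suc n)))" by linarith
    qed
  qed auto
  moreover have "(\<Union>j. {x \<in> space M. b x < m - inverse (real (Suc j))}) = {x \<in> space M. b x < m}"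
  proof safe
    fix x n assume "b x < m - inverse (real (Suc n))"
    moreover have "0 < inverse (real (Suc n))" by simp
    ultimately show "b x < m" by linarith
  next
    fix x assume x: "x \<in> space M" "b x < m"
    then obtain n where "inverse (real (Suc n)) < m - b x" using reals_Archimedean[of "m - b x"] by auto
    then have "b x < m - inverse (real (Suc n))" by linarith
    then show "x \<in> (\<Union>j. {x \<in> space M. b x < m - inverse (real (Suc j))})" using x by blast
  qed
  ultimately have "(\<lambda>j. F (m - inverse (real (Suc j)))) \<longlonglongrightarrow> F m" by (simp only: F_def[of m])
  moreover have "F (m - inverse (real (Suc j))) \<le> ?h" for j by (rule low) simp
  ultimately have "F m \<le> ?h" by (intro LIMSEQ_le_const2) blast+
  moreover have "measure M {x \<in> space M. m \<le> b x} = measure M (space M) - F m"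
  proof -
    have "{x \<in> space M. m \<le> b x} = space M - {x \<in> space M. b x < m}" by auto
    then show ?thesis unfolding F_def by (simp add: finite_measure_compl)
  qed
  ultimately have 1: "?h \<le> measure M {x \<in> space M. m \<le> b x}" by simp
  have "(\<lambda>j. F (m + inverse (real (Suc j)))) \<longlonglongrightarrow> measure M (\<Inter>j. {x \<in> space M. b x < m + inverse (real (Suc j))})"
    unfolding F_def
  proof (intro finite_Lim_measure_decseq)
    show "decseq (\<lambda>j. {x \<in> space M. b x < m + inverse (real (Suc j))})"
    proof (rule decseq_SucI, safe)
      fix n x assume "b x < m + inverse (real (Suc (Suc n)))"
      moreover have "inverse (real (Suc (Suc n))) \<le> inverse (real (Suc n))" by (intro le_imp_inverse_le) auto
      ultimately show "b x < m + inverse (real (Suc n))" by linarith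
    qed
  qed auto
  moreover have "(\<Inter>j. {x \<in> space M. b x < m + inverse (real (Suc j))}) = {x \<in> space M. b x \<le> m}"
  proof safe
    fix x assume x: "x \<in> (\<Inter>j. {x \<in> space M. b x < m + inverse (real (Suc j))})"
    show "b x \<le> m"
    proof (rule ccontr)
      assume "\<not> b x \<le> m"
      then obtain n where "inverse (real (Suc n)) < b x - m" using reals_Archimedean[of "b x - m"] by auto
      moreover have "b x < m + inverse (real (Suc n))" using x by blast
      ultimately show False by linarith
    qed
  next
    fix x n assume "b x \<le> m"
    moreover have "0 < inverse (real (Suc n))" by simp
    ultimately show "b x < m + inverse (real (Suc n))" by linarith
  qed auto
  ultimately have "(\<lambda>j. F (m + inverse (real (Suc j)))) \<longlonglongrightarrow> measure M {x \<in> space M. b x \<le> m}"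
    by (simp only:)
  moreover have "?h \<le> F (m + inverse (real (Suc j)))" for j by (rule less_imp_le[OF high]) simp
  ultimately have 2: "?h \<le> measure M {x \<in> space M. b x \<le> m}" by (intro LIMSEQ_le_const) blast+
  show ?thesis using 1 2 by (rule that)
qed

lemma median_on_cube:
  fixes b :: "real ^ 'n \<Rightarrow> real"
  assumes [measurable]: "b \<in> borel_measurable borel" and "0 < l"
  obtains m where "ennreal (l ^ CARD('n) / 2) \<le> emeasure lborel {x \<in> cube c l. m \<le> b x}"
    "ennreal (l ^ CARD('n) / 2) \<le> emeasure lborel {x \<in> cube c l. b x \<le> m}"
proof -
  let ?M = "restrict_space lborel (cube c l)"
  have em: "emeasure ?M A = emeasure lborel A" if "A \<subseteq> cube c l" for A
    using that by (intro emeasure_restrict_space) auto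
  have sp: "space ?M = cube c l" by (simp add: space_restrict_space)
  interpret finite_measure ?M
    using \<open>0 < l\<close> by (intro finite_measureI) (simp add: sp em emeasure_cube)
  have b: "b \<in> borel_measurable ?M" by (intro measurable_restrict_space1) simp
  have half: "measure ?M (cube c l) = l ^ CARD('n)"
    using \<open>0 < l\<close> unfolding measure_def em[OF order_refl] by (simp add: emeasure_cube)
  obtain m where m: "l ^ CARD('n) / 2 \<le> measure ?M {x \<in> cube c l. m \<le> b x}"
    "l ^ CARD('n) / 2 \<le> measure ?M {x \<in> cube c l. b x \<le> m}"
    by (rule median_exists[OF b, unfolded sp half])
  have eq: "ennreal (measure ?M A) = emeasure lborel A" if "A \<subseteq> cube c l" for A
    using em[OF that] by (simp only: emeasure_eq_measure[symmetric])
  show ?thesis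
  proof (rule that[of m])
    show "ennreal (l ^ CARD('n) / 2) \<le> emeasure lborel {x \<in> cube c l. m \<le> b x}"
      using ennreal_leI[OF m(1)] by (subst (asm) eq) auto
    show "ennreal (l ^ CARD('n) / 2) \<le> emeasure lborel {x \<in> cube c l. b x \<le> m}"
      using ennreal_leI[OF m(2)] by (subst (asm) eq) auto
  qed
qed

section \<open>Testing the commutator on indicator functions\<close>

lemma norm_diff_cube_le:
  fixes x y c :: "real ^ 'n"
  assumes "x \<in> cube c l" "y \<in> cube c l"
  shows "norm (x - y) \<le> real CARD('n) * l"
proof (rule norm_le_card_mult)
  fix i show "\<bar>(x - y) $ i\<bar> \<le> l"
    using assms[unfolded cube_def, simplified, rule_format, of i]
    unfolding vector_minus_component by linarith
qed

lemma integrable_Lp_1: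
  fixes b :: "real ^ 'n \<Rightarrow> real"
  assumes "b \<in> Lp 1"
  shows "integrable gauss b"
  using assms by (auto simp: Lp_def Lp_norm_def eLp_norm_def integrable_iff_bounded)

text \<open>The kernel of \<open>frac_int\<close> is positive, so testing on sets where \<open>b\<close> lies on opposite sides of \<open>m\<close>
  involves no cancellation.\<close>

lemma commutator_indicator_ge:
  fixes b :: "real ^ 'n \<Rightarrow> real" and a \<beta> \<mu> l :: real
  assumes "0 < \<beta>" "\<beta> < 1" and b: "b \<in> Lp 1" and "0 < l"
    and ball: "\<And>x y. x \<in> cube c l \<Longrightarrow> y \<in> cube c l \<Longrightarrow> y \<in> ball x (a * admissible x)"
    and W: "\<And>x. x \<in> cube c l \<Longrightarrow> wt x \<le> W"
    and F [measurable]: "F \<in> sets borel" and FQ: "F \<subseteq> cube c l" and EQ: "E \<subseteq> cube c l"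
    and bE: "\<And>x. x \<in> E \<Longrightarrow> \<mu> \<le> b x" and bF: "\<And>x. x \<in> F \<Longrightarrow> b x \<le> \<mu>"
  shows "AE x in gauss. x \<in> E \<longrightarrow>
    (b x - \<mu>) * (1 / (W * (real CARD('n) * l) ^ CARD('n)) powr (1 - \<beta>) * measure gauss F) \<le> commutator a \<beta> b (indicator F) x"
proof -
  let ?n = "CARD('n)"
  let ?k0 = "\<lambda>x y :: real ^ 'n. 1 / (norm (x - y) ^ ?n) powr (1 - \<beta>)"
  let ?kmin = "1 / (W * (real ?n * l) ^ ?n) powr (1 - \<beta>)"
  have [measurable]: "b \<in> borel_measurable borel" using b by (simp add: Lp_def)
  have fQ: "emeasure gauss (cube c l) < \<infinity>"
  proof (rule emeasure_gauss_finite)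
    show "bounded (cube c l)"
      using norm_diff_cube_le[of _ c l c] corner_in_cube[OF \<open>0 < l\<close>, of c]
      by (auto simp: bounded_def dist_norm norm_minus_commute intro!: exI[of _ c] exI[of _ "real ?n * l"])
  qed simp
  have fF: "emeasure gauss F < \<infinity>"
    by (rule order_le_less_trans[OF emeasure_mono[OF FQ] fQ]) simp
  have iQ: "(indicator (cube c l) :: _ \<Rightarrow> real) \<in> Lp 1"
  proof -
    have "(\<integral>\<^sup>+x. ennreal \<bar>indicator (cube c l) x\<bar> \<partial>gauss) = emeasure gauss (cube c l)"
    proof -
      have "(\<integral>\<^sup>+x. ennreal \<bar>indicator (cube c l) x\<bar> \<partial>gauss) = (\<integral>\<^sup>+x. indicator (cube c l) x \<partial>gauss)"
        by (intro nn_integral_cong) (auto simp: indicator_def)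
      then show ?thesis by simp
    qed
    then show ?thesis using fQ by (simp add: Lp_def Lp_norm_def eLp_norm_def)
  qed
  have diam: "norm (x - y) < real ?n * l + 1" if "x \<in> cube c l" "y \<in> cube c l" for x y
    using norm_diff_cube_le[OF that] by simp
  have R: "0 < real ?n * l + 1" using \<open>0 < l\<close> by (simp add: add_pos_pos)
  have fin: "AE x in gauss. x \<in> cube c l \<longrightarrow> (\<integral>\<^sup>+y\<in>cube c l. ennreal (\<bar>h y\<bar> * ?k0 x y) \<partial>gauss) < \<infinity>" if "h \<in> Lp 1" for h
    unfolding AE_gauss_iff by (rule AE_riesz_potential_finite[OF assms(1,2) that _ R diam]) auto
  \<comment> \<open>At almost every x both integrals of the commutator converge: that of the kernel
    and that of b times the kernel.\<close>
  show ?thesis using fin[OF b] fin[OF iQ]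
  proof eventually_elim
    case (elim x)
    show ?case
    proof
      assume xE: "x \<in> E"
      then have xQ: "x \<in> cube c l" using EQ by auto
      define k where "k y = 1 / (exp (- (norm x)\<^sup>2) * norm (x - y) ^ ?n) powr (1 - \<beta>)" for y
      have [measurable]: "k \<in> borel_measurable borel" unfolding k_def by measurable
      have k_nonneg: "0 \<le> k y" for y by (simp add: k_def)
      have k_eq: "k y = 1 / wt x powr (1 - \<beta>) * ?k0 x y" for y
        by (simp add: k_def wt_def powr_mult)
      have k_ge: "?kmin \<le> k y" if "y \<in> F" "y \<noteq> x" for y
      proof -
        have "norm (x - y) \<le> real ?n * l" using that FQ xQ by (intro norm_diff_cube_le) auto
        then have "wt x * norm (x - y) ^ ?n \<le> W * (real ?n * l) ^ ?n"
          using W[OF xQ] wt_pos[of x] by (intro mult_mono power_mono) (auto simp del: wt_pos)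
        moreover have "0 < wt x * norm (x - y) ^ ?n" using that by simp
        ultimately have "1 / (W * (real ?n * l) ^ ?n) powr (1 - \<beta>) \<le> 1 / (wt x * norm (x - y) ^ ?n) powr (1 - \<beta>)"
          using \<open>\<beta> < 1\<close> by (intro one_over_powr_antimono) auto
        then show ?thesis by (simp add: k_def wt_def)
      qed
      have int: "integrable gauss (\<lambda>y. h y * (indicator F y * k y))"
        if [measurable]: "h \<in> borel_measurable borel" and h: "(\<integral>\<^sup>+y\<in>cube c l. ennreal (\<bar>h y\<bar> * ?k0 x y) \<partial>gauss) < \<infinity>" for h
      proof (rule integrableI_bounded)
        have "(\<integral>\<^sup>+y. ennreal (norm (h y * (indicator F y * k y))) \<partial>gauss)
          \<le> (\<integral>\<^sup>+y. ennreal (1 / wt x powr (1 - \<beta>)) * (ennreal (\<bar>h y\<bar> * ?k0 x y) * indicator (cube c l) y) \<partial>gauss)"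
          using FQ by (intro nn_integral_mono) (auto simp: indicator_def k_eq abs_mult ennreal_mult[symmetric])
        also have "\<dots> = ennreal (1 / wt x powr (1 - \<beta>)) * (\<integral>\<^sup>+y\<in>cube c l. ennreal (\<bar>h y\<bar> * ?k0 x y) \<partial>gauss)"
          by (intro nn_integral_cmult) measurable
        also have "\<dots> < \<infinity>" using h by (simp add: ennreal_mult_less_top)
        finally show "(\<integral>\<^sup>+y. ennreal (norm (h y * (indicator F y * k y))) \<partial>gauss) < \<infinity>" .
      qed measurable
      have frac: "frac_int a \<beta> (\<lambda>y. h y * indicator F y) x = (LINT y|gauss. h y * (indicator F y * k y))" for h
        unfolding frac_int_def set_lebesgue_integral_def
      proof (intro Bochner_Integration.integral_cong refl)
        fix y
        show "indicator (ball x (a * admissible x)) y *\<^sub>R (h y * indicator F y / (exp (- (norm x)\<^sup>2) * norm (x - y) ^ ?n) powr (1 - \<beta>))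
          = h y * (indicator F y * k y)"
          using ball[OF xQ, of y] FQ by (auto simp: indicator_def k_def)
      qed
      have I1: "integrable gauss (\<lambda>y. 1 * (indicator F y * k y))"
      proof (rule int)
        have "(\<integral>\<^sup>+y\<in>cube c l. ennreal (\<bar>1\<bar> * ?k0 x y) \<partial>gauss) = (\<integral>\<^sup>+y\<in>cube c l. ennreal (\<bar>indicator (cube c l) y\<bar> * ?k0 x y) \<partial>gauss)"
          by (intro nn_integral_cong) (auto simp: indicator_def)
        then show "(\<integral>\<^sup>+y\<in>cube c l. ennreal (\<bar>1\<bar> * ?k0 x y) \<partial>gauss) < \<infinity>" using elim xQ by simp
      qed measurable
      have I2: "integrable gauss (\<lambda>y. b y * (indicator F y * k y))"
        using elim xQ by (intro int) auto
      have "frac_int a \<beta> (indicator F) x = (LINT y|gauss. 1 * (indicator F y * k y))"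
        using frac[of "\<lambda>_. 1"] by simp
      then have "commutator a \<beta> b (indicator F) x
        = b x * (LINT y|gauss. 1 * (indicator F y * k y)) - (LINT y|gauss. b y * (indicator F y * k y))"
        using frac[of b] by (simp only: commutator_def)
      also have "\<dots> = (LINT y|gauss. b x * (1 * (indicator F y * k y)) - b y * (indicator F y * k y))"
        using I1 I2 by (subst Bochner_Integration.integral_diff) auto
      finally have comm: "commutator a \<beta> b (indicator F) x
        = (LINT y|gauss. b x * (1 * (indicator F y * k y)) - b y * (indicator F y * k y))" .
      have "(LINT y|gauss. (b x - \<mu>) * ?kmin * indicator F y)
        \<le> (LINT y|gauss. b x * (1 * (indicator F y * k y)) - b y * (indicator F y * k y))"
      proof (rule integral_mono)
        show "integrable gauss (\<lambda>y. (b x - \<mu>) * ?kmin * indicator F y)"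
          using fF by (intro integrable_mult_right) auto
        show "integrable gauss (\<lambda>y. b x * (1 * (indicator F y * k y)) - b y * (indicator F y * k y))"
          using I1 I2 by (intro Bochner_Integration.integrable_diff integrable_mult_right) auto
        fix y
        show "(b x - \<mu>) * ?kmin * indicator F y \<le> b x * (1 * (indicator F y * k y)) - b y * (indicator F y * k y)"
        proof (cases "y \<in> F")
          case True
          have "(b x - \<mu>) * ?kmin \<le> (b x - b y) * k y"
          proof (cases "y = x")
            case True
            \<comment> \<open>A point in both sets has b x = \<mu>, so both sides vanish and the
              conventional value of the kernel at its singularity does not matter.\<close>
            then have "b x = \<mu>" using \<open>y \<in> F\<close> bE[OF xE] bF[of x] by auto
            then show ?thesis using True by simp
          next
            case False
            have "\<mu> \<le> b x" "b y \<le> \<mu>" using bE[OF xE] bF[OF True] by auto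
            then show ?thesis using k_ge[OF True False] by (intro mult_mono) auto
          qed
          then show ?thesis using True by (simp add: left_diff_distrib)
        qed simp
      qed
      also have "(LINT y|gauss. (b x - \<mu>) * ?kmin * indicator F y) = (b x - \<mu>) * (?kmin * measure gauss F)"
        using fF by simp
      finally show "(b x - \<mu>) * (?kmin * measure gauss F) \<le> commutator a \<beta> b (indicator F) x"
        unfolding comm .
    qed
  qed
qed

text \<open>Integrate the pointwise lower bound over E and apply Hoelder's inequality with the
  indicator of E. With u = \<open>wt c * l ^ n\<close>, the kernel is at least a constant times u ^
  (\<beta> - 1), and F has measure comparable to u, E at most of that order. The powers of u combine
  to u, that is, to the volume of the cube after the weight is removed.\<close>

lemma commutator_controls_half:
  fixes a \<beta> p q :: real
  assumes "0 < a" "0 < \<beta>" "\<beta> < 1" "1 < p" "p < q" and pq: "1 / q = 1 / p - \<beta>"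
  obtains \<epsilon> C :: real where "0 < \<epsilon>" "0 \<le> C"
    "\<And>(b :: real ^ 'n \<Rightarrow> real) N c l \<mu> E F. b \<in> Lp 1 \<Longrightarrow> 0 \<le> N \<Longrightarrow> 0 < l \<Longrightarrow> l \<le> \<epsilon> * admissible c \<Longrightarrow>
      E \<in> sets borel \<Longrightarrow> F \<in> sets borel \<Longrightarrow> E \<subseteq> cube c l \<Longrightarrow> F \<subseteq> cube c l \<Longrightarrow>
      (\<And>x. x \<in> E \<Longrightarrow> \<mu> \<le> b x) \<Longrightarrow> (\<And>x. x \<in> F \<Longrightarrow> b x \<le> \<mu>) \<Longrightarrow>
      ennreal (l ^ CARD('n) / 2) \<le> emeasure lborel F \<Longrightarrow>
      commutator a \<beta> b (indicator F) \<in> borel_measurable borel \<Longrightarrow>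
      Lp_norm q (commutator a \<beta> b (indicator F)) \<le> ennreal N * ennreal_powr (emeasure gauss F) (1 / p) \<Longrightarrow>
      (\<integral>\<^sup>+x\<in>E. ennreal (b x - \<mu>) \<partial>lborel) \<le> ennreal (C * N * l ^ CARD('n))"
proof -
  let ?n = "CARD('n)" and ?g = "gauss_const TYPE('n)"
  have n1: "1 \<le> real ?n" by (simp add: Suc_leI)
  obtain D :: real where "1 \<le> D" and D: "\<And>x y :: real ^ 'n. norm (x - y) \<le> 1 * admissible x \<Longrightarrow>
      wt x \<le> D * wt y \<and> wt y \<le> D * wt x \<and>
      admissible x \<le> D * admissible y \<and> admissible y \<le> D * admissible x"
    using wt_admissible_comparable[of 1] by auto
  \<comment> \<open>The cube then lies within the admissible radius of its corner, so D applies, and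
    inside \<open>ball x (a * admissible x)\<close> for each of its points x; the 2 makes the latter
    strict.\<close>
  define \<epsilon> where "\<epsilon> = min 1 (a / (2 * D)) / real ?n"
  have "0 < \<epsilon>" using \<open>0 < a\<close> \<open>1 \<le> D\<close> n1 by (simp add: \<epsilon>_def)
  define C where "C = D / ?g * (?g / (2 * D)) powr (1 / p - 1) * (?g * D) powr (1 - 1 / q) * (D * real ?n ^ ?n) powr (1 - \<beta>)"
  show ?thesis
  proof (rule that[of \<epsilon> C])
    show "0 < \<epsilon>" by fact
    show "0 \<le> C" using \<open>1 \<le> D\<close> by (simp add: C_def)
    fix b :: "real ^ 'n \<Rightarrow> real" and N l \<mu> :: real and c :: "real ^ 'n" and E F :: "(real ^ 'n) set"
    assume b: "b \<in> Lp 1" and "0 \<le> N" and l: "0 < l" "l \<le> \<epsilon> * admissible c"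
      and [measurable]: "E \<in> sets borel" "F \<in> sets borel" and EQ: "E \<subseteq> cube c l" and FQ: "F \<subseteq> cube c l"
      and bE: "\<And>x. x \<in> E \<Longrightarrow> \<mu> \<le> b x" and bF: "\<And>x. x \<in> F \<Longrightarrow> b x \<le> \<mu>"
      and half: "ennreal (l ^ ?n / 2) \<le> emeasure lborel F"
      and cm [measurable]: "commutator a \<beta> b (indicator F) \<in> borel_measurable borel"
      and norm: "Lp_norm q (commutator a \<beta> b (indicator F)) \<le> ennreal N * ennreal_powr (emeasure gauss F) (1 / p)"
    have [measurable]: "b \<in> borel_measurable borel" using b by (simp add: Lp_def)
    have "real ?n * l \<le> real ?n * (\<epsilon> * admissible c)" using l by (intro mult_left_mono) auto
    also have "\<dots> = min 1 (a / (2 * D)) * admissible c" by (simp add: \<epsilon>_def)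
    finally have nl0: "real ?n * l \<le> min 1 (a / (2 * D)) * admissible c" .
    have "min 1 (a / (2 * D)) * admissible c \<le> 1 * admissible c" "min 1 (a / (2 * D)) * admissible c \<le> a / (2 * D) * admissible c"
      by (intro mult_right_mono; simp)+
    with nl0 have nl: "real ?n * l \<le> 1 * admissible c" "real ?n * l \<le> a / (2 * D) * admissible c" by linarith+
    have near: "wt c \<le> D * wt x \<and> wt x \<le> D * wt c \<and> admissible c \<le> D * admissible x" if "x \<in> cube c l" for x
    proof -
      have "norm (c - x) \<le> 1 * admissible c"
        using norm_corner_diff_le[OF that] nl by (simp add: norm_minus_commute)
      then show ?thesis using D by blast
    qed
    have inball: "y \<in> ball x (a * admissible x)" if "x \<in> cube c l" "y \<in> cube c l" for x y
    proof -
      have "norm (x - y) \<le> a / (2 * D) * admissible c" using norm_diff_cube_le[OF that] nl by linarith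
      also have "\<dots> \<le> a / (2 * D) * (D * admissible x)"
        using near[OF that(1)] \<open>0 < a\<close> \<open>1 \<le> D\<close> by (intro mult_left_mono) auto
      also have "\<dots> = a / 2 * admissible x" using \<open>1 \<le> D\<close> by simp
      also have "\<dots> < a * admissible x" using \<open>0 < a\<close> by (intro mult_strict_right_mono) auto
      finally show ?thesis by (simp add: dist_norm)
    qed
    define u where "u = wt c * l ^ ?n"
    have "0 < u" using l by (simp add: u_def)
    have gQ: "emeasure gauss (cube c l) \<le> ennreal (?g * D * u)"
    proof -
      have "emeasure gauss (cube c l) \<le> ennreal (?g * (D * wt c)) * emeasure lborel (cube c l)"
        using near by (intro emeasure_gauss_le_local) auto
      also have "\<dots> = ennreal (?g * D * u)"
        using l \<open>1 \<le> D\<close> by (simp add: emeasure_cube ennreal_mult[symmetric] u_def mult_ac)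
      finally show ?thesis .
    qed
    have "emeasure gauss F \<le> emeasure gauss (cube c l)" "emeasure gauss E \<le> emeasure gauss (cube c l)"
      using FQ EQ by (intro emeasure_mono; simp)+
    then have gF: "emeasure gauss F \<le> ennreal (?g * D * u)" and gE: "emeasure gauss E \<le> ennreal (?g * D * u)"
      using gQ by auto
    define \<phi> where "\<phi> = measure gauss F"
    have eF: "emeasure gauss F = ennreal \<phi>"
      unfolding \<phi>_def using gF by (intro emeasure_eq_ennreal_measure) (auto simp: top_unique)
    have "0 \<le> \<phi>" by (simp add: \<phi>_def)
    have "ennreal (l ^ ?n / 2) \<le> ennreal (D / (?g * wt c)) * ennreal \<phi>"
    proof -
      have "emeasure lborel F \<le> ennreal (D / (?g * wt c)) * emeasure gauss F"
        using near FQ \<open>1 \<le> D\<close> by (intro emeasure_gauss_ge_local) auto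
      then show ?thesis using half unfolding eF by (rule order_trans[rotated])
    qed
    also have "\<dots> = ennreal (D / (?g * wt c) * \<phi>)" using \<open>1 \<le> D\<close> \<open>0 \<le> \<phi>\<close> by (subst ennreal_mult[symmetric]) auto
    finally have "l ^ ?n / 2 \<le> D / (?g * wt c) * \<phi>"
      by (rule ennreal_le_iff[THEN iffD1, rotated]) (use \<open>1 \<le> D\<close> \<open>0 \<le> \<phi>\<close> in simp)
    then have "l ^ ?n / 2 * (?g * wt c) \<le> D / (?g * wt c) * \<phi> * (?g * wt c)" by (rule mult_right_mono) simp
    moreover have "D / (?g * wt c) * \<phi> * (?g * wt c) = D * \<phi>"
      using wt_pos[of c] by (simp add: field_simps del: wt_pos)
    ultimately have \<phi>0: "?g / (2 * D) * u \<le> \<phi>" using \<open>1 \<le> D\<close> by (simp add: u_def field_simps)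
    have "0 < ?g / (2 * D) * u" using \<open>0 < u\<close> \<open>1 \<le> D\<close> by simp
    then have "0 < \<phi>" using \<phi>0 by linarith
    define kmin where "kmin = 1 / (D * wt c * (real ?n * l) ^ ?n) powr (1 - \<beta>)"
    have kmin: "kmin = 1 / (D * real ?n ^ ?n * u) powr (1 - \<beta>)"
      by (simp add: kmin_def u_def power_mult_distrib mult_ac)
    have "0 < kmin" unfolding kmin using \<open>0 < u\<close> \<open>1 \<le> D\<close> by simp
    let ?T = "commutator a \<beta> b (indicator F)"
    have ae: "AE x in gauss. x \<in> E \<longrightarrow> (b x - \<mu>) * (kmin * \<phi>) \<le> ?T x"
      unfolding kmin_def \<phi>_def
      by (rule commutator_indicator_ge[OF assms(2,3) b l(1) inball _ _ FQ EQ bE bF]) (use near in auto)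
    have "ennreal (kmin * \<phi>) * (\<integral>\<^sup>+x\<in>E. ennreal (b x - \<mu>) \<partial>gauss) = (\<integral>\<^sup>+x. ennreal (kmin * \<phi>) * (ennreal (b x - \<mu>) * indicator E x) \<partial>gauss)"
      by (intro nn_integral_cmult[symmetric]) measurable
    also have "\<dots> \<le> (\<integral>\<^sup>+x. ennreal \<bar>?T x\<bar> * indicator E x \<partial>gauss)"
    proof (rule nn_integral_mono_AE, use ae in eventually_elim)
      case (elim x)
      show ?case
      proof (cases "x \<in> E")
        case True
        then have "ennreal (kmin * \<phi>) * ennreal (b x - \<mu>) = ennreal ((b x - \<mu>) * (kmin * \<phi>))"
          using bE[OF True] \<open>0 < kmin\<close> \<open>0 \<le> \<phi>\<close> by (subst ennreal_mult[symmetric]) (auto simp: mult_ac)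
        also have "\<dots> \<le> ennreal \<bar>?T x\<bar>" using elim True by (intro ennreal_leI) auto
        finally show ?thesis using True by simp
      qed simp
    qed
    also have "\<dots> \<le> ennreal_powr (\<integral>\<^sup>+x. ennreal_powr (ennreal \<bar>?T x\<bar>) q \<partial>gauss) (1 / q)
        * ennreal_powr (\<integral>\<^sup>+x. ennreal_powr (indicator E x) (q / (q - 1)) \<partial>gauss) (1 / (q / (q - 1)))"
      using assms by (intro nn_integral_Hoelder) (auto simp: field_simps)
    also have "ennreal_powr (\<integral>\<^sup>+x. ennreal_powr (ennreal \<bar>?T x\<bar>) q \<partial>gauss) (1 / q) = Lp_norm q ?T"
      by (simp add: Lp_norm_def eLp_norm_def)
    also have "(\<integral>\<^sup>+x. ennreal_powr (indicator E x) (q / (q - 1)) \<partial>gauss) = (\<integral>\<^sup>+x. indicator E x \<partial>gauss)"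
      by (intro nn_integral_cong) (auto simp: indicator_def)
    also have "\<dots> = emeasure gauss E" by simp
    also have "1 / (q / (q - 1)) = 1 - 1 / q" using assms by (simp add: field_simps)
    also have "Lp_norm q ?T * ennreal_powr (emeasure gauss E) (1 - 1 / q)
      \<le> (ennreal N * ennreal_powr (ennreal \<phi>) (1 / p)) * ennreal_powr (ennreal (?g * D * u)) (1 - 1 / q)"
    proof -
      have "0 \<le> 1 - 1 / q" using \<open>1 < p\<close> \<open>p < q\<close> by simp
      then show ?thesis using norm unfolding eF by (intro mult_mono ennreal_powr_mono gE) auto
    qed
    also have "\<dots> = ennreal (N * \<phi> powr (1 / p) * (?g * D * u) powr (1 - 1 / q))"
    proof -
      have "ennreal_powr (ennreal (?g * D * u)) (1 - 1 / q) = ennreal ((?g * D * u) powr (1 - 1 / q))"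
        using \<open>0 < u\<close> \<open>1 \<le> D\<close> by (intro ennreal_powr_ennreal) simp
      then show ?thesis using \<open>0 \<le> N\<close> \<open>0 \<le> \<phi>\<close> by (simp only: ennreal_powr_ennreal) (simp add: ennreal_mult)
    qed
    finally have main: "ennreal (kmin * \<phi>) * (\<integral>\<^sup>+x\<in>E. ennreal (b x - \<mu>) \<partial>gauss)
      \<le> ennreal (N * \<phi> powr (1 / p) * (?g * D * u) powr (1 - 1 / q))" .
    have real_ineq: "D / (?g * wt c) * (1 / (kmin * \<phi>) * (N * \<phi> powr (1 / p) * (?g * D * u) powr (1 - 1 / q))) \<le> C * N * l ^ ?n"
    proof -
      have "1 / \<phi> * \<phi> powr (1 / p) = \<phi> powr (1 / p - 1)"
        using \<open>0 < \<phi>\<close> by (simp add: powr_diff)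
      \<comment> \<open>The exponent 1 / p - 1 is negative, so the lower bound for the measure of F
        is what counts; it comes from the median.\<close>
      also have "\<dots> \<le> (?g / (2 * D) * u) powr (1 / p - 1)"
        using \<phi>0 \<open>0 < ?g / (2 * D) * u\<close> \<open>1 < p\<close> by (intro powr_mono2') auto
      finally have 1: "1 / \<phi> * \<phi> powr (1 / p) \<le> (?g / (2 * D)) powr (1 / p - 1) * u powr (1 / p - 1)" by (simp only: powr_mult)
      have 2: "1 / kmin = (D * real ?n ^ ?n) powr (1 - \<beta>) * u powr (1 - \<beta>)" unfolding kmin by (simp add: powr_mult)
      have 3: "(?g * D * u) powr (1 - 1 / q) = (?g * D) powr (1 - 1 / q) * u powr (1 - 1 / q)" by (simp only: powr_mult)
      \<comment> \<open>The exponents add up to 1 precisely by 1 / q = 1 / p - \<beta>.\<close>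
      have 4: "u powr (1 / p - 1) * u powr (1 - 1 / q) * u powr (1 - \<beta>) = u"
        using \<open>0 < u\<close> pq by (simp add: powr_add[symmetric])
      have "D / (?g * wt c) * (1 / (kmin * \<phi>) * (N * \<phi> powr (1 / p) * (?g * D * u) powr (1 - 1 / q)))
        = (D / (?g * wt c) * N * (?g * D * u) powr (1 - 1 / q) * (1 / kmin)) * (1 / \<phi> * \<phi> powr (1 / p))"
        by (simp add: mult_ac)
      also have "\<dots> \<le> (D / (?g * wt c) * N * (?g * D * u) powr (1 - 1 / q) * (1 / kmin)) * ((?g / (2 * D)) powr (1 / p - 1) * u powr (1 / p - 1))"
        using \<open>0 \<le> N\<close> \<open>1 \<le> D\<close> \<open>0 < kmin\<close> by (intro mult_left_mono 1) auto
      also have "\<dots> = D / (?g * wt c) * N * ((?g * D) powr (1 - 1 / q) * (D * real ?n ^ ?n) powr (1 - \<beta>) * (?g / (2 * D)) powr (1 / p - 1))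
        * (u powr (1 / p - 1) * u powr (1 - 1 / q) * u powr (1 - \<beta>))"
        unfolding 2 3 by (simp only: mult_ac)
      also have "\<dots> = C * N * l ^ ?n"
        unfolding 4 unfolding C_def u_def using wt_pos[of c] by (simp add: field_simps del: wt_pos)
      finally show ?thesis .
    qed
    have "(\<integral>\<^sup>+x\<in>E. ennreal (b x - \<mu>) \<partial>lborel) \<le> ennreal (D / (?g * wt c)) * (\<integral>\<^sup>+x\<in>E. ennreal (b x - \<mu>) \<partial>gauss)"
      using near EQ \<open>1 \<le> D\<close> by (intro nn_integral_lborel_le_gauss_local) auto
    also have "(\<integral>\<^sup>+x\<in>E. ennreal (b x - \<mu>) \<partial>gauss)
      = ennreal (1 / (kmin * \<phi>)) * (ennreal (kmin * \<phi>) * (\<integral>\<^sup>+x\<in>E. ennreal (b x - \<mu>) \<partial>gauss))"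
      using \<open>0 < kmin\<close> \<open>0 < \<phi>\<close> by (simp add: mult.assoc[symmetric] ennreal_mult[symmetric] del: mult_pos_pos)
    also have "ennreal (D / (?g * wt c)) * \<dots> \<le> ennreal (D / (?g * wt c)) * (ennreal (1 / (kmin * \<phi>)) * ennreal (N * \<phi> powr (1 / p) * (?g * D * u) powr (1 - 1 / q)))"
      by (intro mult_left_mono main) auto
    also have "\<dots> = ennreal (D / (?g * wt c) * (1 / (kmin * \<phi>) * (N * \<phi> powr (1 / p) * (?g * D * u) powr (1 - 1 / q))))"
      using \<open>0 < kmin\<close> \<open>0 \<le> \<phi>\<close> \<open>0 \<le> N\<close> \<open>1 \<le> D\<close> by (simp add: ennreal_mult[symmetric])
    also have "\<dots> \<le> ennreal (C * N * l ^ ?n)" by (intro ennreal_leI real_ineq)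
    finally show "(\<integral>\<^sup>+x\<in>E. ennreal (b x - \<mu>) \<partial>lborel) \<le> ennreal (C * N * l ^ ?n)" .
  qed
qed

lemma commutator_uminus:
  "commutator a \<beta> (\<lambda>y. - b y) f x = - commutator a \<beta> b f x"
  by (simp add: commutator_def frac_int_def set_lebesgue_integral_def)

text \<open>The two halves of the cube at the median exchange roles: the indicator of the lower half
  controls b - \<mu> above, and the indicator of the upper half, with - b for b, controls \<mu> - b
  below.\<close>

lemma osc_le_of_commutator:
  fixes a \<beta> p q :: real
  assumes "0 < a" "0 < \<beta>" "\<beta> < 1" "1 < p" "p < q" "1 / q = 1 / p - \<beta>"
  obtains \<epsilon> C :: real where "0 < \<epsilon>" "0 \<le> C"
    "\<And>(b :: real ^ 'n \<Rightarrow> real) N c l. b \<in> Lp 1 \<Longrightarrow> 0 \<le> N \<Longrightarrow>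
      (\<And>F. F \<in> sets borel \<Longrightarrow> bounded F \<Longrightarrow> emeasure lborel F \<noteq> 0 \<Longrightarrow>
        commutator a \<beta> b (indicator F) \<in> borel_measurable borel \<and>
        Lp_norm q (commutator a \<beta> b (indicator F)) \<le> ennreal N * ennreal_powr (emeasure gauss F) (1 / p)) \<Longrightarrow>
      0 < l \<Longrightarrow> l \<le> \<epsilon> * admissible c \<Longrightarrow> osc_le b (C * N) c l"
proof -
  let ?n = "CARD('n)"
  obtain \<epsilon> C :: real where "0 < \<epsilon>" "0 \<le> C" and C:
    "\<And>(b :: real ^ 'n \<Rightarrow> real) N c l \<mu> E F. b \<in> Lp 1 \<Longrightarrow> 0 \<le> N \<Longrightarrow> 0 < l \<Longrightarrow> l \<le> \<epsilon> * admissible c \<Longrightarrow>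
      E \<in> sets borel \<Longrightarrow> F \<in> sets borel \<Longrightarrow> E \<subseteq> cube c l \<Longrightarrow> F \<subseteq> cube c l \<Longrightarrow>
      (\<And>x. x \<in> E \<Longrightarrow> \<mu> \<le> b x) \<Longrightarrow> (\<And>x. x \<in> F \<Longrightarrow> b x \<le> \<mu>) \<Longrightarrow>
      ennreal (l ^ CARD('n) / 2) \<le> emeasure lborel F \<Longrightarrow>
      commutator a \<beta> b (indicator F) \<in> borel_measurable borel \<Longrightarrow>
      Lp_norm q (commutator a \<beta> b (indicator F)) \<le> ennreal N * ennreal_powr (emeasure gauss F) (1 / p) \<Longrightarrow>
      (\<integral>\<^sup>+x\<in>E. ennreal (b x - \<mu>) \<partial>lborel) \<le> ennreal (C * N * l ^ CARD('n))"
    by (rule commutator_controls_half[OF assms, where 'n='n]) blast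
  show ?thesis
  proof (rule that[of \<epsilon> "2 * C"])
    show "0 < \<epsilon>" "0 \<le> 2 * C" using \<open>0 < \<epsilon>\<close> \<open>0 \<le> C\<close> by auto
    fix b :: "real ^ 'n \<Rightarrow> real" and N l :: real and c :: "real ^ 'n"
    assume b: "b \<in> Lp 1" and N: "0 \<le> N" and l: "0 < l" "l \<le> \<epsilon> * admissible c"
      and test: "\<And>F. F \<in> sets borel \<Longrightarrow> bounded F \<Longrightarrow> emeasure lborel F \<noteq> 0 \<Longrightarrow>
        commutator a \<beta> b (indicator F) \<in> borel_measurable borel \<and>
        Lp_norm q (commutator a \<beta> b (indicator F)) \<le> ennreal N * ennreal_powr (emeasure gauss F) (1 / p)"
    have [measurable]: "b \<in> borel_measurable borel" using b by (simp add: Lp_def)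
    have b': "(\<lambda>x. - b x) \<in> Lp 1" using Lp_cmult[OF _ b, of "-1"] by simp
    have bdd: "bounded (cube c l)"
      using norm_diff_cube_le[of _ c l c] corner_in_cube[OF l(1), of c]
      by (auto simp: bounded_def dist_norm norm_minus_commute intro!: exI[of _ c] exI[of _ "real ?n * l"])
    obtain \<mu> where \<mu>: "ennreal (l ^ ?n / 2) \<le> emeasure lborel {x \<in> cube c l. \<mu> \<le> b x}"
      "ennreal (l ^ ?n / 2) \<le> emeasure lborel {x \<in> cube c l. b x \<le> \<mu>}"
      by (rule median_on_cube[of b l c]) (use l in auto)
    define E F where "E = {x \<in> cube c l. \<mu> \<le> b x}" and "F = {x \<in> cube c l. b x \<le> \<mu>}"
    have sub: "E \<subseteq> cube c l" "F \<subseteq> cube c l" by (auto simp: E_def F_def)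
    have [measurable]: "E \<in> sets borel" "F \<in> sets borel" by (simp_all add: E_def F_def)
    have pos: "0 < ennreal (l ^ ?n / 2)" using l by simp
    have ne: "emeasure lborel E \<noteq> 0" "emeasure lborel F \<noteq> 0"
      using order_less_le_trans[OF pos \<mu>(1)] order_less_le_trans[OF pos \<mu>(2)] unfolding E_def F_def by simp_all
    have tF: "commutator a \<beta> b (indicator F) \<in> borel_measurable borel"
      "Lp_norm q (commutator a \<beta> b (indicator F)) \<le> ennreal N * ennreal_powr (emeasure gauss F) (1 / p)"
      using test[of F] ne bounded_subset[OF bdd sub(2)] by auto
    have tE: "commutator a \<beta> b (indicator E) \<in> borel_measurable borel"
      "Lp_norm q (commutator a \<beta> b (indicator E)) \<le> ennreal N * ennreal_powr (emeasure gauss E) (1 / p)"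
      using test[of E] ne bounded_subset[OF bdd sub(1)] by auto
    have um: "commutator a \<beta> (\<lambda>y. - b y) (indicator E) = (\<lambda>x. - commutator a \<beta> b (indicator E) x)"
      by (intro ext commutator_uminus)
    have 1: "(\<integral>\<^sup>+x\<in>E. ennreal (b x - \<mu>) \<partial>lborel) \<le> ennreal (C * N * l ^ ?n)"
      by (rule C[where F = F and c = c and N = N, OF b N l _ _ sub]) (use \<mu> tF in \<open>auto simp: E_def F_def\<close>)
    have 2: "(\<integral>\<^sup>+x\<in>F. ennreal (- b x - - \<mu>) \<partial>lborel) \<le> ennreal (C * N * l ^ ?n)"
    proof (rule C[where F = E and c = c and N = N, OF b' N l _ _ sub(2) sub(1)])
      show "commutator a \<beta> (\<lambda>y. - b y) (indicator E) \<in> borel_measurable borel"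
        unfolding um using tE(1) by measurable
      show "Lp_norm q (commutator a \<beta> (\<lambda>y. - b y) (indicator E)) \<le> ennreal N * ennreal_powr (emeasure gauss E) (1 / p)"
        unfolding um using tE(2) by (simp add: Lp_norm_def)
    qed (use \<mu> in \<open>auto simp: E_def F_def\<close>)
    have "(\<integral>\<^sup>+x\<in>cube c l. ennreal \<bar>b x - \<mu>\<bar> \<partial>lborel)
      \<le> (\<integral>\<^sup>+x. ennreal (b x - \<mu>) * indicator E x + ennreal (- b x - - \<mu>) * indicator F x \<partial>lborel)"
      by (intro nn_integral_mono) (auto simp: E_def F_def indicator_def)
    also have "\<dots> = (\<integral>\<^sup>+x\<in>E. ennreal (b x - \<mu>) \<partial>lborel) + (\<integral>\<^sup>+x\<in>F. ennreal (- b x - - \<mu>) \<partial>lborel)"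
      by (intro nn_integral_add) measurable
    also have "\<dots> \<le> ennreal (C * N * l ^ ?n) + ennreal (C * N * l ^ ?n)" by (intro add_mono 1 2)
    also have "\<dots> = ennreal (2 * C * N * l ^ ?n)"
      using \<open>0 \<le> C\<close> N l by (subst ennreal_plus[symmetric]) auto
    finally show "osc_le b (2 * C * N) c l" unfolding osc_le_def by blast
  qed
qed

text \<open>The average differs from d by at most the mean of |b - d|, so replacing d by it at most
  doubles the integral.\<close>

lemma ball_avg_best_constant:
  fixes b :: "real ^ 'n \<Rightarrow> real"
  assumes b: "b \<in> Lp 1" and B [measurable]: "B \<in> sets borel"
    and pos: "emeasure gauss B \<noteq> 0" and fin: "emeasure gauss B < \<infinity>"
  shows "(\<integral>\<^sup>+x\<in>B. ennreal \<bar>b x - ball_avg b B\<bar> \<partial>gauss) \<le> 2 * (\<integral>\<^sup>+x\<in>B. ennreal \<bar>b x - d\<bar> \<partial>gauss)"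
proof -
  have [measurable]: "b \<in> borel_measurable borel" using b by (simp add: Lp_def)
  let ?J = "\<integral>\<^sup>+x\<in>B. ennreal \<bar>b x - d\<bar> \<partial>gauss"
  have eB: "emeasure gauss B = ennreal (measure gauss B)"
    using fin by (intro emeasure_eq_ennreal_measure) auto
  have mB: "0 < measure gauss B" using pos fin by (simp add: measure_def enn2real_positive_iff zero_less_iff_neq_zero less_top)
  have ib: "set_integrable gauss B b"
    unfolding set_integrable_def using integrable_Lp_1[OF b] by (intro integrable_mult_indicator) auto
  have id: "set_integrable gauss B (\<lambda>x. d)"
    unfolding set_integrable_def using fin by (intro integrable_scaleR_left) auto
  have "(LINT x:B|gauss. b x - d) = ball_avg b B * measure gauss B - d * measure gauss B"
    using ib id mB fin by (simp add: set_integral_diff ball_avg_def set_integral_const)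
  then have "\<bar>ball_avg b B - d\<bar> * measure gauss B = norm (LINT x:B|gauss. b x - d)"
    using mB by (simp add: left_diff_distrib[symmetric] abs_mult)
  also have "ennreal \<dots> \<le> (\<integral>\<^sup>+x. ennreal (norm (indicator B x *\<^sub>R (b x - d))) \<partial>gauss)"
    unfolding set_lebesgue_integral_def
    by (intro integral_norm_bound_ennreal) (use set_integral_diff(1)[OF ib id] in \<open>simp add: set_integrable_def\<close>)
  also have "\<dots> = ?J" by (intro nn_integral_cong) (auto simp: indicator_def)
  finally have mean: "ennreal (\<bar>ball_avg b B - d\<bar> * measure gauss B) \<le> ?J" .
  have "(\<integral>\<^sup>+x\<in>B. ennreal \<bar>b x - ball_avg b B\<bar> \<partial>gauss) \<le> ?J + (\<integral>\<^sup>+x\<in>B. ennreal \<bar>d - ball_avg b B\<bar> \<partial>gauss)"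
    by (intro nn_integral_dist_triangle) auto
  also have "(\<integral>\<^sup>+x\<in>B. ennreal \<bar>d - ball_avg b B\<bar> \<partial>gauss) = ennreal (\<bar>ball_avg b B - d\<bar> * measure gauss B)"
    by (subst nn_integral_cmult_indicator) (auto simp: eB ennreal_mult abs_minus_commute)
  also have "?J + \<dots> \<le> ?J + ?J" by (intro add_left_mono mean)
  finally show ?thesis by (simp add: mult_2)
qed

text \<open>An admissible ball of radius r lies in a cube of side 2 r, whose side is at most 2 D
  times the admissible radius of its corner. \<open>osc_le_enlarge\<close> reaches this size from
  arbitrarily small \<epsilon>.\<close>

lemma bmo_of_osc_le:
  fixes \<epsilon> :: real
  assumes "0 < \<epsilon>"
  obtains C :: real where "0 < C"
    "\<And>(b :: real ^ 'n \<Rightarrow> real) \<kappa>. b \<in> Lp 1 \<Longrightarrow> 0 \<le> \<kappa> \<Longrightarrow>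
      (\<And>c l. 0 < l \<Longrightarrow> l \<le> \<epsilon> * admissible c \<Longrightarrow> osc_le b \<kappa> c l) \<Longrightarrow> bmo_seminorm b \<le> ennreal (C * \<kappa>)"
proof -
  let ?n = "CARD('n)" and ?g = "gauss_const TYPE('n)" and ?v = "vball TYPE('n)"
  have n1: "1 \<le> real ?n" by (simp add: Suc_leI)
  obtain D :: real where "1 \<le> D" and D: "\<And>x y :: real ^ 'n. norm (x - y) \<le> real ?n * admissible x \<Longrightarrow>
      wt x \<le> D * wt y \<and> wt y \<le> D * wt x \<and>
      admissible x \<le> D * admissible y \<and> admissible y \<le> D * admissible x"
    using wt_admissible_comparable[of "real ?n"] by auto
  obtain L :: real where "0 < L" and L:
    "\<And>(b :: real ^ 'n \<Rightarrow> real) \<kappa> c l. b \<in> borel_measurable borel \<Longrightarrow> 0 \<le> \<kappa> \<Longrightarrow>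
      (\<And>c l. 0 < l \<Longrightarrow> l \<le> \<epsilon> * admissible c \<Longrightarrow> osc_le b \<kappa> c l) \<Longrightarrow>
      0 < l \<Longrightarrow> l \<le> 2 * D * admissible c \<Longrightarrow> osc_le b (L * \<kappa>) c l"
    by (rule osc_le_enlarge[OF \<open>0 < \<epsilon>\<close>, of "2 * D", where 'n='n]) (use \<open>1 \<le> D\<close> in \<open>simp, blast\<close>)
  \<comment> \<open>The 2 is for the average in place of the best constant, D^2 for the two changes
    of measure, and 2 ^ n / v for the volume of the cube relative to the ball.\<close>
  define C where "C = 2 * (D\<^sup>2 * L * 2 ^ ?n / ?v)"
  show ?thesis
  proof (rule that[of C])
    show "0 < C" using \<open>0 < L\<close> \<open>1 \<le> D\<close> by (simp add: C_def)
    fix b :: "real ^ 'n \<Rightarrow> real" and \<kappa> :: real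
    assume b: "b \<in> Lp 1" and "0 \<le> \<kappa>"
      and small: "\<And>c l. 0 < l \<Longrightarrow> l \<le> \<epsilon> * admissible c \<Longrightarrow> osc_le b \<kappa> c l"
    have [measurable]: "b \<in> borel_measurable borel" using b by (simp add: Lp_def)
    show "bmo_seminorm b \<le> ennreal (C * \<kappa>)"
      unfolding bmo_seminorm_def
    proof (rule SUP_least)
      fix B :: "(real ^ 'n) set" assume "B \<in> adm_balls 1"
      then obtain c0 r where B: "B = ball c0 r" and r: "0 < r" "r \<le> admissible c0" by (auto simp: adm_balls_def)
      have [measurable]: "B \<in> sets borel" by (simp add: B)
      have near: "wt c0 \<le> D * wt x \<and> wt x \<le> D * wt c0" if "x \<in> B" for x
      proof -
        have "norm (c0 - x) \<le> 1 * admissible c0" using that r by (simp add: B dist_norm)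
        also have "\<dots> \<le> real ?n * admissible c0" using n1 by (intro mult_right_mono) auto
        finally show ?thesis using D by blast
      qed
      define c where "c = (\<chi> i. c0 $ i - r)"
      have "norm (c0 - c) \<le> real ?n * r" using r by (intro norm_le_card_mult) (simp add: c_def)
      also have "\<dots> \<le> real ?n * admissible c0" using r by (intro mult_left_mono) auto
      finally have "admissible c0 \<le> D * admissible c" using D by blast
      then have "2 * r \<le> 2 * D * admissible c" using r by linarith
      then have "osc_le b (L * \<kappa>) c (2 * r)" using r \<open>0 \<le> \<kappa>\<close> small by (intro L) auto
      then obtain d where d: "(\<integral>\<^sup>+x\<in>cube c (2 * r). ennreal \<bar>b x - d\<bar> \<partial>lborel) \<le> ennreal (L * \<kappa> * (2 * r) ^ ?n)"
        by (auto simp: osc_le_def)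
      have sub: "B \<subseteq> cube c (2 * r)"
      proof
        fix x assume "x \<in> B"
        then have "norm (x - c0) < r" by (simp add: B dist_norm norm_minus_commute)
        then have "\<bar>x $ i - c0 $ i\<bar> < r" for i
          using component_le_norm_cart[of "x - c0" i] by simp
        then show "x \<in> cube c (2 * r)" by (auto simp: cube_def c_def abs_less_iff) (smt (verit))+
      qed
      have up: "(\<integral>\<^sup>+x\<in>B. ennreal \<bar>b x - d\<bar> \<partial>gauss) \<le> ennreal (?g * (D * wt c0)) * ennreal (L * \<kappa> * (2 * r) ^ ?n)"
      proof -
        have "(\<integral>\<^sup>+x\<in>B. ennreal \<bar>b x - d\<bar> \<partial>gauss) \<le> ennreal (?g * (D * wt c0)) * (\<integral>\<^sup>+x\<in>B. ennreal \<bar>b x - d\<bar> \<partial>lborel)"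
          using near by (intro nn_integral_gauss_le_local) auto
        also have "(\<integral>\<^sup>+x\<in>B. ennreal \<bar>b x - d\<bar> \<partial>lborel) \<le> (\<integral>\<^sup>+x\<in>cube c (2 * r). ennreal \<bar>b x - d\<bar> \<partial>lborel)"
          using sub by (intro nn_integral_mono) (auto simp: indicator_def)
        also note d
        finally show ?thesis by (simp add: mult_left_mono)
      qed
      have vB: "emeasure lborel B = ennreal (?v * r ^ ?n)" using r by (simp add: B emeasure_lborel_ball)
      have low: "ennreal (?v * r ^ ?n) \<le> ennreal (D / (?g * wt c0)) * emeasure gauss B"
        unfolding vB[symmetric] using near \<open>1 \<le> D\<close> by (intro emeasure_gauss_ge_local) auto
      have pos: "emeasure gauss B \<noteq> 0" using vB r by (intro emeasure_gauss_pos) auto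
      have fin: "emeasure gauss B < \<infinity>" by (intro emeasure_gauss_finite) (auto simp: B)
      have "(\<integral>\<^sup>+x\<in>B. ennreal \<bar>b x - ball_avg b B\<bar> \<partial>gauss) \<le> 2 * (\<integral>\<^sup>+x\<in>B. ennreal \<bar>b x - d\<bar> \<partial>gauss)"
        by (rule ball_avg_best_constant[OF b _ pos fin]) simp
      also have "\<dots> \<le> 2 * (ennreal (?g * (D * wt c0)) * ennreal (L * \<kappa> * (2 * r) ^ ?n))"
        by (intro mult_left_mono up) auto
      also have "\<dots> = ennreal (2 * (D * L * \<kappa> * 2 ^ ?n / ?v) * ?g * wt c0) * ennreal (?v * r ^ ?n)"
      proof -
        have "2 * (ennreal (?g * (D * wt c0)) * ennreal (L * \<kappa> * (2 * r) ^ ?n)) = ennreal 2 * ennreal (?g * (D * wt c0) * (L * \<kappa> * (2 * r) ^ ?n))"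
          using \<open>1 \<le> D\<close> by (subst ennreal_mult'[symmetric]) auto
        also have "\<dots> = ennreal (2 * (?g * (D * wt c0) * (L * \<kappa> * (2 * r) ^ ?n)))"
          by (rule ennreal_mult'[symmetric]) simp
        also have "2 * (?g * (D * wt c0) * (L * \<kappa> * (2 * r) ^ ?n)) = 2 * (D * L * \<kappa> * 2 ^ ?n / ?v) * ?g * wt c0 * (?v * r ^ ?n)"
          by (simp add: power_mult_distrib)
        finally show ?thesis using \<open>1 \<le> D\<close> \<open>0 < L\<close> \<open>0 \<le> \<kappa>\<close> by (subst ennreal_mult'[symmetric]) auto
      qed
      also have "\<dots> \<le> ennreal (2 * (D * L * \<kappa> * 2 ^ ?n / ?v) * ?g * wt c0) * (ennreal (D / (?g * wt c0)) * emeasure gauss B)"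
        by (intro mult_left_mono low) auto
      also have "\<dots> = ennreal (C * \<kappa>) * emeasure gauss B"
      proof -
        have "ennreal (2 * (D * L * \<kappa> * 2 ^ ?n / ?v) * ?g * wt c0) * ennreal (D / (?g * wt c0))
          = ennreal (2 * (D * L * \<kappa> * 2 ^ ?n / ?v) * ?g * wt c0 * (D / (?g * wt c0)))"
          using \<open>1 \<le> D\<close> \<open>0 < L\<close> \<open>0 \<le> \<kappa>\<close> by (intro ennreal_mult'[symmetric]) auto
        also have "2 * (D * L * \<kappa> * 2 ^ ?n / ?v) * ?g * wt c0 * (D / (?g * wt c0)) = C * \<kappa>"
          using wt_pos[of c0] by (simp add: C_def power2_eq_square del: wt_pos)
        finally show ?thesis by (simp only: mult.assoc[symmetric])
      qed
      finally have "(\<integral>\<^sup>+x\<in>B. ennreal \<bar>b x - ball_avg b B\<bar> \<partial>gauss) / emeasure gauss B \<le> (ennreal (C * \<kappa>) * emeasure gauss B) / emeasure gauss B"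
        by (rule divide_right_mono_ennreal)
      also have "\<dots> = ennreal (C * \<kappa>)"
        using pos fin by (simp add: mult_divide_eq_ennreal less_top)
      finally show "(\<integral>\<^sup>+x\<in>B. ennreal \<bar>b x - ball_avg b B\<bar> \<partial>gauss) / emeasure gauss B \<le> ennreal (C * \<kappa>)" .
    qed
  qed
qed

text \<open>\<open>op_norm\<close> is a supremum over functions of norm exactly 1, so the indicator
  is rescaled by its norm, which is positive because F is not a null set. Measurability is part of
  the membership in Lq that \<open>bounded_op\<close> asserts.\<close>

lemma commutator_test_bound:
  fixes b :: "real ^ 'n \<Rightarrow> real"
  assumes bd: "bounded_op p q (Lp p \<inter> Linf_c) (commutator a \<beta> b)" and "0 < p" "0 < q"
    and F [measurable]: "F \<in> sets borel" and "bounded F" "emeasure lborel F \<noteq> 0"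
  shows "commutator a \<beta> b (indicator F) \<in> borel_measurable borel"
    and "Lp_norm q (commutator a \<beta> b (indicator F))
      \<le> op_norm p q (Lp p \<inter> Linf_c) (commutator a \<beta> b) * ennreal_powr (emeasure gauss F) (1 / p)"
proof -
  have "emeasure gauss F < \<infinity>" "emeasure gauss F \<noteq> 0"
    using emeasure_gauss_finite[OF F \<open>bounded F\<close>] emeasure_gauss_pos[OF F \<open>emeasure lborel F \<noteq> 0\<close>] by auto
  then obtain \<phi> where \<phi>: "emeasure gauss F = ennreal \<phi>" "0 < \<phi>"
    by (cases "emeasure gauss F") (auto simp: less_le)
  define s where "s = \<phi> powr (1 / p)"
  have "0 < s" using \<phi> by (simp add: s_def)
  have "indicator F \<in> (Linf_c :: (real ^ 'n \<Rightarrow> real) set)"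
    unfolding Linf_c_def
    using \<open>bounded F\<close> closure_subset[of F]
    by (auto simp: indicator_def intro!: exI[of _ 1] exI[of _ "closure F"])
  then have scaled: "(\<lambda>x. k * indicator F x) \<in> (Linf_c :: (real ^ 'n \<Rightarrow> real) set)" for k
  proof -
    have "AE x in gauss. \<bar>k * indicator F x\<bar> \<le> \<bar>k\<bar>" by (auto simp: indicator_def)
    moreover have "AE x in gauss. x \<notin> closure F \<longrightarrow> k * indicator F x = 0"
      using closure_subset[of F] by (auto simp: indicator_def)
    ultimately show ?thesis
      unfolding Linf_c_def using \<open>bounded F\<close> by (auto intro!: exI[of _ "closure F"])
  qed
  then have dom: "(\<lambda>x. k * indicator F x) \<in> Lp p \<inter> (Linf_c :: (real ^ 'n \<Rightarrow> real) set)" for k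
    using Linf_c_subset_Lp[OF \<open>0 < p\<close>] by auto
  show meas [measurable]: "commutator a \<beta> b (indicator F) \<in> borel_measurable borel"
    using bd dom[of 1] unfolding bounded_op_def by (auto simp: Lp_def)
  let ?f = "\<lambda>x. inverse s * indicator F x"
  have "(\<integral>\<^sup>+x. ennreal (\<bar>?f x\<bar> powr p) \<partial>gauss) = (\<integral>\<^sup>+x. ennreal (inverse s powr p) * indicator F x \<partial>gauss)"
    using \<open>0 < s\<close> by (intro nn_integral_cong) (auto simp: indicator_def)
  also have "\<dots> = ennreal (inverse s powr p) * ennreal \<phi>"
    unfolding \<phi>(1)[symmetric] by (intro nn_integral_cmult_indicator) simp
  also have "\<dots> = 1"
    using \<phi> \<open>0 < p\<close> by (simp add: s_def ennreal_mult[symmetric] powr_minus[symmetric] powr_powr)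
  finally have "Lp_norm p ?f = 1" by (simp add: Lp_norm_eq)
  then have "Lp_norm q (commutator a \<beta> b ?f) \<le> op_norm p q (Lp p \<inter> Linf_c) (commutator a \<beta> b)"
    unfolding op_norm_def using dom by (intro SUP_upper) auto
  moreover have "commutator a \<beta> b ?f = (\<lambda>x. inverse s * commutator a \<beta> b (indicator F) x)"
  proof
    fix x
    \<comment> \<open>Homogeneity holds at every x, even where the integral diverges, since the
      default value 0 is unchanged by the factor.\<close>
    have 1: "frac_int a \<beta> (\<lambda>y. h y * (inverse s * indicator F y)) x = inverse s * frac_int a \<beta> (\<lambda>y. h y * indicator F y) x" for h
      unfolding frac_int_def set_lebesgue_integral_def
      by (subst integral_mult_right_zero[symmetric]) (auto intro!: Bochner_Integration.integral_cong)
    show "commutator a \<beta> b ?f x = inverse s * commutator a \<beta> b (indicator F) x"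
      using 1[of "\<lambda>_. 1"] 1[of b] by (simp add: commutator_def right_diff_distrib)
  qed
  then have "Lp_norm q (commutator a \<beta> b ?f) = ennreal (inverse s) * Lp_norm q (commutator a \<beta> b (indicator F))"
    unfolding Lp_norm_def using \<open>0 < s\<close> \<open>0 < q\<close>
    by (subst eLp_norm_cmult[symmetric]) (auto simp: abs_mult ennreal_mult)
  ultimately have "ennreal s * (ennreal (inverse s) * Lp_norm q (commutator a \<beta> b (indicator F)))
    \<le> ennreal s * op_norm p q (Lp p \<inter> Linf_c) (commutator a \<beta> b)"
    by (intro mult_left_mono) auto
  moreover have "ennreal s * ennreal (inverse s) = 1" using \<open>0 < s\<close> by (simp add: ennreal_mult[symmetric])
  ultimately have "Lp_norm q (commutator a \<beta> b (indicator F)) \<le> ennreal s * op_norm p q (Lp p \<inter> Linf_c) (commutator a \<beta> b)"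
    by (simp add: mult.assoc[symmetric])
  then show "Lp_norm q (commutator a \<beta> b (indicator F))
      \<le> op_norm p q (Lp p \<inter> Linf_c) (commutator a \<beta> b) * ennreal_powr (emeasure gauss F) (1 / p)"
    using \<phi> by (simp add: s_def mult.commute)
qed

lemma op_norm_finite:
  assumes "bounded_op p q D T"
  shows "op_norm p q D T < \<infinity>"
proof -
  obtain C :: real where C: "\<And>f. f \<in> D \<Longrightarrow> Lp_norm q (T f) \<le> ennreal C * Lp_norm p f"
    using assms unfolding bounded_op_def by blast
  have "op_norm p q D T \<le> ennreal C"
    unfolding op_norm_def
  proof (rule SUP_least)
    fix f assume f: "f \<in> {f \<in> D. Lp_norm p f = 1}"
    then show "Lp_norm q (T f) \<le> ennreal C" using C[of f] by simp
  qed
  then show ?thesis by (simp add: order_le_less_trans)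
qed

theorem theorem1p1:
  fixes a \<beta> p q :: real
  assumes "0 < a" and "0 < \<beta>" and "\<beta> < 1"
    and "1 < p" and "p < q" and "1 / q = 1 / p - \<beta>"
  shows "\<exists>C::real. 0 < C \<and>
    (\<forall>b \<in> (BMO :: (real ^ 'n \<Rightarrow> real) set).
       (\<forall>f\<in>Linf_c. eLp_norm q (abs_commutator a \<beta> b f)
            \<le> ennreal C * bmo_seminorm b * Lp_norm p f) \<and>
       (\<exists>T. bounded_sublinear_extension p q (abs_commutator a \<beta> b) T \<and>
            op_norm p q (Lp p) T \<le> ennreal C * bmo_seminorm b \<and>
            (\<forall>T'. bounded_sublinear_extension p q (abs_commutator a \<beta> b) T' \<longrightarrow>
                  (\<forall>f\<in>Lp p. AE x in gauss. T' f x = T f x)))) \<and>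
    (\<forall>b \<in> (Lp 1 :: (real ^ 'n \<Rightarrow> real) set).
       bounded_op p q (Lp p \<inter> Linf_c) (commutator a \<beta> b) \<longrightarrow>
         b \<in> BMO \<and>
         bmo_norm b \<le> Lp_norm 1 b
            + ennreal C * op_norm p q (Lp p \<inter> Linf_c) (commutator a \<beta> b))"
proof -
  obtain C1 :: real where "0 \<le> C1" and C1:
    "\<And>(b :: real ^ 'n \<Rightarrow> real) f. b \<in> borel_measurable borel \<Longrightarrow> bmo_seminorm b < \<infinity> \<Longrightarrow>
      f \<in> borel_measurable borel \<Longrightarrow> Lp_norm p f < \<infinity> \<Longrightarrow>
      eLp_norm q (abs_commutator a \<beta> b f) \<le> ennreal C1 * bmo_seminorm b * Lp_norm p f"
    using abs_commutator_bound[OF assms(1,3-6), where 'n='n] by blast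
  obtain \<epsilon> C2 :: real where "0 < \<epsilon>" "0 \<le> C2" and C2:
    "\<And>(b :: real ^ 'n \<Rightarrow> real) N c l. b \<in> Lp 1 \<Longrightarrow> 0 \<le> N \<Longrightarrow>
      (\<And>F. F \<in> sets borel \<Longrightarrow> bounded F \<Longrightarrow> emeasure lborel F \<noteq> 0 \<Longrightarrow>
        commutator a \<beta> b (indicator F) \<in> borel_measurable borel \<and>
        Lp_norm q (commutator a \<beta> b (indicator F)) \<le> ennreal N * ennreal_powr (emeasure gauss F) (1 / p)) \<Longrightarrow>
      0 < l \<Longrightarrow> l \<le> \<epsilon> * admissible c \<Longrightarrow> osc_le b (C2 * N) c l"
    by (rule osc_le_of_commutator[OF assms, where 'n='n]) blast
  obtain C3 :: real where "0 < C3" and C3: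
    "\<And>(b :: real ^ 'n \<Rightarrow> real) \<kappa>. b \<in> Lp 1 \<Longrightarrow> 0 \<le> \<kappa> \<Longrightarrow>
      (\<And>c l. 0 < l \<Longrightarrow> l \<le> \<epsilon> * admissible c \<Longrightarrow> osc_le b \<kappa> c l) \<Longrightarrow> bmo_seminorm b \<le> ennreal (C3 * \<kappa>)"
    by (rule bmo_of_osc_le[OF \<open>0 < \<epsilon>\<close>, where 'n='n]) blast
  \<comment> \<open>One constant for both parts; the 1 makes it positive.\<close>
  define C where "C = C1 + C3 * C2 + 1"
  have "0 \<le> C3 * C2" using \<open>0 < C3\<close> \<open>0 \<le> C2\<close> by simp
  then have C: "0 < C" "C1 \<le> C" "C3 * C2 \<le> C" using \<open>0 \<le> C1\<close> unfolding C_def by linarith+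
  show ?thesis
  proof (intro exI[of _ C] conjI ballI impI)
    show "0 < C" by fact
  next
    fix b :: "real ^ 'n \<Rightarrow> real" and f :: "real ^ 'n \<Rightarrow> real" assume b: "b \<in> BMO" and f: "f \<in> Linf_c"
    have "f \<in> Lp p" using f Linf_c_subset_Lp[of p] assms by auto
    then have "eLp_norm q (abs_commutator a \<beta> b f) \<le> ennreal C1 * bmo_seminorm b * Lp_norm p f"
      using b by (intro C1) (auto simp: BMO_def Lp_def)
    also have "\<dots> \<le> ennreal C * bmo_seminorm b * Lp_norm p f"
      using C by (intro mult_right_mono ennreal_leI) auto
    finally show "eLp_norm q (abs_commutator a \<beta> b f) \<le> ennreal C * bmo_seminorm b * Lp_norm p f" .
  next
    fix b :: "real ^ 'n \<Rightarrow> real" assume b: "b \<in> BMO"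
    then have bm: "b \<in> borel_measurable borel" "bmo_seminorm b < \<infinity>" by (auto simp: BMO_def Lp_def)
    let ?T = "\<lambda>f x. enn2real (abs_commutator a \<beta> b f x)"
    have pq: "1 \<le> p" "1 \<le> q" using assms by auto
    have ext: "bounded_sublinear_extension p q (abs_commutator a \<beta> b) ?T"
      and op: "op_norm p q (Lp p) ?T \<le> ennreal C1 * bmo_seminorm b"
      by (rule abs_commutator_extension[OF bm pq \<open>0 \<le> C1\<close>], rule C1[OF bm], assumption+)+
    show "\<exists>T. bounded_sublinear_extension p q (abs_commutator a \<beta> b) T \<and>
            op_norm p q (Lp p) T \<le> ennreal C * bmo_seminorm b \<and>
            (\<forall>T'. bounded_sublinear_extension p q (abs_commutator a \<beta> b) T' \<longrightarrow>
                  (\<forall>f\<in>Lp p. AE x in gauss. T' f x = T f x))"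
    proof (intro exI[of _ ?T] conjI allI impI ballI)
      show "bounded_sublinear_extension p q (abs_commutator a \<beta> b) ?T" by (rule ext)
      have "ennreal C1 * bmo_seminorm b \<le> ennreal C * bmo_seminorm b"
        using C by (intro mult_right_mono ennreal_leI) auto
      with op show "op_norm p q (Lp p) ?T \<le> ennreal C * bmo_seminorm b" by (rule order_trans)
      fix T' and f :: "real ^ 'n \<Rightarrow> real"
      assume "bounded_sublinear_extension p q (abs_commutator a \<beta> b) T'" "f \<in> Lp p"
      then show "AE x in gauss. T' f x = ?T f x"
        by (intro bounded_sublinear_extension_unique[OF ext _ pq])
    qed
  next
    fix b :: "real ^ 'n \<Rightarrow> real"
    assume b: "b \<in> Lp 1" and bd: "bounded_op p q (Lp p \<inter> Linf_c) (commutator a \<beta> b)"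
    let ?N = "op_norm p q (Lp p \<inter> Linf_c) (commutator a \<beta> b)"
    obtain N where N: "?N = ennreal N" "0 \<le> N"
      using op_norm_finite[OF bd] by (cases ?N) auto
    have "0 < p" "0 < q" using assms by auto
    then have "osc_le b (C2 * N) c l" if "0 < l" "l \<le> \<epsilon> * admissible c" for c l
      using commutator_test_bound[OF bd] that N by (intro C2[OF b]) auto
    then have "bmo_seminorm b \<le> ennreal (C3 * (C2 * N))"
      using \<open>0 \<le> C2\<close> N by (intro C3 b) auto
    also have "\<dots> = ennreal (C3 * C2) * ennreal N"
      using N \<open>0 \<le> C3 * C2\<close> by (simp add: mult.assoc[symmetric] ennreal_mult)
    also have "\<dots> \<le> ennreal C * ?N"
      unfolding N using C by (intro mult_right_mono ennreal_leI) auto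
    finally have semi: "bmo_seminorm b \<le> ennreal C * ?N" .
    then show "bmo_norm b \<le> Lp_norm 1 b + ennreal C * ?N"
      unfolding bmo_norm_def by (subst add.commute) (rule add_left_mono)
    have "ennreal C * ?N < \<infinity>" by (simp add: N ennreal_mult_less_top)
    then show "b \<in> BMO" using b semi by (auto simp: BMO_def intro: order_le_less_trans)
  qed
qed

end
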